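(* There exists a constant $c>0$ such that $$\inf_{\hat\theta\in\mathcal{A}_E(B,\mathcal{B}^{\alpha}_{p,q}(M))}\ \sup_{\theta\in\mathcal{B}^{\alpha}_{p,q}(M)}\mathbb{E}\|\hat\theta-\theta\|^2\ \ge\ c\cdot\begin{cases} M^2B^{-2\alpha} & \text{if } B<\left(\frac{M}{\sigma}\right)^{\frac{2}{2\alpha+1}},\\[4pt] M^{\frac{2}{\alpha+1}}\left(\frac{\sigma^2}{B}\right)^{\frac{\alpha}{\alpha+1}} & \text{if } \left(\frac{M}{\sigma}\right)^{\frac{2}{2\alpha+1}}\le B<\left(\frac{M}{\sigma}\right)^{\frac{2}{2\alpha+1}}m^{\frac{2\alpha+2}{2\alpha+1}},\\[4pt] M^{\frac{2}{2\alpha+1}}\left(\frac{\sigma^2}{m}\right)^{\frac{2\alpha}{2\alpha+1}} & \text{if } B\ge\left(\frac{M}{\sigma}\right)^{\frac{2}{2\alpha+1}}m^{\frac{2\alpha+2}{2\alpha+1}},\end{cases}$$ for all $0<p\le\infty$, $0<q\le\infty$, $\alpha>0$ with $\alpha+1/2-1/p>0$, and all $M\ge\sigma$.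
   Context: Distributed Gaussian sequence model: there are $m$ local machines; machine $i\in\{1,\dots,m\}$ observes only $X_i=(X_{i,jk})_{j\ge0,\,1\le k\le 2^j}$, where $X_{i,jk}=\theta_{jk}+\sigma z_{i,jk}$, the $z_{i,jk}$ are i.i.d. $N(0,1)$ over all $i,j,k$, the noise level $\sigma>0$ is known, and $\theta=(\theta_{jk})_{j\ge0,1\le k\le2^j}$ is the unknown real sequence. Besov ball: with $s=\alpha+1/2-1/p$, $\mathcal{B}^{\alpha}_{p,q}(M)=\{\theta:|\theta|_{b^{\alpha}_{p,q}}\le M\}$, where $|\theta|_{b^{\alpha}_{p,q}}=\Big(\sum_{j\ge0}\big(2^{js}(\sum_{k=1}^{2^j}|\theta_{jk}|^p)^{1/p}\big)^q\Big)^{1/q}$, with the usual replacement by suprema when $p=\infty$ or $q=\infty$. Distributed estimator: machine $i$ produces a transcript $Z_i=Z_i(X_i)$, a uniquely decodable string given by a (possibly random) function of its own data only, with values in $\bigcup_{b=1}^{\infty}\{0,1\}^b$; no information is exchanged between local machines. The central machine outputs $\hat\theta=\hat\theta(Z_1,\dots,Z_m)$. $|Z_i|_l$ is the length of $Z_i$, and $L(\hat\theta)=\sum_{i=1}^m|Z_i|_l$ is the total communication cost. For a parameter set $\Theta$ and communication budget $B$, $\mathcal{A}_E(B,\Theta)$ is the class of distributed estimators (together with their transcripts) such that $\sup_{\theta\in\Theta}\mathbb{E}_\theta L(\hat\theta)\le B$. Also $\|\hat\theta-\theta\|^2=\sum_{j\ge0}\sum_{k=1}^{2^j}(\hat\theta_{jk}-\theta_{jk})^2$,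 and expectations are over the data and the randomness in the transcripts and the estimator. *)

theory Defs
  imports "HOL-Probability.Probability"
begin

definition coeffs :: "(nat \<times> nat) set" where
  "coeffs = {(j, k). 1 \<le> k \<and> k \<le> 2 ^ j}"

abbreviation seq_space :: "(nat \<times> nat \<Rightarrow> real) measure" where
  "seq_space \<equiv> PiM coeffs (\<lambda>_. borel)"

(* The exponents p and q range over (0, infinity], represented in ennreal, where 1 / \<infinity> = 0.
   A parameter \<theta> is a total function on pairs of numbers; only its values on coeffs matter,
   here and in the observation law and the loss below. *)

definition besov_s :: "real \<Rightarrow> ennreal \<Rightarrow> real" where
  "besov_s \<alpha> p = \<alpha> + 1 / 2 - enn2real (1 / p)"

definition level_norm :: "ennreal \<Rightarrow> (nat \<times> nat \<Rightarrow> real) \<Rightarrow> nat \<Rightarrow> real" where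
  "level_norm p \<theta> j =
     (if p = \<infinity> then MAX k\<in>{1..2 ^ j}. \<bar>\<theta> (j, k)\<bar>
      else (\<Sum>k = 1..2 ^ j. \<bar>\<theta> (j, k)\<bar> powr enn2real p) powr (1 / enn2real p))"

(* Real power with positive exponent on [0, infinity]. *)
definition ennpowr :: "ennreal \<Rightarrow> real \<Rightarrow> ennreal" where
  "ennpowr x a = (if x = \<infinity> then \<infinity> else ennreal (enn2real x powr a))"

definition besov_norm :: "real \<Rightarrow> ennreal \<Rightarrow> ennreal \<Rightarrow> (nat \<times> nat \<Rightarrow> real) \<Rightarrow> ennreal" where
  "besov_norm \<alpha> p q \<theta> =
     (let w = (\<lambda>j. 2 powr (real j * besov_s \<alpha> p) * level_norm p \<theta> j) in
      if q = \<infinity> then SUP j. ennreal (w j)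
      else ennpowr (\<Sum>j. ennreal (w j powr enn2real q)) (1 / enn2real q))"

definition besov_ball :: "real \<Rightarrow> ennreal \<Rightarrow> ennreal \<Rightarrow> real \<Rightarrow> (nat \<times> nat \<Rightarrow> real) set" where
  "besov_ball \<alpha> p q M = {\<theta>. besov_norm \<alpha> p q \<theta> \<le> ennreal M}"

definition machine_law :: "real \<Rightarrow> (nat \<times> nat \<Rightarrow> real) \<Rightarrow> (nat \<times> nat \<Rightarrow> real) measure" where
  "machine_law \<sigma> \<theta> =
     PiM coeffs (\<lambda>jk. density lborel (\<lambda>x. ennreal (normal_density (\<theta> jk) \<sigma> x)))"

definition data_law ::
    "nat \<Rightarrow> real \<Rightarrow> (nat \<times> nat \<Rightarrow> real) \<Rightarrow> (nat \<Rightarrow> nat \<times> nat \<Rightarrow> real) measure" where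
  "data_law m \<sigma> \<theta> = PiM {1..m} (\<lambda>_. machine_law \<sigma> \<theta>)"

(* Every string over the alphabet has at most one parsing into codewords. *)
definition uniquely_decodable :: "bool list set \<Rightarrow> bool" where
  "uniquely_decodable C \<longleftrightarrow> inj_on concat (lists C)"

(* A randomized transcript Z_i(X_i) is given by the conditional law of the string given the data of
   machine i. The machines randomize privately, so given all data the strings are independent. *)
type_synonym transcripts = "nat \<Rightarrow> (nat \<times> nat \<Rightarrow> real) \<Rightarrow> bool list pmf"

(* A (possibly randomized) central estimator: the law of the estimate given the transcripts. *)
type_synonym central = "(nat \<Rightarrow> bool list) \<Rightarrow> (nat \<times> nat \<Rightarrow> real) measure"

definition transcripts_given ::
    "nat \<Rightarrow> transcripts \<Rightarrow> (nat \<Rightarrow> nat \<times> nat \<Rightarrow> real) \<Rightarrow> (nat \<Rightarrow> bool list) pmf" where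
  "transcripts_given m Z X = Pi_pmf {1..m} [] (\<lambda>i. Z i (X i))"

definition valid_transcripts :: "nat \<Rightarrow> transcripts \<Rightarrow> bool" where
  "valid_transcripts m Z \<longleftrightarrow>
     (\<forall>i\<in>{1..m}.
        (\<forall>z. (\<lambda>x. pmf (Z i x) z) \<in> borel_measurable seq_space) \<and>
        (\<exists>C. [] \<notin> C \<and> uniquely_decodable C \<and> (\<forall>x\<in>space seq_space. set_pmf (Z i x) \<subseteq> C)))"

definition valid_central :: "central \<Rightarrow> bool" where
  "valid_central D \<longleftrightarrow> (\<forall>z. prob_space (D z) \<and> sets (D z) = sets seq_space)"

definition expected_cost ::
    "nat \<Rightarrow> real \<Rightarrow> transcripts \<Rightarrow> (nat \<times> nat \<Rightarrow> real) \<Rightarrow> ennreal" where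
  "expected_cost m \<sigma> Z \<theta> =
     (\<integral>\<^sup>+ X. (\<integral>\<^sup>+ z. (\<Sum>i = 1..m. of_nat (length (z i))) \<partial>measure_pmf (transcripts_given m Z X))
        \<partial>data_law m \<sigma> \<theta>)"

definition sq_loss :: "(nat \<times> nat \<Rightarrow> real) \<Rightarrow> (nat \<times> nat \<Rightarrow> real) \<Rightarrow> ennreal" where
  "sq_loss t \<theta> = (\<Sum>j. \<Sum>k = 1..2 ^ j. ennreal ((t (j, k) - \<theta> (j, k))\<^sup>2))"

definition risk ::
    "nat \<Rightarrow> real \<Rightarrow> transcripts \<times> central \<Rightarrow> (nat \<times> nat \<Rightarrow> real) \<Rightarrow> ennreal" where
  "risk m \<sigma> E \<theta> =
     (\<integral>\<^sup>+ X. (\<integral>\<^sup>+ z. (\<integral>\<^sup>+ t. sq_loss t \<theta> \<partial>snd E z) \<partial>measure_pmf (transcripts_given m (fst E) X))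
        \<partial>data_law m \<sigma> \<theta>)"

(* The class A_E(B, \<Theta>), for m machines and noise level \<sigma>. *)
definition dist_estimators ::
    "nat \<Rightarrow> real \<Rightarrow> real \<Rightarrow> (nat \<times> nat \<Rightarrow> real) set \<Rightarrow> (transcripts \<times> central) set" where
  "dist_estimators m \<sigma> B \<Theta> =
     {(Z, D). valid_transcripts m Z \<and> valid_central D \<and>
        (SUP \<theta>\<in>\<Theta>. expected_cost m \<sigma> Z \<theta>) \<le> ennreal B}"

definition rate :: "real \<Rightarrow> real \<Rightarrow> real \<Rightarrow> nat \<Rightarrow> real \<Rightarrow> real" where
  "rate \<alpha> \<sigma> M m B =
     (if B < (M / \<sigma>) powr (2 / (2 * \<alpha> + 1))
        then M\<^sup>2 * B powr (- 2 * \<alpha>)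
      else if B < (M / \<sigma>) powr (2 / (2 * \<alpha> + 1)) * real m powr ((2 * \<alpha> + 2) / (2 * \<alpha> + 1))
        then M powr (2 / (\<alpha> + 1)) * (\<sigma>\<^sup>2 / B) powr (\<alpha> / (\<alpha> + 1))
      else M powr (2 / (2 * \<alpha> + 1)) * (\<sigma>\<^sup>2 / real m) powr (2 * \<alpha> / (2 * \<alpha> + 1)))"

end

theory Submission
  imports Defs
begin

text \<open>
The risk is bounded from below by the Bayes risk for a prior on a single level \<open>j\<close> of the sequence. The
\<open>d = 2 ^ j\<close> coefficients are independent and lie between \<open>-\<delta>\<close> and \<open>\<delta>\<close>; this cube lies in the
Besov ball as soon as \<open>\<delta> \<le> M * d powr (- \<alpha> - 1 / 2)\<close>, for all \<open>p\<close> and \<open>q\<close>. Given the parameter, the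
strings of the machines are independent, so everything can be expressed through the laws of the
single strings (\<open>nn_integral_product_channel\<close>). Three different reasons prevent a small risk.

Few bits do not describe a point of the cube. Even without noise, \<open>B\<close> bits cannot specify \<open>d \<le> B\<close>
coefficients much more accurately than \<open>\<delta>\<close> when \<open>B\<close> is of the order \<open>d\<close>
(\<open>quantization_bound\<close>). With \<open>d\<close> close to \<open>B\<close> and the full cube this gives \<open>M\<^sup>2 * B powr (- 2 * \<alpha>)\<close>.

Few bits carry little Fisher information. The score of a string at \<open>\<theta>\<close> is the conditional mean of
\<open>(X - \<theta>) / \<sigma>\<^sup>2\<close> given the string. Conditioning a Gaussian vector on an event of probability
\<open>w\<close> moves its mean by at most \<open>\<sigma> * sqrt (2 * ln (1 / w))\<close>, in any dimension. Hence the trace of the information of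
a string is at most a constant times its expected length divided by \<open>\<sigma>\<^sup>2\<close>
(\<open>score_information\<close>), and that of all strings is of order \<open>B / \<sigma>\<^sup>2\<close>. The van Trees inequality
(\<open>van_trees_bound\<close>) bounds the risk by \<open>d\<^sup>2\<close> over the sum of this trace and that of the prior, which is of
order \<open>d / \<delta>\<^sup>2\<close>. The choice \<open>\<delta>\<^sup>2 = d * \<sigma>\<^sup>2 / B\<close> makes both of the same order, and the largest \<open>d\<close> that is
compatible with the Besov ball gives the second rate.

All observations together carry the information \<open>m / \<sigma>\<^sup>2\<close> per coefficient. The same inequality with
\<open>\<delta>\<^sup>2 = \<sigma>\<^sup>2 / m\<close> gives the third rate, which is the minimax rate without communication constraints.

Each of the three bounds holds for every budget that admits an estimator, and the rate is one of them
in each regime. All choices are made up to factors that do not involve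
\<open>\<alpha>\<close>, so one constant serves all parameters.
\<close>

section \<open>Densities of infinite products\<close>

lemma nn_integral_PiM_prod_finite:
  assumes M: "\<And>i. prob_space (M i)" and J: "finite J" "J \<subseteq> I"
    and g: "\<And>i. i \<in> J \<Longrightarrow> g i \<in> borel_measurable (M i)"
  shows "(\<integral>\<^sup>+x. (\<Prod>i\<in>J. g i (x i)) \<partial>PiM I M) = (\<Prod>i\<in>J. \<integral>\<^sup>+y. g i y \<partial>M i)"
proof -
  interpret product_prob_space M I
    by (rule product_prob_spaceI[OF M])
  have "(\<integral>\<^sup>+x. (\<Prod>i\<in>J. g i (x i)) \<partial>PiM I M) = (\<integral>\<^sup>+x. (\<Prod>i\<in>J. g i (restrict x J i)) \<partial>PiM I M)"
    by (intro nn_integral_cong prod.cong) auto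
  also have "\<dots> = (\<integral>\<^sup>+x. (\<Prod>i\<in>J. g i (x i)) \<partial>distr (PiM I M) (PiM J M) (\<lambda>x. restrict x J))"
    using g J by (subst nn_integral_distr)
      (auto intro!: borel_measurable_prod_ennreal measurable_restrict_subset
         measurable_compose[OF measurable_component_singleton])
  also have "\<dots> = (\<Prod>i\<in>J. \<integral>\<^sup>+y. g i y \<partial>M i)"
    using g J by (subst distr_PiM_restrict_finite) (auto intro!: product_nn_integral_prod)
  finally show ?thesis .
qed

text \<open>Changing finitely many factors of an infinite product of probability measures by densities changes
the product by the product of these densities. This turns all parameters that are supported on one
level into densities with respect to a single law, although the observation has infinitely many
coordinates. Both sides agree on cylinders, where only finitely many factors matter.\<close>

lemma PiM_density_finite:
  assumes M: "\<And>i. prob_space (M i)" and N: "\<And>i. prob_space (N i)"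
    and J: "finite J" "J \<subseteq> I"
    and g: "\<And>i. i \<in> J \<Longrightarrow> g i \<in> borel_measurable (M i)"
    and NJ: "\<And>i. i \<in> J \<Longrightarrow> N i = density (M i) (g i)"
    and NI: "\<And>i. i \<in> I - J \<Longrightarrow> N i = M i"
  shows "PiM I N = density (PiM I M) (\<lambda>x. \<Prod>i\<in>J. g i (x i))"
proof -
  have sets_N: "sets (N i) = sets (M i)" if "i \<in> I" for i
    using NJ[of i] NI[of i] that by (cases "i \<in> J") auto
  have sets_eq: "sets (PiM I N) = sets (PiM I M)"
    by (intro sets_PiM_cong sets_N) auto
  interpret N: product_prob_space N I
    by (rule product_prob_spaceI[OF N])
  have gJ: "(\<lambda>x. \<Prod>i\<in>J. g i (x i)) \<in> borel_measurable (PiM I M)"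
    using g J by (auto intro!: borel_measurable_prod_ennreal
         measurable_compose[OF measurable_component_singleton])
  show ?thesis
  proof (rule measure_eqI_PiM_infinite)
    show "sets (PiM I N) = PiM I N" by simp
    show "sets (density (PiM I M) (\<lambda>x. \<Prod>i\<in>J. g i (x i))) = PiM I N"
      using sets_eq by simp
    show "finite_measure (PiM I N)"
      by unfold_locales (simp add: N.emeasure_space_1)
    fix A K assume K: "finite K" "K \<subseteq> I" and A: "\<And>i. i \<in> K \<Longrightarrow> A i \<in> sets (N i)"
    have A': "A i \<in> sets (M i)" if "i \<in> K" for i using A sets_N K that by auto
    define A2 where "A2 i = (if i \<in> K then A i else space (M i))" for i
    define g2 where "g2 i = (if i \<in> J then g i else (\<lambda>_. 1))" for i
    have A2[measurable]: "A2 i \<in> sets (M i)" for i using A' by (auto simp: A2_def)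
    have g2[measurable]: "i \<in> J \<union> K \<Longrightarrow> g2 i \<in> borel_measurable (M i)" for i using g by (auto simp: g2_def)
    have sp: "space (PiM I N) = space (PiM I M)" using sets_eq by (rule sets_eq_imp_space_eq)
    have spi: "space (N i) = space (M i)" if "i \<in> I" for i using sets_eq_imp_space_eq[OF sets_N[OF that]] .
    have emb_eq: "prod_emb I N K (Pi\<^sub>E K A) = {x\<in>space (PiM I M). \<forall>i\<in>J \<union> K. x i \<in> A2 i}"
      using K J sets.sets_into_space[OF A'] spi
      by (auto simp: prod_emb_def space_PiM A2_def PiE_iff Pi_iff extensional_def split: if_splits)
    have S: "{x\<in>space (PiM I M). \<forall>i\<in>J \<union> K. x i \<in> A2 i} \<in> sets (PiM I M)"
      using J K by (intro sets.sets_Collect_finite_All) (auto intro!: sets_Collect_single)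
    have "emeasure (density (PiM I M) (\<lambda>x. \<Prod>i\<in>J. g i (x i))) (prod_emb I N K (Pi\<^sub>E K A))
       = (\<integral>\<^sup>+x. (\<Prod>i\<in>J. g i (x i)) * indicator (prod_emb I N K (Pi\<^sub>E K A)) x \<partial>PiM I M)"
      using gJ S by (subst emeasure_density) (auto simp: emb_eq)
    also have "\<dots> = (\<integral>\<^sup>+x. (\<Prod>i\<in>J \<union> K. g2 i (x i) * indicator (A2 i) (x i)) \<partial>PiM I M)"
    proof (intro nn_integral_cong)
      fix x assume x: "x \<in> space (PiM I M)"
      have "(\<Prod>i\<in>J \<union> K. g2 i (x i)) = (\<Prod>i\<in>J. g i (x i))"
        using J K by (intro prod.mono_neutral_cong_right) (auto simp: g2_def)
      moreover have "(\<Prod>i\<in>J \<union> K. indicator (A2 i) (x i) :: ennreal) = indicator (prod_emb I N K (Pi\<^sub>E K A)) x"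
        using x J K by (auto simp: emb_eq indicator_def prod_zero_iff)
      ultimately show "(\<Prod>i\<in>J. g i (x i)) * indicator (prod_emb I N K (Pi\<^sub>E K A)) x =
           (\<Prod>i\<in>J \<union> K. g2 i (x i) * indicator (A2 i) (x i))"
        by (simp add: prod.distrib)
    qed
    also have "\<dots> = (\<Prod>i\<in>J \<union> K. \<integral>\<^sup>+y. g2 i y * indicator (A2 i) y \<partial>M i)"
      using J K g2 by (intro nn_integral_PiM_prod_finite M) auto
    also have "\<dots> = (\<Prod>i\<in>J \<union> K. emeasure (N i) (A2 i))"
    proof (intro prod.cong refl)
      fix i assume i: "i \<in> J \<union> K"
      show "(\<integral>\<^sup>+y. g2 i y * indicator (A2 i) y \<partial>M i) = emeasure (N i) (A2 i)"
      proof (cases "i \<in> J")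
        case True
        then show ?thesis using NJ[OF True] g[OF True] by (simp add: g2_def emeasure_density)
      next
        case False
        then show ?thesis using i NI[of i] K by (auto simp: g2_def)
      qed
    qed
    also have "\<dots> = (\<Prod>i\<in>K. emeasure (N i) (A i))"
    proof (intro prod.mono_neutral_cong_right)
      show "\<forall>i\<in>J \<union> K - K. emeasure (N i) (A2 i) = 1"
        using J spi prob_space.emeasure_space_1[OF N] by (auto simp: A2_def simp flip: spi)
    qed (use J K in \<open>auto simp: A2_def\<close>)
    also have "\<dots> = emeasure (PiM I N) (prod_emb I N K (Pi\<^sub>E K A))"
      using K A by (intro N.emeasure_PiM_emb[symmetric]) auto
    finally show "emeasure (PiM I N) (prod_emb I N K (Pi\<^sub>E K A)) =
        emeasure (density (PiM I M) (\<lambda>x. \<Prod>i\<in>J. g i (x i))) (prod_emb I N K (Pi\<^sub>E K A))" ..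
  qed
qed

section \<open>Differentiation of exponential tilts\<close>

text \<open>The factor \<open>exp x + 1\<close> is crude but gives one bound for both signs of \<open>x\<close>, and it is integrable
against every exponential tilt.\<close>

lemma exp_second_order_bound:
  fixes x :: real
  shows "\<bar>exp x - 1 - x\<bar> \<le> x\<^sup>2 * (exp x + 1)"
proof -
  have lower: "0 \<le> exp x - 1 - x" using exp_ge_add_one_self[of x] by linarith
  have "exp x - 1 - x \<le> x * (exp x - 1)"
  proof -
    have "1 - x \<le> exp (- x)" using exp_ge_add_one_self[of "-x"] by simp
    then have "exp x * (1 - x) \<le> exp x * exp (-x)" by (intro mult_left_mono) auto
    then show ?thesis by (simp add: exp_minus field_simps)
  qed
  also have "x * (exp x - 1) \<le> x\<^sup>2 * (exp x + 1)"
  proof (cases "x \<ge> 0")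
    case True
    have "1 - x \<le> exp (- x)" using exp_ge_add_one_self[of "-x"] by simp
    then have "exp x * (1 - x) \<le> exp x * exp (-x)" by (intro mult_left_mono) auto
    then have "exp x - 1 \<le> x * exp x" by (simp add: exp_minus field_simps)
    also have "\<dots> \<le> x * (exp x + 1)" using True by (simp add: algebra_simps)
    finally show ?thesis using True by (simp add: power2_eq_square mult_left_mono mult.assoc)
  next
    case False
    have "- x * (1 - exp x) \<le> - x * (- x)"
      using False exp_ge_add_one_self[of x] by (intro mult_left_mono) linarith+
    also have "\<dots> \<le> x\<^sup>2 * (exp x + 1)"
      using mult_nonneg_nonneg[of "x\<^sup>2" "exp x"] by (simp add: power2_eq_square distrib_left)
    finally show ?thesis by (simp add: algebra_simps)
  qed
  finally show ?thesis using lower by simp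
qed

lemma DERIV_from_quadratic_remainder:
  fixes F :: "real \<Rightarrow> real"
  assumes "\<And>h. \<bar>h\<bar> \<le> 1 \<Longrightarrow> \<bar>F (s + h) - F s - h * D\<bar> \<le> C * h\<^sup>2"
  shows "(F has_real_derivative D) (at s)"
proof -
  have "((\<lambda>h. (F (s + h) - F s) / h - D) \<longlongrightarrow> 0) (at 0)"
  proof (rule Lim_null_comparison)
    show "\<forall>\<^sub>F h in at 0. norm ((F (s + h) - F s) / h - D) \<le> C * \<bar>h\<bar>"
      unfolding eventually_at
    proof (intro exI[of _ 1] conjI ballI impI; clarsimp)
      fix h :: real assume h: "h \<noteq> 0" "\<bar>h\<bar> < 1"
      have "(F (s + h) - F s) / h - D = (F (s + h) - F s - h * D) / h"
        using h by (simp add: field_simps)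
      then have "\<bar>(F (s + h) - F s) / h - D\<bar> = \<bar>F (s + h) - F s - h * D\<bar> / \<bar>h\<bar>" by simp
      also have "\<dots> \<le> C * h\<^sup>2 / \<bar>h\<bar>" using h assms[of h] by (intro divide_right_mono) auto
      also have "\<dots> = C * \<bar>h\<bar>" using h by (simp add: power2_eq_square abs_if)
      finally show "\<bar>(F (s + h) - F s) / h - D\<bar> \<le> C * \<bar>h\<bar>" .
    qed
    show "((\<lambda>h. C * \<bar>h\<bar>) \<longlongrightarrow> 0) (at 0)"
      by (auto intro!: tendsto_eq_intros)
  qed
  then show ?thesis unfolding DERIV_def by (simp add: LIM_zero_iff)
qed

text \<open>A factor \<open>y\<close> costs a change of the tilt by one, since \<open>\<bar>y\<bar> \<le> exp y + exp (- y)\<close>. Functions that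
remain integrable under all tilts are therefore closed under multiplication by \<open>y\<close>, and
derivatives of all orders can be taken under the integral.\<close>

lemma integrable_exp_tilt_mult:
  fixes h y :: "'a \<Rightarrow> real"
  assumes [measurable]: "h \<in> borel_measurable M" "y \<in> borel_measurable M"
    and int: "\<And>s. integrable M (\<lambda>x. h x * exp (s * y x))"
  shows "integrable M (\<lambda>x. h x * y x * exp (s * y x))"
proof (rule Bochner_Integration.integrable_bound)
  show "integrable M (\<lambda>x. \<bar>h x * exp ((s + 1) * y x)\<bar> + \<bar>h x * exp ((s - 1) * y x)\<bar>)"
    using int[of "s+1"] int[of "s-1"] by (intro Bochner_Integration.integrable_add integrable_abs)
  show "AE x in M. norm (h x * y x * exp (s * y x)) \<le>
      norm (\<bar>h x * exp ((s + 1) * y x)\<bar> + \<bar>h x * exp ((s - 1) * y x)\<bar>)"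
  proof (rule AE_I2)
    fix x
    have "\<bar>y x\<bar> \<le> exp (y x) + exp (- y x)"
      using exp_ge_add_one_self[of "y x"] exp_ge_add_one_self[of "- y x"] exp_gt_zero[of "y x"] exp_gt_zero[of "- y x"]
      by (smt (verit))
    then have "\<bar>h x\<bar> * \<bar>y x\<bar> * exp (s * y x) \<le> \<bar>h x\<bar> * (exp (y x) + exp (- y x)) * exp (s * y x)"
      by (intro mult_right_mono mult_left_mono) auto
    also have "\<dots> = \<bar>h x * exp ((s + 1) * y x)\<bar> + \<bar>h x * exp ((s - 1) * y x)\<bar>"
      by (simp add: abs_mult algebra_simps flip: exp_add)
    finally show "norm (h x * y x * exp (s * y x)) \<le>
      norm (\<bar>h x * exp ((s + 1) * y x)\<bar> + \<bar>h x * exp ((s - 1) * y x)\<bar>)"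
      by (simp add: abs_mult)
  qed
qed measurable

text \<open>The remainder of the integrand is quadratic in the increment, with a factor that is integrable and the
same for all increments of size at most one; so the remainder of the integral is quadratic too.\<close>

lemma DERIV_integral_exp_tilt:
  fixes h y :: "'a \<Rightarrow> real"
  assumes [measurable]: "h \<in> borel_measurable M" "y \<in> borel_measurable M"
    and int: "\<And>s. integrable M (\<lambda>x. h x * exp (s * y x))"
  shows "((\<lambda>s. \<integral>x. h x * exp (s * y x) \<partial>M) has_real_derivative
            (\<integral>x. h x * y x * exp (s * y x) \<partial>M)) (at s)"
proof -
  have int1: "integrable M (\<lambda>x. h x * y x * exp (s * y x))" for s
    by (rule integrable_exp_tilt_mult[OF _ _ int]) measurable
  have int2: "integrable M (\<lambda>x. h x * y x * y x * exp (s * y x))" for s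
    by (rule integrable_exp_tilt_mult[OF _ _ int1]) measurable
  define q where "q x = \<bar>h x\<bar> * (y x)\<^sup>2 * exp (s * y x) * (exp (y x) + exp (- y x) + 1)" for x
  have q: "integrable M q"
  proof -
    have "q = (\<lambda>x. \<bar>h x * y x * y x * exp ((s+1) * y x)\<bar> + \<bar>h x * y x * y x * exp ((s-1) * y x)\<bar>
         + \<bar>h x * y x * y x * exp (s * y x)\<bar>)"
    proof
      fix x
      have "\<bar>h x * y x * y x * exp r\<bar> = \<bar>h x\<bar> * (y x)\<^sup>2 * exp r" for r
        by (simp add: abs_mult power2_eq_square mult.assoc)
      then show "q x = \<bar>h x * y x * y x * exp ((s+1) * y x)\<bar> + \<bar>h x * y x * y x * exp ((s-1) * y x)\<bar>
         + \<bar>h x * y x * y x * exp (s * y x)\<bar>"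
        by (simp only: q_def) (simp add: distrib_left distrib_right left_diff_distrib exp_add exp_diff exp_minus divide_inverse)
    qed
    then show ?thesis using int2 by (auto intro!: Bochner_Integration.integrable_add integrable_abs)
  qed
  show ?thesis
  proof (rule DERIV_from_quadratic_remainder[where C = "\<integral>x. q x \<partial>M"])
    fix d :: real assume d: "\<bar>d\<bar> \<le> 1"
    have "(\<integral>x. h x * exp ((s+d) * y x) \<partial>M) - (\<integral>x. h x * exp (s * y x) \<partial>M)
         - d * (\<integral>x. h x * y x * exp (s * y x) \<partial>M)
       = (\<integral>x. h x * exp ((s+d) * y x) - h x * exp (s * y x) - d * (h x * y x * exp (s * y x)) \<partial>M)"
      using int[of "s+d"] int[of s] int1[of s] by simp
    also have "\<bar>\<dots>\<bar> \<le> (\<integral>x. q x * d\<^sup>2 \<partial>M)"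
    proof (rule order_trans[OF integral_abs_bound integral_mono])
      show "integrable M (\<lambda>x. \<bar>h x * exp ((s+d) * y x) - h x * exp (s * y x) - d * (h x * y x * exp (s * y x))\<bar>)"
        using int[of "s+d"] int[of s] int1[of s] by (intro integrable_abs) simp
      show "integrable M (\<lambda>x. q x * d\<^sup>2)" using q by simp
      fix x
      have "exp (d * y x) \<le> exp (y x) + exp (- y x)"
      proof (cases "y x \<ge> 0")
        case True
        then have "d * y x \<le> 1 * y x" using d by (intro mult_right_mono) auto
        then have "exp (d * y x) \<le> exp (y x)" by simp
        then show ?thesis using exp_gt_zero[of "- y x"] by linarith
      next
        case False
        then have "d * y x \<le> (-1) * y x" using d by (intro mult_right_mono_neg) auto
        then have "exp (d * y x) \<le> exp (- y x)" by simp
        then show ?thesis using exp_gt_zero[of "y x"] by linarith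
      qed
      then have B: "\<bar>exp (d * y x) - 1 - d * y x\<bar> \<le> (d * y x)\<^sup>2 * (exp (y x) + exp (- y x) + 1)"
        using exp_second_order_bound[of "d * y x"]
        by (smt (verit) mult_left_mono zero_le_power2)
      have "h x * exp ((s+d) * y x) - h x * exp (s * y x) - d * (h x * y x * exp (s * y x))
         = h x * exp (s * y x) * (exp (d * y x) - 1 - d * y x)"
        by (simp add: algebra_simps exp_add)
      then have "\<bar>h x * exp ((s+d) * y x) - h x * exp (s * y x) - d * (h x * y x * exp (s * y x))\<bar>
        \<le> \<bar>h x\<bar> * exp (s * y x) * ((d * y x)\<^sup>2 * (exp (y x) + exp (- y x) + 1))"
        using B by (simp add: abs_mult mult_left_mono)
      also have "\<dots> = q x * d\<^sup>2" by (simp add: q_def power_mult_distrib)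
      finally show "\<bar>h x * exp ((s+d) * y x) - h x * exp (s * y x) - d * (h x * y x * exp (s * y x))\<bar> \<le> q x * d\<^sup>2" .
    qed
    also have "\<dots> = (\<integral>x. q x \<partial>M) * d\<^sup>2" by simp
    finally show "\<bar>(\<integral>x. h x * exp ((s+d) * y x) \<partial>M) - (\<integral>x. h x * exp (s * y x) \<partial>M)
         - d * (\<integral>x. h x * y x * exp (s * y x) \<partial>M)\<bar> \<le> (\<integral>x. q x \<partial>M) * d\<^sup>2" .
  qed
qed

section \<open>A compactly supported prior and its van Trees inequality\<close>

lemma nn_integral_ge_integral:
  fixes f g :: "'a \<Rightarrow> real"
  assumes "integrable M g" "\<And>x. x \<in> space M \<Longrightarrow> g x \<le> f x"
  shows "ennreal (\<integral>x. g x \<partial>M) \<le> (\<integral>\<^sup>+x. ennreal (f x) \<partial>M)"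
proof -
  have m: "integrable M (\<lambda>x. max 0 (g x))" using assms(1) by auto
  have "ennreal (\<integral>x. g x \<partial>M) \<le> ennreal (\<integral>x. max 0 (g x) \<partial>M)"
    using assms(1) m by (intro ennreal_leI integral_mono) auto
  also have "\<dots> = (\<integral>\<^sup>+x. ennreal (max 0 (g x)) \<partial>M)"
    using m by (intro nn_integral_eq_integral[symmetric]) auto
  also have "\<dots> \<le> (\<integral>\<^sup>+x. ennreal (f x) \<partial>M)"
    using assms(2) by (intro nn_integral_mono) (auto simp: max_def ennreal_leI ennreal_neg)
  finally show ?thesis .
qed

definition bump :: "real \<Rightarrow> real \<Rightarrow> real" where
  "bump \<delta> s = 1 - (s / \<delta>)\<^sup>2"

definition bump_score :: "real \<Rightarrow> real \<Rightarrow> real" where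
  "bump_score \<delta> s = (- 2 * s / \<delta>\<^sup>2) / bump \<delta> s"

text \<open>The prior for one coefficient has a density proportional to \<open>(1 - (s / \<delta>)\<^sup>2)\<^sup>2\<close> on the interval from
\<open>-\<delta>\<close> to \<open>\<delta>\<close>. The factor \<open>bump\<close> vanishes at the end points, so that integration by parts has no
boundary terms; its square is taken to make the Fisher information finite. The logarithmic derivative
of the density is twice \<open>bump_score\<close>.\<close>

definition bump_density :: "real \<Rightarrow> real \<Rightarrow> real" where
  "bump_density \<delta> s = 15 / (16 * \<delta>) * (bump \<delta> s)\<^sup>2 * indicator {-\<delta>..\<delta>} s"

definition bump_prior :: "real \<Rightarrow> real measure" where
  "bump_prior \<delta> = density lborel (\<lambda>s. ennreal (bump_density \<delta> s))"

lemma bump_measurable [measurable]: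
  "bump \<delta> \<in> borel_measurable borel" "bump_score \<delta> \<in> borel_measurable borel"
  "bump_density \<delta> \<in> borel_measurable borel"
  unfolding bump_def[abs_def] bump_score_def[abs_def] bump_density_def[abs_def] by measurable

lemma sets_bump_prior [simp, measurable_cong]: "sets (bump_prior \<delta>) = sets borel"
  and space_bump_prior [simp]: "space (bump_prior \<delta>) = UNIV"
  by (auto simp: bump_prior_def)

lemma bump_density_nonneg: "0 < \<delta> \<Longrightarrow> 0 \<le> bump_density \<delta> s"
  by (simp add: bump_density_def)

lemma bump_density_le: 
  assumes "0 < \<delta>" shows "bump_density \<delta> s \<le> 1 / \<delta>"
proof (cases "s \<in> {-\<delta>..\<delta>}")
  case True
  then have "\<bar>s / \<delta>\<bar> \<le> 1" using assms by (simp add: abs_if field_simps)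
  then have "(s / \<delta>)\<^sup>2 \<le> 1" by (simp only: abs_square_le_1)
  then have "(bump \<delta> s)\<^sup>2 \<le> 1" by (auto simp: bump_def intro!: power_le_one)
  then have "15 / (16 * \<delta>) * (bump \<delta> s)\<^sup>2 \<le> 15 / (16 * \<delta>) * 1"
    using assms by (intro mult_left_mono) auto
  also have "\<dots> \<le> 1 / \<delta>" using assms by (simp add: field_simps)
  finally show ?thesis using True by (simp add: bump_density_def)
qed (use assms in \<open>simp add: bump_density_def\<close>)

lemma prob_space_bump_prior: 
  assumes "0 < \<delta>" shows "prob_space (bump_prior \<delta>)"
proof
  define F where "F s = 15 / (16 * \<delta>) * (s - 2 * s ^ 3 / (3 * \<delta>\<^sup>2) + s ^ 5 / (5 * \<delta> ^ 4))" for s :: real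
  have "emeasure (bump_prior \<delta>) (space (bump_prior \<delta>)) =
     (\<integral>\<^sup>+s. ennreal (15 / (16 * \<delta>) * (bump \<delta> s)\<^sup>2) * indicator {-\<delta>..\<delta>} s \<partial>lborel)"
    by (auto simp: bump_prior_def emeasure_density bump_density_def indicator_def intro!: nn_integral_cong)
  also have "\<dots> = F \<delta> - F (-\<delta>)"
  proof (rule nn_integral_FTC_Icc)
    fix s show "(F has_real_derivative 15 / (16 * \<delta>) * (bump \<delta> s)\<^sup>2) (at s)"
      unfolding F_def bump_def using assms
      by (auto intro!: derivative_eq_intros simp: field_simps eval_nat_numeral)
  qed (use assms in \<open>auto simp: bump_def\<close>)
  also have "F \<delta> - F (-\<delta>) = 1"
    using assms by (simp add: F_def field_simps eval_nat_numeral)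
  finally show "emeasure (bump_prior \<delta>) (space (bump_prior \<delta>)) = 1" by simp
qed

lemma AE_bump_prior: "0 < \<delta> \<Longrightarrow> AE s in bump_prior \<delta>. \<bar>s\<bar> \<le> \<delta>"
  by (subst bump_prior_def, subst AE_density)
    (auto simp: bump_density_def abs_le_iff intro!: AE_I2 split: split_indicator_asm)

lemma bump_pos:
  assumes "\<bar>s\<bar> < \<delta>" shows "0 < bump \<delta> s"
  using assms by (simp add: bump_def abs_square_less_1)

lemma AE_lborel_not_endpoint: "AE s in lborel. \<bar>s\<bar> \<noteq> (\<delta>::real)"
proof -
  have "AE s in lborel. s \<noteq> \<delta>" "AE s in lborel. s \<noteq> -\<delta>" by (rule AE_lborel_singleton)+
  then show ?thesis by eventually_elim auto
qed

lemma nn_integral_bump_prior: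
  assumes "0 < \<delta>" "f \<in> borel_measurable borel"
  shows "(\<integral>\<^sup>+s. f s \<partial>bump_prior \<delta>) = (\<integral>\<^sup>+s. ennreal (bump_density \<delta> s) * f s \<partial>lborel)"
  using assms by (simp add: bump_prior_def nn_integral_density)

lemma nn_integral_bump_score:
  assumes d: "0 < \<delta>"
  shows "(\<integral>\<^sup>+s. ennreal ((bump_score \<delta> s)\<^sup>2) \<partial>bump_prior \<delta>) = ennreal (5 / (2 * \<delta>\<^sup>2))"
proof -
  define K where "K = 5 / (4 * \<delta> ^ 5)"
  define F where "F s = K * s ^ 3" for s :: real
  have "(\<integral>\<^sup>+s. ennreal ((bump_score \<delta> s)\<^sup>2) \<partial>bump_prior \<delta>)
      = (\<integral>\<^sup>+s. ennreal (bump_density \<delta> s) * ennreal ((bump_score \<delta> s)\<^sup>2) \<partial>lborel)"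
    using d by (intro nn_integral_bump_prior) auto
  also have "\<dots> = (\<integral>\<^sup>+s. ennreal (15 / (4 * \<delta> ^ 5) * s\<^sup>2) * indicator {-\<delta>..\<delta>} s \<partial>lborel)"
  proof (rule nn_integral_cong_AE)
    show "AE s in lborel. ennreal (bump_density \<delta> s) * ennreal ((bump_score \<delta> s)\<^sup>2) =
       ennreal (15 / (4 * \<delta> ^ 5) * s\<^sup>2) * indicator {- \<delta>..\<delta>} s"
      using AE_lborel_not_endpoint[of \<delta>]
    proof eventually_elim
      case (elim s)
      show ?case
      proof (cases "s \<in> {-\<delta>..\<delta>}")
        case True
        then have "bump \<delta> s \<noteq> 0" using elim bump_pos[of s \<delta>] by (auto simp: abs_less_iff abs_if split: if_splits)
        then have "bump_density \<delta> s * (bump_score \<delta> s)\<^sup>2 = 15 / (16 * \<delta>) * (2 * s / \<delta>\<^sup>2)\<^sup>2"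
        proof -
          have "bump \<delta> s * bump_score \<delta> s = - (2 * s / \<delta>\<^sup>2)"
            using \<open>bump \<delta> s \<noteq> 0\<close> by (simp add: bump_score_def)
          then have "(bump \<delta> s)\<^sup>2 * (bump_score \<delta> s)\<^sup>2 = (2 * s / \<delta>\<^sup>2)\<^sup>2"
            by (simp flip: power_mult_distrib)
          then show ?thesis using True by (simp add: bump_density_def mult.assoc)
        qed
        also have "\<dots> = 15 / (4 * \<delta> ^ 5) * s\<^sup>2"
        proof -
          have "\<delta> ^ 5 = \<delta> * \<delta> ^ 4" by (simp add: eval_nat_numeral)
          then show ?thesis by (simp add: power_divide power_mult_distrib flip: power_mult)
        qed
        finally show ?thesis using True d by (simp add: bump_density_nonneg flip: ennreal_mult)
      qed (auto simp: bump_density_def)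
    qed
  qed
  also have "\<dots> = F \<delta> - F (-\<delta>)"
  proof (rule nn_integral_FTC_Icc)
    fix s show "(F has_real_derivative 15 / (4 * \<delta> ^ 5) * s\<^sup>2) (at s)"
      unfolding F_def[abs_def] by (rule DERIV_cong[OF DERIV_cmult[OF DERIV_pow]]) (simp add: K_def)
  qed (use d in auto)
  also have "F \<delta> - F (-\<delta>) = 5 / (2 * \<delta>\<^sup>2)"
    using d by (simp add: F_def K_def field_simps eval_nat_numeral)
  finally show ?thesis .
qed

text \<open>The van Trees inequality in one coordinate, before it is optimized over \<open>\<gamma>\<close>. Here \<open>w s\<close> is the
likelihood of a fixed outcome, \<open>a\<close> is its logarithmic derivative, and \<open>t\<close> is the estimate.
Let \<open>\<pi>\<close> be the prior density. Since \<open>(t - s) * w s * \<pi> s\<close> vanishes at both ends of the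
interval, its derivative has integral zero; hence \<open>t - s\<close> integrated against the derivative of
\<open>w * \<pi>\<close> equals the integral of \<open>w * \<pi>\<close>. The claim follows from
\<open>2 * x * y \<le> x\<^sup>2 + y\<^sup>2\<close>, applied to \<open>t - s\<close> and \<open>\<gamma>\<close> times the logarithmic derivative of \<open>w * \<pi>\<close>.\<close>

lemma van_trees_coordinate:
  assumes d: "0 < \<delta>" and \<gamma>: "0 \<le> \<gamma>"
    and w: "\<And>s. (w has_real_derivative w s * a s) (at s)" "\<And>s. 0 \<le> w s"
    and cont: "continuous_on UNIV (\<lambda>s. w s * a s)"
    and a[measurable]: "a \<in> borel_measurable borel"
  shows "(\<integral>\<^sup>+s. ennreal (2 * \<gamma> * w s) \<partial>bump_prior \<delta>)
     \<le> (\<integral>\<^sup>+s. ennreal (w s * (t - s)\<^sup>2) \<partial>bump_prior \<delta>) +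
       (\<integral>\<^sup>+s. ennreal (\<gamma>\<^sup>2 * w s * (2 * (a s)\<^sup>2 + 8 * (bump_score \<delta> s)\<^sup>2)) \<partial>bump_prior \<delta>)"
proof -
  define c where "c = 15 / (16 * \<delta>)"
  have c: "c > 0" using d by (simp add: c_def)
  have cw: "continuous_on UNIV w"
    using w(1) by (meson DERIV_isCont continuous_at_imp_continuous_on)
  have [measurable]: "w \<in> borel_measurable borel"
    using cw by (rule borel_measurable_continuous_onI)
  define r where "r = bump \<delta>"
  define r' where "r' s = - 2 * s / \<delta>\<^sup>2" for s
  have r: "(r has_real_derivative r' s) (at s)" for s
    unfolding r_def bump_def[abs_def] r'_def using d
    by (auto intro!: derivative_eq_intros simp: field_simps eval_nat_numeral)
  have cr: "continuous_on UNIV r" "continuous_on UNIV r'"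
    using d by (auto simp: r_def bump_def[abs_def] r'_def[abs_def] intro!: continuous_intros)
  define F where "F s = 2 * \<gamma> * c * ((t - s) * (r s)\<^sup>2 * w s)" for s
  define F' where "F' s = 2 * \<gamma> * c * (- (r s)\<^sup>2 * w s + (t - s) * (2 * r s * r' s) * w s + (t - s) * (r s)\<^sup>2 * (w s * a s))" for s
  have F: "(F has_real_derivative F' s) (at s)" for s
    unfolding F_def[abs_def] F'_def
    by (auto intro!: derivative_eq_intros r w simp: algebra_simps power2_eq_square)
  have "continuous_on UNIV F'"
    unfolding F'_def[abs_def] by (intro continuous_intros cr cw cont)
  then have contF: "isCont F' s" for s by (simp add: continuous_on_eq_continuous_at)
  have r0: "r \<delta> = 0" "r (-\<delta>) = 0" using d by (auto simp: r_def bump_def)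
  have F0: "has_bochner_integral lborel (\<lambda>s. F' s * indicator {-\<delta>..\<delta>} s) 0"
    using has_bochner_integral_FTC_Icc_real[of "-\<delta>" \<delta> F F'] F contF d r0 by (auto simp: F_def)
  define G where "G s = 2 * \<gamma> * c * (r s)\<^sup>2 * w s" for s
  have "continuous_on UNIV G"
    unfolding G_def[abs_def] by (intro continuous_intros cr cw)
  then have G: "integrable lborel (\<lambda>s. G s * indicator {-\<delta>..\<delta>} s)"
    using borel_integrable_compact[of "{-\<delta>..\<delta>}" G]
    by (auto simp: mult.commute set_integrable_def indicator_def if_distrib cong: if_cong intro: continuous_on_subset)
  define Q where "Q s = bump_density \<delta> s * (w s * (t - s)\<^sup>2 + \<gamma>\<^sup>2 * w s * (2 * (a s)\<^sup>2 + 8 * (bump_score \<delta> s)\<^sup>2))" for s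
  have Q0: "0 \<le> Q s" for s using w(2) d by (simp add: Q_def bump_density_nonneg)
  (* At the end points bump_score divides by zero, so that Q does not dominate there. Two points have
     measure zero, and Q' corrects the values at them. *)
  define Q' where "Q' s = (if \<bar>s\<bar> = \<delta> then max (Q s) (G s + F' s) else Q s)" for s
  have le: "(G s + F' s) * indicator {-\<delta>..\<delta>} s \<le> Q' s" for s
  proof (cases "s \<in> {-\<delta>..\<delta>} \<and> \<bar>s\<bar> \<noteq> \<delta>")
    case True
    then have pos: "0 < r s" using bump_pos[of s \<delta>] by (auto simp: r_def abs_if split: if_splits)
    then have sc: "bump_score \<delta> s = r' s / r s" by (simp add: bump_score_def r_def r'_def)
    have "G s + F' s = c * w s * (2 * ((t - s) * r s) * (\<gamma> * (r s * a s + 2 * r' s)))"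
      by (simp add: G_def F'_def algebra_simps power2_eq_square)
    also have "\<dots> \<le> c * w s * (((t - s) * r s)\<^sup>2 + (\<gamma> * (r s * a s + 2 * r' s))\<^sup>2)"
      using sum_squares_bound[of "(t - s) * r s" "\<gamma> * (r s * a s + 2 * r' s)"] c w(2)[of s]
      by (intro mult_left_mono) auto
    also have "\<dots> \<le> c * w s * (((t - s) * r s)\<^sup>2 + \<gamma>\<^sup>2 * (2 * (r s * a s)\<^sup>2 + 2 * (2 * r' s)\<^sup>2))"
    proof -
      have "(r s * a s + 2 * r' s)\<^sup>2 \<le> 2 * (r s * a s)\<^sup>2 + 2 * (2 * r' s)\<^sup>2"
        using sum_squares_bound[of "r s * a s" "2 * r' s"] by (simp add: power2_sum)
      then show ?thesis using c w(2)[of s] by (intro mult_left_mono add_left_mono) (auto simp: power_mult_distrib mult_left_mono)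
    qed
    also have "\<dots> = Q s"
    proof -
      have "(r' s)\<^sup>2 = (r s)\<^sup>2 * (bump_score \<delta> s)\<^sup>2"
        using pos by (simp add: sc power_divide)
      moreover have "bump_density \<delta> s = c * (r s)\<^sup>2"
        using True by (simp add: bump_density_def r_def c_def)
      ultimately show ?thesis unfolding Q_def power_mult_distrib by (simp add: distrib_left mult_ac)
    qed
    finally show ?thesis using True by (simp add: Q'_def)
  next
    case False
    then show ?thesis using Q0[of s] by (auto simp: Q'_def split: split_indicator)
  qed
  have "(\<integral>\<^sup>+s. ennreal (2 * \<gamma> * w s) \<partial>bump_prior \<delta>) = (\<integral>\<^sup>+s. ennreal (G s * indicator {-\<delta>..\<delta>} s) \<partial>lborel)"
    using d c w(2) \<gamma> by (subst nn_integral_bump_prior)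
      (auto intro!: nn_integral_cong simp: bump_density_nonneg bump_density_def G_def c_def r_def ennreal_mult[symmetric] mult_ac
         split: split_indicator)
  also have "\<dots> = ennreal (\<integral>s. G s * indicator {-\<delta>..\<delta>} s \<partial>lborel)"
    using G c w(2) \<gamma> by (intro nn_integral_eq_integral) (auto simp: G_def)
  also have "\<dots> = ennreal (\<integral>s. (G s + F' s) * indicator {-\<delta>..\<delta>} s \<partial>lborel)"
    using G F0 by (simp add: distrib_right has_bochner_integral_iff)
  also have "\<dots> \<le> (\<integral>\<^sup>+s. ennreal (Q' s) \<partial>lborel)"
    using G F0 le by (intro nn_integral_ge_integral) (auto simp: distrib_right has_bochner_integral_iff)
  also have "\<dots> = (\<integral>\<^sup>+s. ennreal (Q s) \<partial>lborel)"
    using AE_lborel_not_endpoint[of \<delta>] by (intro nn_integral_cong_AE) (auto simp: Q'_def)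
  also have "\<dots> = (\<integral>\<^sup>+s. ennreal (w s * (t - s)\<^sup>2) + ennreal (\<gamma>\<^sup>2 * w s * (2 * (a s)\<^sup>2 + 8 * (bump_score \<delta> s)\<^sup>2)) \<partial>bump_prior \<delta>)"
  proof -
    have "ennreal (Q s) = ennreal (bump_density \<delta> s) * (ennreal (w s * (t - s)\<^sup>2) +
        ennreal (\<gamma>\<^sup>2 * w s * (2 * (a s)\<^sup>2 + 8 * (bump_score \<delta> s)\<^sup>2)))" for s
      unfolding Q_def using d w(2)[of s] by (subst ennreal_mult) (auto simp: bump_density_nonneg)
    then show ?thesis using d by (subst nn_integral_bump_prior) auto
  qed
  also have "\<dots> = (\<integral>\<^sup>+s. ennreal (w s * (t - s)\<^sup>2) \<partial>bump_prior \<delta>) +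
       (\<integral>\<^sup>+s. ennreal (\<gamma>\<^sup>2 * w s * (2 * (a s)\<^sup>2 + 8 * (bump_score \<delta> s)\<^sup>2)) \<partial>bump_prior \<delta>)"
    by (intro nn_integral_add) auto
  finally show ?thesis .
qed

section \<open>Information content of binary strings\<close>

text \<open>A reference law on all binary strings under which the negative logarithm of the probability is
linear in the length. It measures the information content of a transcript: relative to this law, the
cross-entropy of a random nonempty string is at most a multiple of its expected length.\<close>

definition code_pmf :: "bool list pmf" where
  "code_pmf = bind_pmf (geometric_pmf (1 / 2)) (\<lambda>n. pmf_of_set {z. length z = n})"

lemma finite_length_eq: "finite {z :: bool list. length z = n}"
  using finite_lists_length_eq[of "UNIV :: bool set" n] by simp

lemma pmf_code_pmf: "pmf code_pmf z = (1 / 4) ^ length z / 2"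
proof -
  let ?L = "length z"
  have ne: "{x :: bool list. length x = n} \<noteq> {}" for n
    using Ex_list_of_length[of n] by auto
  have card: "card {x :: bool list. length x = n} = 2 ^ n" for n
    using card_lists_length_eq[of "UNIV :: bool set" n] by simp
  have "pmf code_pmf z = (\<integral>n. pmf (pmf_of_set {x. length x = n}) z \<partial>geometric_pmf (1/2))"
    by (simp add: code_pmf_def pmf_bind)
  also have "\<dots> = (\<integral>n. indicator {?L} n * (1 / 2 ^ ?L) \<partial>geometric_pmf (1/2))"
    by (intro integral_cong_AE) (auto simp: pmf_of_set[OF ne finite_length_eq] card indicator_def)
  also have "\<dots> = pmf (geometric_pmf (1/2)) ?L * (1 / 2 ^ ?L)"
    by (simp add: measure_pmf_single)
  also have "\<dots> = (1 / 4) ^ ?L / 2"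
    by (simp add: power_divide flip: power_mult_distrib)
  finally show ?thesis .
qed

lemma pmf_code_pmf_pos: "0 < pmf code_pmf z"
  by (simp add: pmf_code_pmf)

lemma neg_ln_code_pmf:
  assumes "z \<noteq> []" shows "- ln (pmf code_pmf z) \<le> 3 * length z"
proof -
  have l: "1 \<le> real (length z)" using assms by (cases z) auto
  have ln2: "ln (2::real) \<le> 1" using ln_le_minus_one[of 2] by simp
  have "ln (4::real) = 2 * ln 2" using ln_realpow[of 2 2] by simp
  then have "- ln (pmf code_pmf z) = (2 * length z + 1) * ln 2"
    by (simp add: pmf_code_pmf ln_div ln_mult ln_realpow algebra_simps)
  also have "\<dots> \<le> real (2 * length z + 1) * 1"
    using ln2 by (intro mult_left_mono) auto
  also have "\<dots> \<le> 3 * length z" using l by simp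
  finally show ?thesis .
qed

text \<open>The pointwise core of the Gibbs variational principle: integrated over a parameter or an observation,
it bounds the mean of \<open>y\<close> on an event, described by the weight \<open>p\<close>, by an exponential moment of \<open>y\<close>.
Subtracting a constant from \<open>y\<close> first turns this constant into an information content.\<close>

lemma weighted_le_exp:
  fixes p y :: real
  assumes "0 \<le> p" "p \<le> 1"
  shows "p * y \<le> exp y"
proof (cases "y \<ge> 0")
  case True
  then have "p * y \<le> 1 * y" using assms by (intro mult_right_mono) auto
  also have "\<dots> \<le> exp y" using exp_ge_add_one_self[of y] by linarith
  finally show ?thesis .
next
  case False
  then have "p * y \<le> 0" using assms by (simp add: mult_nonneg_nonpos)
  then show ?thesis using exp_gt_zero[of y] by linarith
qed

text \<open>The strings of different machines are independent, so the mixed terms vanish and the Fisher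
information of the transcripts is the sum over the machines.\<close>

lemma second_moment_sum_Pi_pmf:
  fixes f :: "'i \<Rightarrow> 'a \<Rightarrow> real"
  assumes A: "finite A"
    and sq: "\<And>i. i \<in> A \<Longrightarrow> integrable (measure_pmf (p i)) (\<lambda>x. (f i x)\<^sup>2)"
    and mean: "\<And>i. i \<in> A \<Longrightarrow> (\<integral>x. f i x \<partial>measure_pmf (p i)) = 0"
  shows "integrable (measure_pmf (Pi_pmf A d p)) (\<lambda>z. (\<Sum>i\<in>A. f i (z i))\<^sup>2)"
    and "(\<integral>z. (\<Sum>i\<in>A. f i (z i))\<^sup>2 \<partial>measure_pmf (Pi_pmf A d p)) =
         (\<Sum>i\<in>A. \<integral>x. (f i x)\<^sup>2 \<partial>measure_pmf (p i))"
proof -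
  let ?P = "measure_pmf (Pi_pmf A d p)"
  let ?X = "\<lambda>i z. f i (z i)"
  note P = measure_pmf.prob_space_axioms[of "Pi_pmf A d p"]
  have comp: "map_pmf (\<lambda>z. z i) (Pi_pmf A d p) = p i" if "i \<in> A" for i
    using Pi_pmf_component[OF A, of i d p] that by simp
  have transfer: "integrable ?P (\<lambda>z. g (z i)) \<longleftrightarrow> integrable (measure_pmf (p i)) g"
      "(\<integral>z. g (z i) \<partial>?P) = (\<integral>x. g x \<partial>measure_pmf (p i))"
    if "i \<in> A" for i and g :: "'a \<Rightarrow> real"
    unfolding comp[OF that, symmetric] by simp_all
  have fin: "integrable (measure_pmf (p i)) (f i)" if "i \<in> A" for i
    by (rule measure_pmf.square_integrable_imp_integrable[OF _ sq[OF that]]) simp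
  have int_sq: "integrable ?P (\<lambda>z. (?X i z)\<^sup>2)"
      "(\<integral>z. (?X i z)\<^sup>2 \<partial>?P) = (\<integral>x. (f i x)\<^sup>2 \<partial>measure_pmf (p i))"
    if "i \<in> A" for i
    subgoal using sq[OF that] by (subst transfer(1)[OF that, where g = "\<lambda>x. (f i x)\<^sup>2"])
    subgoal by (rule transfer(2)[OF that, where g = "\<lambda>x. (f i x)\<^sup>2"])
    done
  have int1: "integrable ?P (?X i)" "(\<integral>z. ?X i z \<partial>?P) = 0" if "i \<in> A" for i
    subgoal using fin[OF that] by (subst transfer(1)[OF that, where g = "f i"])
    subgoal using mean[OF that] by (subst transfer(2)[OF that, where g = "f i"])
    done
  have cross: "integrable ?P (\<lambda>z. ?X i z * ?X j z)" "(\<integral>z. ?X i z * ?X j z \<partial>?P) = 0"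
    if ij: "i \<in> A" "j \<in> A" "i \<noteq> j" for i j
  proof -
    have "prob_space.indep_vars ?P (\<lambda>_. borel) ?X {i, j}"
      using prob_space.indep_vars_compose2[OF P indep_vars_Pi_pmf[OF A], where Y = f and N = "\<lambda>_. borel"] ij
      by (intro prob_space.indep_vars_subset[OF P, where J = "{i, j}" and I = A]) auto
    note * = prob_space.indep_vars_integrable[OF P _ this] prob_space.indep_vars_lebesgue_integral[OF P _ this]
    show "integrable ?P (\<lambda>z. ?X i z * ?X j z)" "(\<integral>z. ?X i z * ?X j z \<partial>?P) = 0"
      using * int1 ij by auto
  qed
  have expand: "(\<Sum>i\<in>A. ?X i z)\<^sup>2 = (\<Sum>i\<in>A. \<Sum>j\<in>A. ?X i z * ?X j z)" for z
    by (simp add: power2_eq_square sum_product)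
  have int: "integrable ?P (\<lambda>z. ?X i z * ?X j z)" if "i \<in> A" "j \<in> A" for i j
    using cross(1)[OF that] int_sq(1)[OF that(1)] by (cases "i = j") (auto simp: power2_eq_square)
  show "integrable ?P (\<lambda>z. (\<Sum>i\<in>A. ?X i z)\<^sup>2)"
    unfolding expand using int by (intro Bochner_Integration.integrable_sum)
  have "(\<integral>z. (\<Sum>i\<in>A. ?X i z)\<^sup>2 \<partial>?P) = (\<Sum>i\<in>A. \<Sum>j\<in>A. \<integral>z. ?X i z * ?X j z \<partial>?P)"
    unfolding expand using int by (simp add: Bochner_Integration.integral_sum Bochner_Integration.integrable_sum)
  also have "\<dots> = (\<Sum>i\<in>A. \<Sum>j\<in>A. if j = i then \<integral>x. (f i x)\<^sup>2 \<partial>measure_pmf (p i) else 0)"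
    using cross(2) int_sq(2) by (intro sum.cong) (auto simp: power2_eq_square)
  also have "\<dots> = (\<Sum>i\<in>A. \<integral>x. (f i x)\<^sup>2 \<partial>measure_pmf (p i))"
    using A by (simp add: sum.delta)
  finally show "(\<integral>z. (\<Sum>i\<in>A. ?X i z)\<^sup>2 \<partial>?P) = (\<Sum>i\<in>A. \<integral>x. (f i x)\<^sup>2 \<partial>measure_pmf (p i))" .
qed

section \<open>Observations seen through a randomized channel\<close>

definition mixture_pmf :: "'x measure \<Rightarrow> ('x \<Rightarrow> 'z pmf) \<Rightarrow> 'z pmf" where
  "mixture_pmf P K = embed_pmf (\<lambda>z. \<integral>x. pmf (K x) z \<partial>P)"

text \<open>Outputs of probability zero get the value zero by the convention for division. This is harmless, since
the value is always multiplied by that probability.\<close>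

definition cond_mean :: "'x measure \<Rightarrow> ('x \<Rightarrow> 'z pmf) \<Rightarrow> ('x \<Rightarrow> real) \<Rightarrow> 'z \<Rightarrow> real" where
  "cond_mean P K f z = (\<integral>x. pmf (K x) z * f x \<partial>P) / pmf (mixture_pmf P K) z"

locale channel = prob_space P for P :: "'x measure" +
  fixes K :: "'x \<Rightarrow> 'z :: countable pmf"
  assumes K_measurable [measurable]: "(\<lambda>x. pmf (K x) z) \<in> borel_measurable P"
begin

lemma nn_integral_kernel:
  fixes f :: "'x \<Rightarrow> ennreal"
  assumes [measurable]: "f \<in> borel_measurable P"
  shows "(\<integral>\<^sup>+z. \<integral>\<^sup>+x. ennreal (pmf (K x) z) * f x \<partial>P \<partial>count_space UNIV) = (\<integral>\<^sup>+x. f x \<partial>P)"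
proof -
  have "(\<integral>\<^sup>+z. \<integral>\<^sup>+x. ennreal (pmf (K x) z) * f x \<partial>P \<partial>count_space UNIV)
      = (\<integral>\<^sup>+x. \<integral>\<^sup>+z. ennreal (pmf (K x) z) * f x \<partial>count_space UNIV \<partial>P)"
    by (intro nn_integral_count_space_nn_integral[symmetric]) auto
  also have "\<dots> = (\<integral>\<^sup>+x. f x \<partial>P)"
    by (intro nn_integral_cong) (simp add: nn_integral_multc nn_integral_pmf_eq_1)
  finally show ?thesis .
qed

lemma integrable_pmf: "integrable P (\<lambda>x. pmf (K x) z)"
  by (intro integrable_const_bound[where B = 1]) (auto simp: pmf_le_1)

lemma integrable_pmf_mult: "integrable P f \<Longrightarrow> integrable P (\<lambda>x. pmf (K x) z * f x)"
  by (rule Bochner_Integration.integrable_bound[of _ f])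
    (auto simp: abs_mult pmf_le_1 intro!: mult_left_le_one_le)

lemma nn_integral_pmf_kernel: "(\<integral>\<^sup>+x. ennreal (pmf (K x) z) \<partial>P) = ennreal (\<integral>x. pmf (K x) z \<partial>P)"
  by (intro nn_integral_eq_integral integrable_pmf) auto

lemma pmf_mixture: "pmf (mixture_pmf P K) z = (\<integral>x. pmf (K x) z \<partial>P)"
  unfolding mixture_pmf_def
proof (rule pmf_embed_pmf)
  show "(\<integral>\<^sup>+z. ennreal (\<integral>x. pmf (K x) z \<partial>P) \<partial>count_space UNIV) = 1"
    using nn_integral_kernel[of "\<lambda>_. 1"] by (simp add: nn_integral_pmf_kernel emeasure_space_1)
qed simp

lemma ennreal_pmf_mixture: "ennreal (pmf (mixture_pmf P K) z) = (\<integral>\<^sup>+x. ennreal (pmf (K x) z) \<partial>P)"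
  by (simp add: pmf_mixture nn_integral_pmf_kernel)

lemma set_mixture_pmf:
  assumes "\<And>x. x \<in> space P \<Longrightarrow> set_pmf (K x) \<subseteq> C"
  shows "set_pmf (mixture_pmf P K) \<subseteq> C"
proof
  fix z assume "z \<in> set_pmf (mixture_pmf P K)"
  then have "(\<integral>x. pmf (K x) z \<partial>P) \<noteq> 0" by (simp add: set_pmf_iff pmf_mixture)
  then have "\<exists>x\<in>space P. pmf (K x) z \<noteq> 0"
    by (metis (mono_tags, lifting) Bochner_Integration.integral_cong integral_zero)
  then show "z \<in> C" using assms by (metis set_pmf_iff subsetD)
qed

lemma pmf_mult_cond_mean:
  "pmf (mixture_pmf P K) z * cond_mean P K f z = (\<integral>x. pmf (K x) z * f x \<partial>P)"
proof (cases "pmf (mixture_pmf P K) z = 0")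
  case True
  then have "(\<integral>x. pmf (K x) z \<partial>P) = 0" by (simp add: pmf_mixture)
  then have "AE x in P. pmf (K x) z = 0"
    using integral_nonneg_eq_0_iff_AE[OF integrable_pmf[of z]] by simp
  then have "(\<integral>x. pmf (K x) z * f x \<partial>P) = 0"
    by (intro integral_eq_zero_AE) auto
  then show ?thesis using True by simp
qed (simp add: cond_mean_def)

lemma cond_mean_diff:
  "integrable P f \<Longrightarrow> integrable P g \<Longrightarrow>
    cond_mean P K (\<lambda>x. f x - g x) z = cond_mean P K f z - cond_mean P K g z"
  by (simp add: cond_mean_def right_diff_distrib integrable_pmf_mult diff_divide_distrib)

lemma cond_mean_nonneg: "(\<And>x. 0 \<le> f x) \<Longrightarrow> 0 \<le> cond_mean P K f z"
  by (auto simp: cond_mean_def intro!: divide_nonneg_nonneg integral_nonneg)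

lemma nn_integral_cond_mean:
  assumes f: "integrable P f" "\<And>x. 0 \<le> f x"
  shows "(\<integral>\<^sup>+z. ennreal (cond_mean P K f z) \<partial>measure_pmf (mixture_pmf P K)) = ennreal (\<integral>x. f x \<partial>P)"
proof -
  have "(\<integral>\<^sup>+z. ennreal (cond_mean P K f z) \<partial>measure_pmf (mixture_pmf P K))
      = (\<integral>\<^sup>+z. ennreal (\<integral>x. pmf (K x) z * f x \<partial>P) \<partial>count_space UNIV)"
    using f(2) by (simp add: nn_integral_measure_pmf cond_mean_nonneg flip: pmf_mult_cond_mean ennreal_mult)
  also have "\<dots> = (\<integral>\<^sup>+z. \<integral>\<^sup>+x. ennreal (pmf (K x) z) * ennreal (f x) \<partial>P \<partial>count_space UNIV)"
    using f by (intro nn_integral_cong)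
      (simp add: nn_integral_eq_integral integrable_pmf_mult flip: ennreal_mult)
  also have "\<dots> = (\<integral>\<^sup>+x. ennreal (f x) \<partial>P)"
    using f(1) by (intro nn_integral_kernel) auto
  finally show ?thesis using f by (simp add: nn_integral_eq_integral)
qed

text \<open>The tower property. Positive and negative parts are treated separately, since Tonelli's theorem
needs no integrability over the pair of input and output.\<close>

lemma integral_cond_mean:
  assumes f: "integrable P f"
  shows "(\<integral>z. cond_mean P K f z \<partial>measure_pmf (mixture_pmf P K)) = (\<integral>x. f x \<partial>P)"
proof -
  let ?M = "measure_pmf (mixture_pmf P K)"
  have nonneg: "has_bochner_integral ?M (cond_mean P K g) (\<integral>x. g x \<partial>P)"
    if "integrable P g" "\<And>x. 0 \<le> g x" for g
    using nn_integral_cond_mean[OF that] that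
    by (intro has_bochner_integral_nn_integral) (auto simp: cond_mean_nonneg intro!: integral_nonneg)
  have pos: "integrable P (\<lambda>x. max 0 (f x))" and neg: "integrable P (\<lambda>x. max 0 (- f x))"
    using f by auto
  have f_eq: "f = (\<lambda>x. max 0 (f x) - max 0 (- f x))" by (auto simp: max_def)
  have "cond_mean P K f = (\<lambda>z. cond_mean P K (\<lambda>x. max 0 (f x)) z - cond_mean P K (\<lambda>x. max 0 (- f x)) z)"
    by (subst f_eq) (simp add: fun_eq_iff cond_mean_diff[OF pos neg])
  moreover have "(\<integral>x. f x \<partial>P) = (\<integral>x. max 0 (f x) \<partial>P) - (\<integral>x. max 0 (- f x) \<partial>P)"
    by (subst f_eq) (rule Bochner_Integration.integral_diff[OF pos neg])
  moreover have "has_bochner_integral ?M (\<lambda>z. cond_mean P K (\<lambda>x. max 0 (f x)) z - cond_mean P K (\<lambda>x. max 0 (- f x)) z)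
     ((\<integral>x. max 0 (f x) \<partial>P) - (\<integral>x. max 0 (- f x) \<partial>P))"
    by (intro has_bochner_integral_diff nonneg pos neg) auto
  ultimately show ?thesis by (simp add: has_bochner_integral_iff)
qed

lemma nn_integral_cond_mean_square_le:
  assumes f: "integrable P f" "integrable P (\<lambda>x. (f x)\<^sup>2)"
  shows "(\<integral>\<^sup>+z. ennreal ((cond_mean P K f z)\<^sup>2) \<partial>measure_pmf (mixture_pmf P K))
    \<le> ennreal (\<integral>x. (f x)\<^sup>2 \<partial>P)"
proof -
  let ?w = "pmf (mixture_pmf P K)"
  have jensen: "?w z * (cond_mean P K f z)\<^sup>2 \<le> ?w z * cond_mean P K (\<lambda>x. (f x)\<^sup>2) z" for z
  proof -
    define a where "a = cond_mean P K f z"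
    have "2 * a * (\<integral>x. pmf (K x) z * f x \<partial>P) = (\<integral>x. pmf (K x) z * (2 * a * f x) \<partial>P)"
      by (subst integral_mult_right_zero[symmetric]) (simp add: mult_ac)
    also have "\<dots> \<le> (\<integral>x. pmf (K x) z * (a\<^sup>2 + (f x)\<^sup>2) \<partial>P)"
      using f sum_squares_bound[of a] by (intro integral_mono integrable_pmf_mult mult_left_mono) auto
    also have "\<dots> = a\<^sup>2 * ?w z + (\<integral>x. pmf (K x) z * (f x)\<^sup>2 \<partial>P)"
      using f integrable_pmf_mult[OF f(2)] integrable_pmf
      by (simp add: distrib_left pmf_mixture mult.commute)
    finally have "2 * a * (?w z * a) \<le> a\<^sup>2 * ?w z + ?w z * cond_mean P K (\<lambda>x. (f x)\<^sup>2) z"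
      unfolding pmf_mult_cond_mean[symmetric] a_def .
    moreover have "2 * a * (?w z * a) = 2 * (?w z * a\<^sup>2)" by (simp add: power2_eq_square)
    moreover have "a\<^sup>2 * ?w z = ?w z * a\<^sup>2" by simp
    ultimately show ?thesis unfolding a_def by linarith
  qed
  have "(\<integral>\<^sup>+z. ennreal ((cond_mean P K f z)\<^sup>2) \<partial>measure_pmf (mixture_pmf P K))
     \<le> (\<integral>\<^sup>+z. ennreal (cond_mean P K (\<lambda>x. (f x)\<^sup>2) z) \<partial>measure_pmf (mixture_pmf P K))"
    unfolding nn_integral_measure_pmf
    by (intro nn_integral_mono)
      (use jensen in \<open>simp add: cond_mean_nonneg ennreal_leI flip: ennreal_mult\<close>)
  also have "\<dots> = ennreal (\<integral>x. (f x)\<^sup>2 \<partial>P)"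
    using f by (intro nn_integral_cond_mean) auto
  finally show ?thesis .
qed

end

lemma nn_integral_Pi_pmf_count_space:
  fixes p :: "'i \<Rightarrow> 'z :: countable pmf"
  assumes A: "finite A"
  shows "(\<integral>\<^sup>+z. F z \<partial>measure_pmf (Pi_pmf A d p)) =
    (\<integral>\<^sup>+z. ennreal (\<Prod>i\<in>A. pmf (p i) (z i)) * F z \<partial>count_space (PiE_dflt A d (\<lambda>_. UNIV)))"
proof -
  have "(\<integral>\<^sup>+z. F z \<partial>measure_pmf (Pi_pmf A d p)) =
     (\<integral>\<^sup>+z. ennreal (pmf (Pi_pmf A d p) z) * F z \<partial>count_space (PiE_dflt A d (\<lambda>_. UNIV)))"
    unfolding nn_integral_measure_pmf
    by (intro nn_integral_count_space_eq) (auto simp: pmf_Pi[OF A] PiE_dflt_def)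
  also have "\<dots> = (\<integral>\<^sup>+z. ennreal (\<Prod>i\<in>A. pmf (p i) (z i)) * F z \<partial>count_space (PiE_dflt A d (\<lambda>_. UNIV)))"
    by (intro nn_integral_cong) (auto simp: pmf_Pi'[OF A] PiE_dflt_def)
  finally show ?thesis .
qed

lemma countable_PiE_dflt:
  "finite A \<Longrightarrow> countable (PiE_dflt A d (\<lambda>_. UNIV :: 'z :: countable set))"
  unfolding dflt_image_PiE[symmetric] by (intro countable_image countable_PiE) auto

text \<open>Independent inputs, passed through private channels, give independent outputs. The joint law of the
transcripts is therefore the product of the laws of the single strings, and the data disappear
from the problem.\<close>

lemma nn_integral_product_channel:
  fixes K :: "'i \<Rightarrow> 'x \<Rightarrow> 'z :: countable pmf"
  assumes A: "finite A" and K: "\<And>i. i \<in> A \<Longrightarrow> channel (P i) (K i)"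
    and P: "\<And>i. prob_space (P i)"
  shows "(\<integral>\<^sup>+X. \<integral>\<^sup>+z. F z \<partial>measure_pmf (Pi_pmf A d (\<lambda>i. K i (X i))) \<partial>PiM A P) =
    (\<integral>\<^sup>+z. F z \<partial>measure_pmf (Pi_pmf A d (\<lambda>i. mixture_pmf (P i) (K i))))"
proof -
  interpret product_prob_space P A by (rule product_prob_spaceI[OF P])
  have meas: "(\<lambda>X. ennreal (pmf (K i (X i)) (z i))) \<in> borel_measurable (PiM A P)" if "i \<in> A" for i z
    using channel.K_measurable[OF K[OF that]] that
    by (intro measurable_compose[OF _ measurable_ennreal] measurable_compose[OF measurable_component_singleton[OF that]])
  have eq: "(\<integral>\<^sup>+X. ennreal (\<Prod>i\<in>A. pmf (K i (X i)) (z i)) * F z \<partial>PiM A P)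
      = ennreal (\<Prod>i\<in>A. pmf (mixture_pmf (P i) (K i)) (z i)) * F z" for z
  proof -
    have "(\<integral>\<^sup>+X. ennreal (\<Prod>i\<in>A. pmf (K i (X i)) (z i)) * F z \<partial>PiM A P)
      = (\<integral>\<^sup>+X. (\<Prod>i\<in>A. ennreal (pmf (K i (X i)) (z i))) \<partial>PiM A P) * F z"
      using meas by (subst nn_integral_multc[symmetric]) (auto simp: prod_ennreal intro!: borel_measurable_prod_ennreal)
    also have "(\<integral>\<^sup>+X. (\<Prod>i\<in>A. ennreal (pmf (K i (X i)) (z i))) \<partial>PiM A P)
       = (\<Prod>i\<in>A. \<integral>\<^sup>+x. ennreal (pmf (K i x) (z i)) \<partial>P i)"
      using A channel.K_measurable[OF K] by (intro product_nn_integral_prod) auto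
    also have "\<dots> = (\<Prod>i\<in>A. ennreal (pmf (mixture_pmf (P i) (K i)) (z i)))"
      by (intro prod.cong refl) (simp add: channel.ennreal_pmf_mixture[OF K])
    finally show ?thesis by (simp add: prod_ennreal)
  qed
  have "(\<integral>\<^sup>+X. \<integral>\<^sup>+z. F z \<partial>measure_pmf (Pi_pmf A d (\<lambda>i. K i (X i))) \<partial>PiM A P) =
      (\<integral>\<^sup>+X. \<integral>\<^sup>+z. ennreal (\<Prod>i\<in>A. pmf (K i (X i)) (z i)) * F z \<partial>count_space (PiE_dflt A d (\<lambda>_. UNIV)) \<partial>PiM A P)"
    by (simp add: nn_integral_Pi_pmf_count_space[OF A])
  also have "\<dots> = (\<integral>\<^sup>+z. \<integral>\<^sup>+X. ennreal (\<Prod>i\<in>A. pmf (K i (X i)) (z i)) * F z \<partial>PiM A P \<partial>count_space (PiE_dflt A d (\<lambda>_. UNIV)))"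
    using meas by (intro nn_integral_count_space_nn_integral countable_PiE_dflt A borel_measurable_times)
      (auto simp flip: prod_ennreal intro!: borel_measurable_prod_ennreal)
  also have "\<dots> = (\<integral>\<^sup>+z. F z \<partial>measure_pmf (Pi_pmf A d (\<lambda>i. mixture_pmf (P i) (K i))))"
    by (simp add: eq nn_integral_Pi_pmf_count_space[OF A])
  finally show ?thesis .
qed

section \<open>Messages about a Gaussian sequence\<close>

lemma sets_machine_law [simp, measurable_cong]: "sets (machine_law \<sigma> \<theta>) = sets seq_space"
  unfolding machine_law_def by (intro sets_PiM_cong) auto

lemma space_machine_law [simp]: "space (machine_law \<sigma> \<theta>) = space seq_space"
  by (rule sets_eq_imp_space_eq) simp

lemma prob_space_machine_law:
  assumes "0 < \<sigma>" shows "prob_space (machine_law \<sigma> \<theta>)"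
  unfolding machine_law_def by (intro prob_space_PiM prob_space_normal_density assms)

text \<open>The log-likelihood ratio at \<open>x\<close> for moving the mean from \<open>\<theta>\<close> by \<open>b\<close> on the coordinates in \<open>J\<close>.\<close>

definition log_ratio ::
    "real \<Rightarrow> (nat \<times> nat) set \<Rightarrow> (nat \<times> nat \<Rightarrow> real) \<Rightarrow> (nat \<times> nat \<Rightarrow> real) \<Rightarrow> (nat \<times> nat \<Rightarrow> real) \<Rightarrow> real" where
  "log_ratio \<sigma> J \<theta> b x = (\<Sum>c\<in>J. b c * (x c - \<theta> c) / \<sigma>\<^sup>2 - (b c)\<^sup>2 / (2 * \<sigma>\<^sup>2))"

lemma normal_density_shift:
  assumes "0 < \<sigma>"
  shows "normal_density (a + b) \<sigma> x = normal_density a \<sigma> x * exp (b * (x - a) / \<sigma>\<^sup>2 - b\<^sup>2 / (2 * \<sigma>\<^sup>2))"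
proof -
  have "- (x - (a + b))\<^sup>2 / (2 * \<sigma>\<^sup>2) = - (x - a)\<^sup>2 / (2 * \<sigma>\<^sup>2) + (b * (x - a) / \<sigma>\<^sup>2 - b\<^sup>2 / (2 * \<sigma>\<^sup>2))"
    using assms by (simp add: field_simps power2_eq_square)
  then show ?thesis by (simp only: normal_density_def exp_add)
qed

lemma machine_law_shift:
  assumes \<sigma>: "0 < \<sigma>" and J: "finite J" "J \<subseteq> coeffs"
    and "\<And>c. c \<in> J \<Longrightarrow> \<theta>' c = \<theta> c + b c" "\<And>c. c \<in> coeffs - J \<Longrightarrow> \<theta>' c = \<theta> c"
  shows "machine_law \<sigma> \<theta>' = density (machine_law \<sigma> \<theta>) (\<lambda>x. ennreal (exp (log_ratio \<sigma> J \<theta> b x)))"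
proof -
  define g where "g c y = ennreal (exp (b c * (y - \<theta> c) / \<sigma>\<^sup>2 - (b c)\<^sup>2 / (2 * \<sigma>\<^sup>2)))" for c y
  have [measurable]: "g c \<in> borel_measurable borel" for c by (simp add: g_def[abs_def])
  have "machine_law \<sigma> \<theta>' = density (machine_law \<sigma> \<theta>) (\<lambda>x. \<Prod>c\<in>J. g c (x c))"
    unfolding machine_law_def
  proof (rule PiM_density_finite)
    fix c assume "c \<in> J"
    then show "density lborel (\<lambda>x. ennreal (normal_density (\<theta>' c) \<sigma> x)) =
       density (density lborel (\<lambda>x. ennreal (normal_density (\<theta> c) \<sigma> x))) (g c)"
      by (subst density_density_eq) (auto simp: assms normal_density_shift g_def ennreal_mult intro!: density_cong)
  qed (auto simp: assms prob_space_normal_density)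
  also have "(\<lambda>x. \<Prod>c\<in>J. g c (x c)) = (\<lambda>x. ennreal (exp (log_ratio \<sigma> J \<theta> b x)))"
    using J(1) by (simp add: g_def prod_ennreal log_ratio_def exp_sum)
  finally show ?thesis .
qed

lemma log_ratio_measurable [measurable]:
  "J \<subseteq> coeffs \<Longrightarrow> log_ratio \<sigma> J \<theta> b \<in> borel_measurable seq_space"
  unfolding log_ratio_def[abs_def]
  by (intro borel_measurable_sum borel_measurable_diff borel_measurable_divide borel_measurable_times
      borel_measurable_const measurable_component_singleton) auto

lemma has_integral_exp_log_ratio:
  assumes \<sigma>: "0 < \<sigma>" and J: "finite J" "J \<subseteq> coeffs"
  shows "has_bochner_integral (machine_law \<sigma> \<theta>) (\<lambda>x. exp (log_ratio \<sigma> J \<theta> b x)) 1"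
proof -
  define \<theta>' where "\<theta>' c = (if c \<in> J then \<theta> c + b c else \<theta> c)" for c
  interpret P: prob_space "machine_law \<sigma> \<theta>'" by (rule prob_space_machine_law[OF \<sigma>])
  have "(\<integral>\<^sup>+x. ennreal (exp (log_ratio \<sigma> J \<theta> b x)) \<partial>machine_law \<sigma> \<theta>) = emeasure (machine_law \<sigma> \<theta>') (space seq_space)"
    using J by (subst machine_law_shift[OF \<sigma> J, of \<theta>' \<theta> b])
      (auto simp: \<theta>'_def emeasure_density intro!: nn_integral_cong)
  also have "\<dots> = 1" using P.emeasure_space_1 by simp
  finally show ?thesis
    using J by (intro has_bochner_integral_nn_integral) auto
qed

lemma coordinate_moments:
  assumes \<sigma>: "0 < \<sigma>" and c: "c \<in> coeffs"
  shows "integrable (machine_law \<sigma> \<theta>) (\<lambda>x. x c - \<theta> c)"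
    and "(\<integral>x. x c - \<theta> c \<partial>machine_law \<sigma> \<theta>) = 0"
    and "integrable (machine_law \<sigma> \<theta>) (\<lambda>x. (x c - \<theta> c)\<^sup>2)"
    and "(\<integral>x. (x c - \<theta> c)\<^sup>2 \<partial>machine_law \<sigma> \<theta>) = \<sigma>\<^sup>2"
proof -
  let ?N = "\<lambda>c. density lborel (\<lambda>x. ennreal (normal_density (\<theta> c) \<sigma> x))"
  have "distr (machine_law \<sigma> \<theta>) (?N c) (\<lambda>x. x c) = ?N c"
    unfolding machine_law_def using c by (intro distr_PiM_component prob_space_normal_density \<sigma>)
  then have d: "distr (machine_law \<sigma> \<theta>) borel (\<lambda>x. x c) = ?N c"
    by (metis distr_cong sets_density sets_lborel)
  have [measurable]: "(\<lambda>x. x c) \<in> borel_measurable (machine_law \<sigma> \<theta>)"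
    using measurable_component_singleton[OF c, of "\<lambda>_. borel :: real measure"] by simp
  have tr: "integrable (machine_law \<sigma> \<theta>) (\<lambda>x. f (x c)) \<longleftrightarrow> integrable lborel (\<lambda>y. normal_density (\<theta> c) \<sigma> y * f y)"
    "(\<integral>x. f (x c) \<partial>machine_law \<sigma> \<theta>) = (\<integral>y. normal_density (\<theta> c) \<sigma> y * f y \<partial>lborel)"
    if [measurable]: "f \<in> borel_measurable borel" for f :: "real \<Rightarrow> real"
  proof -
    show "integrable (machine_law \<sigma> \<theta>) (\<lambda>x. f (x c)) \<longleftrightarrow> integrable lborel (\<lambda>y. normal_density (\<theta> c) \<sigma> y * f y)"
      using integrable_distr_eq[of "\<lambda>x. x c" "machine_law \<sigma> \<theta>" borel f] \<sigma>
      by (simp add: d integrable_density)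
    show "(\<integral>x. f (x c) \<partial>machine_law \<sigma> \<theta>) = (\<integral>y. normal_density (\<theta> c) \<sigma> y * f y \<partial>lborel)"
      using integral_distr[of "\<lambda>x. x c" "machine_law \<sigma> \<theta>" borel f] \<sigma>
      by (simp add: d integral_density)
  qed
  show "integrable (machine_law \<sigma> \<theta>) (\<lambda>x. x c - \<theta> c)"
    using tr(1)[of "\<lambda>y. y - \<theta> c"] integrable_normal_moment[OF \<sigma>, of "\<theta> c" 1] by simp
  show "integrable (machine_law \<sigma> \<theta>) (\<lambda>x. (x c - \<theta> c)\<^sup>2)"
    using tr(1)[of "\<lambda>y. (y - \<theta> c)\<^sup>2"] integrable_normal_moment[OF \<sigma>, of "\<theta> c" 2] by simp
  show "(\<integral>x. x c - \<theta> c \<partial>machine_law \<sigma> \<theta>) = 0"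
    using tr(2)[of "\<lambda>y. y - \<theta> c"] integral_normal_moment_odd[OF \<sigma>, of "\<theta> c" 0] by simp
  show "(\<integral>x. (x c - \<theta> c)\<^sup>2 \<partial>machine_law \<sigma> \<theta>) = \<sigma>\<^sup>2"
    using tr(2)[of "\<lambda>y. (y - \<theta> c)\<^sup>2"] integral_normal_moment_even[OF \<sigma>, of "\<theta> c" 1] by simp
qed

text \<open>One machine: it observes the Gaussian sequence and sends a random message \<open>K x\<close>. The law of the
message and the score of this law are functions of the unknown mean \<open>\<theta>\<close>. By the usual identity, the
score is the conditional mean of the score of the observation.\<close>

locale gaussian_channel =
  fixes \<sigma> :: real and K :: "(nat \<times> nat \<Rightarrow> real) \<Rightarrow> 'z :: countable pmf"
  assumes \<sigma>: "0 < \<sigma>"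
    and K_measurable [measurable]: "(\<lambda>x. pmf (K x) z) \<in> borel_measurable seq_space"
begin

definition law :: "(nat \<times> nat \<Rightarrow> real) \<Rightarrow> 'z pmf" where
  "law \<theta> = mixture_pmf (machine_law \<sigma> \<theta>) K"

definition score :: "(nat \<times> nat \<Rightarrow> real) \<Rightarrow> 'z \<Rightarrow> nat \<times> nat \<Rightarrow> real" where
  "score \<theta> z c = cond_mean (machine_law \<sigma> \<theta>) K (\<lambda>x. (x c - \<theta> c) / \<sigma>\<^sup>2) z"

lemma channel: "channel (machine_law \<sigma> \<theta>) K"
proof -
  interpret prob_space "machine_law \<sigma> \<theta>" by (rule prob_space_machine_law[OF \<sigma>])
  show ?thesis by unfold_locales simp
qed

lemma pmf_law: "pmf (law \<theta>) z = (\<integral>x. pmf (K x) z \<partial>machine_law \<sigma> \<theta>)"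
  unfolding law_def by (rule channel.pmf_mixture[OF channel])

lemma pmf_law_score:
  "pmf (law \<theta>) z * score \<theta> z c = (\<integral>x. pmf (K x) z * ((x c - \<theta> c) / \<sigma>\<^sup>2) \<partial>machine_law \<sigma> \<theta>)"
  unfolding law_def score_def by (rule channel.pmf_mult_cond_mean[OF channel])

lemma integral_score:
  assumes "c \<in> coeffs" shows "(\<integral>z. score \<theta> z c \<partial>measure_pmf (law \<theta>)) = 0"
  unfolding law_def score_def
  using coordinate_moments[OF \<sigma> assms, of \<theta>] by (subst channel.integral_cond_mean[OF channel]) auto

text \<open>Conditioning contracts the second moment, so a message carries at most the information of the
observation.\<close>

lemma nn_integral_score_square:
  assumes "c \<in> coeffs"
  shows "(\<integral>\<^sup>+z. ennreal ((score \<theta> z c)\<^sup>2) \<partial>measure_pmf (law \<theta>)) \<le> ennreal (1 / \<sigma>\<^sup>2)"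
proof -
  have "(\<integral>\<^sup>+z. ennreal ((score \<theta> z c)\<^sup>2) \<partial>measure_pmf (law \<theta>)) \<le>
     ennreal (\<integral>x. ((x c - \<theta> c) / \<sigma>\<^sup>2)\<^sup>2 \<partial>machine_law \<sigma> \<theta>)"
    unfolding law_def score_def using coordinate_moments[OF \<sigma> assms, of \<theta>]
    by (intro channel.nn_integral_cond_mean_square_le[OF channel]) (auto simp: power_divide)
  also have "(\<integral>x. ((x c - \<theta> c) / \<sigma>\<^sup>2)\<^sup>2 \<partial>machine_law \<sigma> \<theta>) = 1 / \<sigma>\<^sup>2"
    using coordinate_moments[OF \<sigma> assms, of \<theta>] \<sigma> by (simp add: power_divide) (simp add: power2_eq_square power4_eq_xxxx)
  finally show ?thesis .
qed

lemma integrable_score_square: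
  assumes "c \<in> coeffs" shows "integrable (measure_pmf (law \<theta>)) (\<lambda>z. (score \<theta> z c)\<^sup>2)"
proof (rule integrableI_bounded)
  show "(\<integral>\<^sup>+z. ennreal (norm ((score \<theta> z c)\<^sup>2)) \<partial>measure_pmf (law \<theta>)) < \<infinity>"
    using nn_integral_score_square[OF assms, of \<theta>] by (simp add: order_le_less_trans)
qed simp

text \<open>A message of few bits carries little Fisher information, whatever the dimension. Let \<open>a\<close> be the
score vector for the message \<open>z\<close>. The function \<open>log_ratio\<close> with shift \<open>\<sigma>\<^sup>2 * a\<close> is affine in the
observation and its exponential has mean one, while its conditional mean given \<open>z\<close> is
\<open>\<sigma>\<^sup>2 / 2\<close> times the squared length of \<open>a\<close>. By the Gibbs inequality this conditional mean is at most
of the order of the information content of \<open>z\<close> under the reference law \<open>\<rho>\<close>; summation over \<open>z\<close> gives the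
cross-entropy. Applying it to the whole vector at once, and not coordinate by coordinate, is what
makes the bound free of the dimension.\<close>

lemma score_information:
  assumes J: "finite J" "J \<subseteq> coeffs" and \<rho>: "\<And>z. 0 < pmf \<rho> z"
  shows "(\<integral>\<^sup>+z. ennreal (\<sigma>\<^sup>2 / 2 * (\<Sum>c\<in>J. (score \<theta> z c)\<^sup>2)) \<partial>measure_pmf (law \<theta>))
    \<le> (\<integral>\<^sup>+z. ennreal (- ln (pmf \<rho> z)) \<partial>measure_pmf (law \<theta>)) + 1"
proof -
  let ?P = "machine_law \<sigma> \<theta>"
  interpret prob_space ?P by (rule prob_space_machine_law[OF \<sigma>])
  have ln: "0 \<le> - ln (pmf \<rho> z)" for z
    using \<rho>[of z] pmf_le_1[of \<rho> z] by simp
  have key: "pmf (law \<theta>) z * (\<sigma>\<^sup>2 / 2 * (\<Sum>c\<in>J. (score \<theta> z c)\<^sup>2)) \<le> pmf (law \<theta>) z * - ln (pmf \<rho> z) + pmf \<rho> z" for z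
  proof -
    define a where "a = score \<theta> z"
    (* The shift that maximizes the conditional mean of the log-likelihood ratio. *)
    define b where "b c = \<sigma>\<^sup>2 * a c" for c
    note int1 = channel.integrable_pmf[OF channel, of \<theta> z]
    note int2 = channel.integrable_pmf_mult[OF channel, of \<theta> _ z]
    have lin: "integrable ?P (\<lambda>x. (x c - \<theta> c) / \<sigma>\<^sup>2)" if "c \<in> J" for c
      using coordinate_moments(1)[OF \<sigma>, of c \<theta>] that J by auto
    have lr: "log_ratio \<sigma> J \<theta> b x = (\<Sum>c\<in>J. b c * ((x c - \<theta> c) / \<sigma>\<^sup>2)) - \<sigma>\<^sup>2 / 2 * (\<Sum>c\<in>J. (a c)\<^sup>2)" for x
      using \<sigma> by (simp add: log_ratio_def b_def sum_subtractf sum_distrib_left power2_eq_square mult_ac)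
    have int3: "integrable ?P (\<lambda>x. log_ratio \<sigma> J \<theta> b x)"
      unfolding lr using lin by (intro Bochner_Integration.integrable_diff Bochner_Integration.integrable_sum integrable_mult_right) auto
    have "(\<integral>x. pmf (K x) z * (log_ratio \<sigma> J \<theta> b x + ln (pmf \<rho> z)) \<partial>?P) \<le> (\<integral>x. pmf \<rho> z * exp (log_ratio \<sigma> J \<theta> b x) \<partial>?P)"
    proof (rule integral_mono)
      show "integrable ?P (\<lambda>x. pmf (K x) z * (log_ratio \<sigma> J \<theta> b x + ln (pmf \<rho> z)))"
        using int3 by (intro int2) auto
      show "integrable ?P (\<lambda>x. pmf \<rho> z * exp (log_ratio \<sigma> J \<theta> b x))"
        using has_integral_exp_log_ratio[OF \<sigma> J, of \<theta> b] by (auto simp: has_bochner_integral_iff)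
      fix x
      show "pmf (K x) z * (log_ratio \<sigma> J \<theta> b x + ln (pmf \<rho> z)) \<le> pmf \<rho> z * exp (log_ratio \<sigma> J \<theta> b x)"
        using weighted_le_exp[of "pmf (K x) z" "log_ratio \<sigma> J \<theta> b x + ln (pmf \<rho> z)"] \<rho>[of z]
        by (simp add: pmf_le_1 exp_add mult.commute)
    qed
    also have "\<dots> = pmf \<rho> z"
      using has_integral_exp_log_ratio[OF \<sigma> J, of \<theta> b] by (simp add: has_bochner_integral_iff)
    also have "(\<integral>x. pmf (K x) z * (log_ratio \<sigma> J \<theta> b x + ln (pmf \<rho> z)) \<partial>?P) =
        (\<Sum>c\<in>J. b c * (pmf (law \<theta>) z * a c)) - pmf (law \<theta>) z * (\<sigma>\<^sup>2 / 2 * (\<Sum>c\<in>J. (a c)\<^sup>2)) + pmf (law \<theta>) z * ln (pmf \<rho> z)"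
    proof -
      have "(\<integral>x. pmf (K x) z * (log_ratio \<sigma> J \<theta> b x + ln (pmf \<rho> z)) \<partial>?P) =
         (\<integral>x. (\<Sum>c\<in>J. b c * (pmf (K x) z * ((x c - \<theta> c) / \<sigma>\<^sup>2))) - pmf (K x) z * (\<sigma>\<^sup>2 / 2 * (\<Sum>c\<in>J. (a c)\<^sup>2))
            + pmf (K x) z * ln (pmf \<rho> z) \<partial>?P)"
        unfolding lr by (intro Bochner_Integration.integral_cong) (auto simp: distrib_left right_diff_distrib sum_distrib_left mult_ac)
      also have "\<dots> = (\<Sum>c\<in>J. b c * (\<integral>x. pmf (K x) z * ((x c - \<theta> c) / \<sigma>\<^sup>2) \<partial>?P))
            - (\<integral>x. pmf (K x) z \<partial>?P) * (\<sigma>\<^sup>2 / 2 * (\<Sum>c\<in>J. (a c)\<^sup>2)) + (\<integral>x. pmf (K x) z \<partial>?P) * ln (pmf \<rho> z)"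
      proof -
        have i1: "integrable ?P (\<lambda>x. b c * (pmf (K x) z * ((x c - \<theta> c) / \<sigma>\<^sup>2)))" if "c \<in> J" for c
          by (intro integrable_mult_right int2 lin that)
        have i2: "integrable ?P (\<lambda>x. \<Sum>c\<in>J. b c * (pmf (K x) z * ((x c - \<theta> c) / \<sigma>\<^sup>2)))"
          by (intro Bochner_Integration.integrable_sum i1)
        have i3: "integrable ?P (\<lambda>x. pmf (K x) z * r)" for r
          by (intro integrable_mult_left int1)
        show ?thesis
          unfolding Bochner_Integration.integral_add[OF Bochner_Integration.integrable_diff[OF i2 i3] i3]
            Bochner_Integration.integral_diff[OF i2 i3] integral_mult_left_zero
          by (simp only: Bochner_Integration.integral_sum[OF i1] integral_mult_right_zero)
      qed
      finally show ?thesis by (simp only: a_def pmf_law_score flip: pmf_law)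
    qed
    also have "(\<Sum>c\<in>J. b c * (pmf (law \<theta>) z * a c)) = 2 * (pmf (law \<theta>) z * (\<sigma>\<^sup>2 / 2 * (\<Sum>c\<in>J. (a c)\<^sup>2)))"
      by (simp add: b_def sum_distrib_left power2_eq_square mult_ac)
    finally show ?thesis unfolding a_def mult_minus_right by linarith
  qed
  have "(\<integral>\<^sup>+z. ennreal (\<sigma>\<^sup>2 / 2 * (\<Sum>c\<in>J. (score \<theta> z c)\<^sup>2)) \<partial>measure_pmf (law \<theta>))
     = (\<integral>\<^sup>+z. ennreal (pmf (law \<theta>) z * (\<sigma>\<^sup>2 / 2 * (\<Sum>c\<in>J. (score \<theta> z c)\<^sup>2))) \<partial>count_space UNIV)"
    unfolding nn_integral_measure_pmf by (intro nn_integral_cong ennreal_mult[symmetric]) (auto intro!: mult_nonneg_nonneg sum_nonneg)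
  also have "\<dots> \<le> (\<integral>\<^sup>+z. ennreal (pmf (law \<theta>) z) * ennreal (- ln (pmf \<rho> z)) + ennreal (pmf \<rho> z) \<partial>count_space UNIV)"
  proof (intro nn_integral_mono)
    fix z
    have "ennreal (pmf (law \<theta>) z * (\<sigma>\<^sup>2 / 2 * (\<Sum>c\<in>J. (score \<theta> z c)\<^sup>2))) \<le>
        ennreal (pmf (law \<theta>) z * - ln (pmf \<rho> z) + pmf \<rho> z)"
      by (rule ennreal_leI[OF key])
    also have "\<dots> = ennreal (pmf (law \<theta>) z * - ln (pmf \<rho> z)) + ennreal (pmf \<rho> z)"
      using ln[of z] by (intro ennreal_plus mult_nonneg_nonneg) auto
    also have "ennreal (pmf (law \<theta>) z * - ln (pmf \<rho> z)) = ennreal (pmf (law \<theta>) z) * ennreal (- ln (pmf \<rho> z))"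
      using ln[of z] by (intro ennreal_mult) auto
    finally show "ennreal (pmf (law \<theta>) z * (\<sigma>\<^sup>2 / 2 * (\<Sum>c\<in>J. (score \<theta> z c)\<^sup>2))) \<le>
        ennreal (pmf (law \<theta>) z) * ennreal (- ln (pmf \<rho> z)) + ennreal (pmf \<rho> z)" .
  qed
  also have "\<dots> = (\<integral>\<^sup>+z. ennreal (- ln (pmf \<rho> z)) \<partial>measure_pmf (law \<theta>)) + 1"
    by (simp add: nn_integral_add nn_integral_measure_pmf nn_integral_pmf_eq_1)
  finally show ?thesis .
qed

text \<open>Moving one coordinate of the mean to \<open>s\<close> multiplies the law with \<open>s = 0\<close> by a Gaussian factor in \<open>s\<close>
times an exponential tilt in that coordinate. Hence the probability of a message is twice
differentiable in \<open>s\<close>, which gives the derivative and its continuity.\<close>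

lemma
  assumes c: "c \<in> coeffs"
  shows DERIV_pmf_law: "((\<lambda>s. pmf (law (\<theta>(c := s))) z) has_real_derivative
        pmf (law (\<theta>(c := s))) z * score (\<theta>(c := s)) z c) (at s)"
    and continuous_pmf_law_score:
      "continuous_on UNIV (\<lambda>s. pmf (law (\<theta>(c := s))) z * score (\<theta>(c := s)) z c)"
proof -
  define \<theta>0 where "\<theta>0 = \<theta>(c := 0)"
  let ?P = "machine_law \<sigma> \<theta>0"
  let ?J = "{c}"
  have J: "finite ?J" "?J \<subseteq> coeffs" using c by auto
  have [measurable]: "(\<lambda>x. x c) \<in> borel_measurable seq_space"
    by (rule measurable_component_singleton[OF c])
  have shift: "machine_law \<sigma> (\<theta>(c := s)) = density ?P (\<lambda>x. ennreal (exp (log_ratio \<sigma> ?J \<theta>0 (\<lambda>_. s) x)))" for s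
    by (intro machine_law_shift[OF \<sigma> J]) (auto simp: \<theta>0_def)
  have lr: "exp (log_ratio \<sigma> ?J \<theta>0 (\<lambda>_. s) x) = exp (- s\<^sup>2 / (2 * \<sigma>\<^sup>2)) * exp (s * (x c / \<sigma>\<^sup>2))" for s x
    by (simp add: log_ratio_def \<theta>0_def flip: exp_add)
  have [measurable]: "(\<lambda>x. log_ratio \<sigma> ?J \<theta>0 b x) \<in> borel_measurable ?P" for b
    using log_ratio_measurable[OF J(2)] by simp
  have tilt: "integrable ?P (\<lambda>x. pmf (K x) z * exp (s * (x c / \<sigma>\<^sup>2)))" for s
  proof (rule channel.integrable_pmf_mult[OF channel])
    show "integrable ?P (\<lambda>x. exp (s * (x c / \<sigma>\<^sup>2)))"
      using has_integral_exp_log_ratio[OF \<sigma> J, of \<theta>0 "\<lambda>_. s"] unfolding lr by (simp add: has_bochner_integral_iff)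
  qed
  have tilt1: "integrable ?P (\<lambda>x. pmf (K x) z * (x c / \<sigma>\<^sup>2) * exp (s * (x c / \<sigma>\<^sup>2)))" for s
    by (rule integrable_exp_tilt_mult[OF _ _ tilt]) measurable
  define A0 where "A0 s = (\<integral>x. pmf (K x) z * exp (s * (x c / \<sigma>\<^sup>2)) \<partial>?P)" for s
  define A1 where "A1 s = (\<integral>x. pmf (K x) z * (x c / \<sigma>\<^sup>2) * exp (s * (x c / \<sigma>\<^sup>2)) \<partial>?P)" for s
  define A2 where "A2 s = (\<integral>x. pmf (K x) z * (x c / \<sigma>\<^sup>2) * (x c / \<sigma>\<^sup>2) * exp (s * (x c / \<sigma>\<^sup>2)) \<partial>?P)" for s
  define E where "E s = exp (- s\<^sup>2 / (2 * \<sigma>\<^sup>2))" for s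
  have A0: "(A0 has_real_derivative A1 s) (at s)" for s
    unfolding A0_def[abs_def] A1_def by (rule DERIV_integral_exp_tilt[OF _ _ tilt]) measurable
  have A1: "(A1 has_real_derivative A2 s) (at s)" for s
    unfolding A1_def[abs_def] A2_def by (rule DERIV_integral_exp_tilt[OF _ _ tilt1]) measurable
  have E: "(E has_real_derivative E s * (- s / \<sigma>\<^sup>2)) (at s)" for s
    unfolding E_def[abs_def] using \<sigma>
    by (auto intro!: derivative_eq_intros simp: field_simps power2_eq_square)
  have law_eq: "pmf (law (\<theta>(c := s))) z = E s * A0 s" for s
  proof -
    have "pmf (law (\<theta>(c := s))) z = (\<integral>x. E s * (pmf (K x) z * exp (s * (x c / \<sigma>\<^sup>2))) \<partial>?P)"
      unfolding pmf_law shift by (subst integral_density) (auto simp: lr E_def mult_ac)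
    then show ?thesis by (simp add: A0_def)
  qed
  have score_eq: "pmf (law (\<theta>(c := s))) z * score (\<theta>(c := s)) z c = E s * A1 s + E s * (- s / \<sigma>\<^sup>2) * A0 s" for s
  proof -
    have "pmf (law (\<theta>(c := s))) z * score (\<theta>(c := s)) z c =
        (\<integral>x. E s * (pmf (K x) z * (x c / \<sigma>\<^sup>2) * exp (s * (x c / \<sigma>\<^sup>2)))
          + E s * (- s / \<sigma>\<^sup>2) * (pmf (K x) z * exp (s * (x c / \<sigma>\<^sup>2))) \<partial>?P)"
      unfolding pmf_law_score shift
      by (subst integral_density) (auto simp: lr E_def algebra_simps diff_divide_distrib)
    also have "\<dots> = E s * A1 s + E s * (- s / \<sigma>\<^sup>2) * A0 s"
      unfolding A0_def A1_def using tilt tilt1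
      by (subst Bochner_Integration.integral_add) (auto simp only: integral_mult_right_zero intro!: integrable_mult_right)
    finally show ?thesis .
  qed
  show "((\<lambda>s. pmf (law (\<theta>(c := s))) z) has_real_derivative
        pmf (law (\<theta>(c := s))) z * score (\<theta>(c := s)) z c) (at s)"
    unfolding score_eq unfolding law_eq
    by (rule DERIV_cong[OF DERIV_mult[OF E A0]]) (simp add: algebra_simps)
  have "continuous_on UNIV E" "continuous_on UNIV A0" "continuous_on UNIV A1"
    using E A0 A1 by (meson DERIV_isCont continuous_at_imp_continuous_on)+
  then show "continuous_on UNIV (\<lambda>s. pmf (law (\<theta>(c := s))) z * score (\<theta>(c := s)) z c)"
    unfolding score_eq using \<sigma> by (intro continuous_intros) auto
qed

end

text \<open>Parameters of one level live in a finite product space, whose elements are undefined outside the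
index set. As parameters of the sequence model they must be zero there.\<close>

definition extend_zero :: "'c set \<Rightarrow> ('c \<Rightarrow> real) \<Rightarrow> 'c \<Rightarrow> real" where
  "extend_zero I u c = (if c \<in> I then u c else 0)"

lemma extend_zero_update: "c \<in> I \<Longrightarrow> extend_zero I (u(c := s)) = (extend_zero I u)(c := s)"
  by (auto simp: extend_zero_def fun_eq_iff)

context gaussian_channel
begin

lemma
  assumes I: "finite I" "I \<subseteq> coeffs" and c: "c \<in> coeffs"
  shows pmf_law_measurable:
      "(\<lambda>u. pmf (law (extend_zero I u)) z) \<in> borel_measurable (PiM I (\<lambda>_. borel))"
    and score_measurable:
      "(\<lambda>u. score (extend_zero I u) z c) \<in> borel_measurable (PiM I (\<lambda>_. borel))"
proof -
  let ?P = "machine_law \<sigma> (\<lambda>_. 0)"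
  let ?L = "log_ratio \<sigma> I (\<lambda>_. 0)"
  interpret prob_space ?P by (rule prob_space_machine_law[OF \<sigma>])
  have shift: "machine_law \<sigma> (extend_zero I u) = density ?P (\<lambda>x. ennreal (exp (?L u x)))" for u
    by (intro machine_law_shift[OF \<sigma> I]) (auto simp: extend_zero_def)
  have [measurable]: "(\<lambda>x. x c) \<in> borel_measurable seq_space" if "c \<in> coeffs" for c
    by (rule measurable_component_singleton[OF that])
  have u_meas: "(\<lambda>u. u c) \<in> borel_measurable (PiM I (\<lambda>_. borel :: real measure))" if "c \<in> I" for c
    by (rule measurable_component_singleton[OF that])
  have [measurable]: "?L u \<in> borel_measurable seq_space" for u
    using I by measurable
  have L: "(\<lambda>(u, x). ?L u x) \<in> borel_measurable (PiM I (\<lambda>_. borel) \<Otimes>\<^sub>M ?P)"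
    unfolding log_ratio_def case_prod_beta
    using I by (intro borel_measurable_sum borel_measurable_diff borel_measurable_divide borel_measurable_times borel_measurable_power
      borel_measurable_const measurable_compose[OF measurable_fst u_meas] measurable_compose[OF measurable_snd])
      (auto simp: subset_iff)
  have E: "(\<lambda>u. extend_zero I u c) \<in> borel_measurable (PiM I (\<lambda>_. borel))"
    using u_meas[of c] by (cases "c \<in> I") (auto simp: extend_zero_def)
  have M1: "(\<lambda>u. \<integral>x. exp (?L u x) * pmf (K x) z \<partial>?P) \<in> borel_measurable (PiM I (\<lambda>_. borel))"
    using L by (intro borel_measurable_lebesgue_integral) (simp add: case_prod_beta)
  have M2: "(\<lambda>u. \<integral>x. exp (?L u x) * (pmf (K x) z * ((x c - extend_zero I u c) / \<sigma>\<^sup>2)) \<partial>?P)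
      \<in> borel_measurable (PiM I (\<lambda>_. borel))"
    using L E c by (intro borel_measurable_lebesgue_integral) (simp add: case_prod_beta)
  have eq1: "pmf (law (extend_zero I u)) z = (\<integral>x. exp (?L u x) * pmf (K x) z \<partial>?P)" for u
    unfolding pmf_law shift by (subst integral_density) auto
  show m1: "(\<lambda>u. pmf (law (extend_zero I u)) z) \<in> borel_measurable (PiM I (\<lambda>_. borel))"
    unfolding eq1 by (rule M1)
  have eq2: "score (extend_zero I u) z c =
      (\<integral>x. exp (?L u x) * (pmf (K x) z * ((x c - extend_zero I u c) / \<sigma>\<^sup>2)) \<partial>?P) / pmf (law (extend_zero I u)) z" for u
  proof -
    have "score (extend_zero I u) z c = (\<integral>x. pmf (K x) z * ((x c - extend_zero I u c) / \<sigma>\<^sup>2)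
        \<partial>machine_law \<sigma> (extend_zero I u)) / pmf (law (extend_zero I u)) z"
      by (simp add: score_def cond_mean_def law_def)
    also have "(\<integral>x. pmf (K x) z * ((x c - extend_zero I u c) / \<sigma>\<^sup>2) \<partial>machine_law \<sigma> (extend_zero I u))
       = (\<integral>x. exp (?L u x) * (pmf (K x) z * ((x c - extend_zero I u c) / \<sigma>\<^sup>2)) \<partial>?P)"
      unfolding shift using c by (subst integral_density) auto
    finally show ?thesis .
  qed
  show "(\<lambda>u. score (extend_zero I u) z c) \<in> borel_measurable (PiM I (\<lambda>_. borel))"
    unfolding eq2 by (intro borel_measurable_divide M2 m1)
qed

end

section \<open>Bayes risk and quantization\<close>

text \<open>An abstract Bayesian experiment: given the parameter \<open>u\<close>, unit \<open>i\<close> emits an independent symbol with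
law \<open>p i u\<close>, and \<open>D y\<close> is the law of the estimate given the symbols \<open>y\<close>. The coordinates of \<open>u\<close> are
independent under the prior.\<close>

locale product_experiment =
  fixes A :: "'i set" and I :: "'c set" and p :: "'i \<Rightarrow> ('c \<Rightarrow> real) \<Rightarrow> 'z :: countable pmf"
    and dflt :: 'z and \<delta> :: real and D :: "('i \<Rightarrow> 'z) \<Rightarrow> ('c \<Rightarrow> real) measure"
  assumes A: "finite A" and I: "finite I" and \<delta>: "0 < \<delta>"
    and p_measurable: "i \<in> A \<Longrightarrow> (\<lambda>u. pmf (p i u) z) \<in> borel_measurable (PiM I (\<lambda>_. borel))"
    and D: "prob_space (D y)"
    and D_measurable: "c \<in> I \<Longrightarrow> (\<lambda>t. t c) \<in> borel_measurable (D y)"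
begin

definition prior :: "('c \<Rightarrow> real) measure" where
  "prior = PiM I (\<lambda>_. bump_prior \<delta>)"

definition joint :: "('c \<Rightarrow> real) \<Rightarrow> ('i \<Rightarrow> 'z) pmf" where
  "joint u = Pi_pmf A dflt (\<lambda>i. p i u)"

definition likelihood :: "('c \<Rightarrow> real) \<Rightarrow> ('i \<Rightarrow> 'z) \<Rightarrow> real" where
  "likelihood u y = (\<Prod>i\<in>A. pmf (p i u) (y i))"

text \<open>A countable set that carries all joint laws, so that sums over outcomes can be exchanged with
integrals over the parameter.\<close>

definition outcomes :: "('i \<Rightarrow> 'z) set" where
  "outcomes = PiE_dflt A dflt (\<lambda>_. UNIV)"

definition bayes_risk :: ennreal where
  "bayes_risk = (\<integral>\<^sup>+u. \<integral>\<^sup>+y. \<integral>\<^sup>+t. ennreal (\<Sum>c\<in>I. (t c - u c)\<^sup>2) \<partial>D y \<partial>measure_pmf (joint u) \<partial>prior)"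

lemma sets_prior [simp, measurable_cong]: "sets prior = sets (PiM I (\<lambda>_. borel))"
  unfolding prior_def by (intro sets_PiM_cong) auto

lemma prob_space_prior: "prob_space prior"
  unfolding prior_def by (intro prob_space_PiM prob_space_bump_prior \<delta>)

lemma prior_component: "c \<in> I \<Longrightarrow> (\<lambda>u. u c) \<in> borel_measurable prior"
  using measurable_component_singleton[of c I "\<lambda>_. borel :: real measure"] by simp

lemma likelihood_measurable [measurable]: "(\<lambda>u. likelihood u y) \<in> borel_measurable prior"
  unfolding likelihood_def using p_measurable by (intro borel_measurable_prod) auto

lemma likelihood_nonneg: "0 \<le> likelihood u y"
  by (auto simp: likelihood_def intro!: prod_nonneg)

lemma likelihood_le_1: "likelihood u y \<le> 1"
  by (auto simp: likelihood_def pmf_le_1 intro!: prod_le_1)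

lemma nn_integral_joint:
  "(\<integral>\<^sup>+y. F y \<partial>measure_pmf (joint u)) = (\<integral>\<^sup>+y. ennreal (likelihood u y) * F y \<partial>count_space outcomes)"
  unfolding joint_def likelihood_def outcomes_def by (rule nn_integral_Pi_pmf_count_space[OF A])

lemma nn_integral_joint_prior:
  assumes "\<And>y. (\<lambda>u. F u y) \<in> borel_measurable prior"
  shows "(\<integral>\<^sup>+u. \<integral>\<^sup>+y. F u y \<partial>measure_pmf (joint u) \<partial>prior)
    = (\<integral>\<^sup>+y. \<integral>\<^sup>+u. ennreal (likelihood u y) * F u y \<partial>prior \<partial>count_space outcomes)"
  unfolding nn_integral_joint using assms
  by (intro nn_integral_count_space_nn_integral) (auto simp: outcomes_def A countable_PiE_dflt)

text \<open>Both lower bounds are first proved for a fixed outcome \<open>y\<close> and a fixed estimate \<open>t\<close>. Randomized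
estimators need no extra argument: the inequality is integrated over \<open>t\<close> and summed over \<open>y\<close>.\<close>

lemma bayes_bound_from_outcomes:
  assumes L [measurable]: "\<And>y. (\<lambda>(u, t). L t u) \<in> borel_measurable (prior \<Otimes>\<^sub>M D y)"
    and H [measurable]: "\<And>y. (\<lambda>u. H u y) \<in> borel_measurable prior"
    and step: "\<And>y t. (\<integral>\<^sup>+u. ennreal (likelihood u y) * k \<partial>prior)
      \<le> (\<integral>\<^sup>+u. ennreal (likelihood u y) * L t u \<partial>prior) + (\<integral>\<^sup>+u. ennreal (likelihood u y) * H u y \<partial>prior) + r y"
  shows "k \<le> (\<integral>\<^sup>+u. \<integral>\<^sup>+y. \<integral>\<^sup>+t. L t u \<partial>D y \<partial>measure_pmf (joint u) \<partial>prior)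
     + (\<integral>\<^sup>+u. \<integral>\<^sup>+y. H u y \<partial>measure_pmf (joint u) \<partial>prior) + (\<integral>\<^sup>+y. r y \<partial>count_space outcomes)"
proof -
  interpret prior: prob_space prior by (rule prob_space_prior)
  have Lt [measurable]: "(\<lambda>u. \<integral>\<^sup>+t. L t u \<partial>D y) \<in> borel_measurable prior" for y
  proof -
    interpret D: prob_space "D y" by (rule D)
    show ?thesis using L[of y] by (intro D.borel_measurable_nn_integral) simp
  qed
  have swap: "(\<integral>\<^sup>+u. ennreal (likelihood u y) * (\<integral>\<^sup>+t. L t u \<partial>D y) \<partial>prior)
      = (\<integral>\<^sup>+t. \<integral>\<^sup>+u. ennreal (likelihood u y) * L t u \<partial>prior \<partial>D y)" for y
  proof -
    interpret D: prob_space "D y" by (rule D)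
    interpret pair_sigma_finite prior "D y" by unfold_locales
    have "(\<integral>\<^sup>+u. ennreal (likelihood u y) * (\<integral>\<^sup>+t. L t u \<partial>D y) \<partial>prior)
      = (\<integral>\<^sup>+u. \<integral>\<^sup>+t. ennreal (likelihood u y) * L t u \<partial>D y \<partial>prior)"
    proof (intro nn_integral_cong nn_integral_cmult[symmetric])
      fix u assume "u \<in> space prior"
      then show "(\<lambda>t. L t u) \<in> borel_measurable (D y)"
        using measurable_Pair2[OF L[of y]] by simp
    qed
    also have "\<dots> = (\<integral>\<^sup>+t. \<integral>\<^sup>+u. ennreal (likelihood u y) * L t u \<partial>prior \<partial>D y)"
      using L[of y] by (intro Fubini'[symmetric]) (simp add: case_prod_beta)
    finally show ?thesis .
  qed
  have step_D: "(\<integral>\<^sup>+u. ennreal (likelihood u y) * k \<partial>prior)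
      \<le> (\<integral>\<^sup>+u. ennreal (likelihood u y) * (\<integral>\<^sup>+t. L t u \<partial>D y) \<partial>prior)
        + (\<integral>\<^sup>+u. ennreal (likelihood u y) * H u y \<partial>prior) + r y" (is "?l \<le> _ + ?h + _") for y
  proof -
    interpret D: prob_space "D y" by (rule D)
    interpret pair_sigma_finite prior "D y" by unfold_locales
    have [measurable]: "(\<lambda>t. \<integral>\<^sup>+u. ennreal (likelihood u y) * L t u \<partial>prior) \<in> borel_measurable (D y)"
    proof (rule prior.borel_measurable_nn_integral)
      have "(\<lambda>(u, t). ennreal (likelihood u y) * L t u) \<in> borel_measurable (prior \<Otimes>\<^sub>M D y)"
        using L[of y] by (simp add: case_prod_beta)
      then show "(\<lambda>(t, u). ennreal (likelihood u y) * L t u) \<in> borel_measurable (D y \<Otimes>\<^sub>M prior)"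
        by (subst (asm) measurable_pair_swap_iff) (simp add: case_prod_beta)
    qed
    have "?l = (\<integral>\<^sup>+t. ?l \<partial>D y)" by (simp add: D.emeasure_space_1)
    also have "\<dots> \<le> (\<integral>\<^sup>+t. (\<integral>\<^sup>+u. ennreal (likelihood u y) * L t u \<partial>prior) + (?h + r y) \<partial>D y)"
      using step by (intro nn_integral_mono) (simp add: add.assoc)
    also have "\<dots> = (\<integral>\<^sup>+t. \<integral>\<^sup>+u. ennreal (likelihood u y) * L t u \<partial>prior \<partial>D y) + (?h + r y)"
      by (subst nn_integral_add) (auto simp: D.emeasure_space_1)
    finally show ?thesis by (simp add: swap add.assoc)
  qed
  have "k = (\<integral>\<^sup>+u. \<integral>\<^sup>+y. k \<partial>measure_pmf (joint u) \<partial>prior)"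
    by (simp add: prior.emeasure_space_1 measure_pmf.emeasure_space_1)
  also have "\<dots> = (\<integral>\<^sup>+y. \<integral>\<^sup>+u. ennreal (likelihood u y) * k \<partial>prior \<partial>count_space outcomes)"
    by (intro nn_integral_joint_prior) auto
  also have "\<dots> \<le> (\<integral>\<^sup>+y. (\<integral>\<^sup>+u. ennreal (likelihood u y) * (\<integral>\<^sup>+t. L t u \<partial>D y) \<partial>prior)
        + (\<integral>\<^sup>+u. ennreal (likelihood u y) * H u y \<partial>prior) + r y \<partial>count_space outcomes)"
    by (intro nn_integral_mono step_D)
  also have "\<dots> = (\<integral>\<^sup>+u. \<integral>\<^sup>+y. \<integral>\<^sup>+t. L t u \<partial>D y \<partial>measure_pmf (joint u) \<partial>prior)
     + (\<integral>\<^sup>+u. \<integral>\<^sup>+y. H u y \<partial>measure_pmf (joint u) \<partial>prior) + (\<integral>\<^sup>+y. r y \<partial>count_space outcomes)"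
    by (simp add: nn_integral_add nn_integral_joint_prior[OF Lt] nn_integral_joint_prior[OF H])
  finally show ?thesis .
qed

lemma AE_prior_cube: "AE u in prior. \<forall>c\<in>I. \<bar>u c\<bar> \<le> \<delta>"
  using I \<delta> unfolding prior_def
  by (intro AE_finite_allI AE_PiM_component[where P = "\<lambda>x. \<bar>x\<bar> \<le> \<delta>"] AE_bump_prior prob_space_bump_prior) auto

lemma nn_integral_prior_component:
  assumes c: "c \<in> I" and [measurable]: "f \<in> borel_measurable borel"
  shows "(\<integral>\<^sup>+u. f (u c) \<partial>prior) = (\<integral>\<^sup>+s. f s \<partial>bump_prior \<delta>)"
proof -
  have "(\<integral>\<^sup>+s. f s \<partial>bump_prior \<delta>) = (\<integral>\<^sup>+s. f s \<partial>distr prior (bump_prior \<delta>) (\<lambda>u. u c))"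
    unfolding prior_def using c \<delta> by (subst distr_PiM_component) (auto simp: prob_space_bump_prior)
  also have "\<dots> = (\<integral>\<^sup>+u. f (u c) \<partial>prior)"
    using c by (subst nn_integral_distr)
      (auto simp: measurable_cong_sets[OF sets_bump_prior refl] measurable_cong_sets[OF refl sets_bump_prior]
        intro: prior_component)
  finally show ?thesis ..
qed

lemma loss_measurable:
  "(\<lambda>(u, t). ennreal (q * (\<Sum>c\<in>I. (t c - u c)\<^sup>2))) \<in> borel_measurable (prior \<Otimes>\<^sub>M D y)"
proof -
  have [measurable]: "(\<lambda>(u, t). t c - u c) \<in> borel_measurable (prior \<Otimes>\<^sub>M D y)" if "c \<in> I" for c
    unfolding case_prod_beta using that
    by (intro borel_measurable_diff measurable_compose[OF measurable_fst prior_component]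
        measurable_compose[OF measurable_snd D_measurable])
  then have "(\<lambda>x. (snd x c - fst x c)\<^sup>2) \<in> borel_measurable (prior \<Otimes>\<^sub>M D y)" if "c \<in> I" for c
    using that by (intro borel_measurable_power) (simp add: case_prod_beta)
  then show ?thesis unfolding case_prod_beta
    by (intro measurable_compose[OF _ measurable_ennreal] borel_measurable_times borel_measurable_const borel_measurable_sum)
qed

text \<open>Few bits cannot describe a point of the cube. This holds without any noise, and it replaces the rate
distortion function of the prior. For a fixed outcome \<open>y\<close> with reference probability \<open>\<rho>\<close>, the Gibbs
inequality bounds the average of \<open>8 * d - \<kappa>\<inverse> * loss + ln \<rho>\<close>, weighted by the likelihood, by
\<open>\<rho> * exp (8 * d)\<close> times a Gaussian integral over the prior. For \<open>\<kappa> = \<delta>\<^sup>2 / (pi * exp 16)\<close>, a Gaussian of variance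
\<open>\<kappa> / 2\<close> per coordinate is so narrow that this integral is at most \<open>exp (- 8 * d)\<close>. Summation over the outcomes
leaves \<open>8 * d - E (- ln \<rho>) - 1\<close> as a lower bound for the risk in units of \<open>\<kappa>\<close>.\<close>

lemma quantization_bound:
  assumes \<rho>: "\<And>z. 0 < pmf \<rho> z"
    and len: "\<And>u. u \<in> space prior \<Longrightarrow> (\<forall>c\<in>I. \<bar>u c\<bar> \<le> \<delta>) \<Longrightarrow>
       (\<integral>\<^sup>+y. ennreal (\<Sum>i\<in>A. - ln (pmf \<rho> (y i))) \<partial>measure_pmf (joint u)) \<le> ennreal b"
    and b: "0 \<le> b"
  shows "ennreal (\<delta>\<^sup>2 / (pi * exp 16) * (8 * real (card I) - b - 1)) \<le> bayes_risk"
proof -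
  interpret prior: prob_space prior by (rule prob_space_prior)
  interpret PS: product_sigma_finite "\<lambda>_::'c. bump_prior \<delta>"
    by (intro product_sigma_finite.intro prob_space_imp_sigma_finite prob_space_bump_prior \<delta>)
  let ?d = "real (card I)"
  (* The prior density is at most 1 / \<delta>, so a Gaussian weight with standard deviation \<tau> has integral
     at most exp (- 8) in each coordinate. *)
  define \<tau> where "\<tau> = \<delta> * exp (- 8) / sqrt (2 * pi)"
  have \<tau>: "0 < \<tau>" using \<delta> by (simp add: \<tau>_def)
  define q where "q = 1 / (2 * \<tau>\<^sup>2)"
  define \<kappa> where "\<kappa> = 2 * \<tau>\<^sup>2"
  have \<kappa>: "0 < \<kappa>" "\<kappa> * q = 1" using \<tau> by (simp_all add: \<kappa>_def q_def)
  have \<kappa>_eq: "\<kappa> = \<delta>\<^sup>2 / (pi * exp 16)"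
    using \<delta> by (simp add: \<kappa>_def \<tau>_def power_divide power_mult_distrib exp_minus field_simps flip: exp_double)
  have q0: "0 \<le> q" by (simp add: q_def)
  have expo: "(\<lambda>s. ennreal (exp (- q * (r - s)\<^sup>2))) \<in> borel_measurable (bump_prior \<delta>)" for r :: real
    by measurable
  have one: "(\<integral>\<^sup>+s. ennreal (exp (- q * (t - s)\<^sup>2)) \<partial>bump_prior \<delta>) \<le> ennreal (exp (- 8))" for t
  proof -
    have e: "exp (- q * (t - s)\<^sup>2) = sqrt (2 * pi) * \<tau> * normal_density t \<tau> s" for s
      using \<tau> by (simp add: normal_density_def q_def real_sqrt_mult power2_commute)
    have "(\<integral>\<^sup>+s. ennreal (exp (- q * (t - s)\<^sup>2)) \<partial>bump_prior \<delta>)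
      = (\<integral>\<^sup>+s. ennreal (bump_density \<delta> s) * ennreal (exp (- q * (t - s)\<^sup>2)) \<partial>lborel)"
      using \<delta> by (intro nn_integral_bump_prior) auto
    also have "\<dots> \<le> (\<integral>\<^sup>+s. ennreal (exp (- 8)) * ennreal (normal_density t \<tau> s) \<partial>lborel)"
    proof (intro nn_integral_mono)
      fix s
      have "bump_density \<delta> s * exp (- q * (t - s)\<^sup>2) \<le> 1 / \<delta> * exp (- q * (t - s)\<^sup>2)"
        using bump_density_le[OF \<delta>] by (intro mult_right_mono) auto
      also have "\<dots> = exp (- 8) * normal_density t \<tau> s"
        unfolding e using \<delta> by (simp add: \<tau>_def)
      finally show "ennreal (bump_density \<delta> s) * ennreal (exp (- q * (t - s)\<^sup>2)) \<le> ennreal (exp (- 8)) * ennreal (normal_density t \<tau> s)"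
        using \<delta> by (simp add: bump_density_nonneg ennreal_leI flip: ennreal_mult)
    qed
    also have "\<dots> = ennreal (exp (- 8))"
      using \<tau> integral_normal_density[of \<tau> t] by (simp add: nn_integral_cmult nn_integral_eq_integral)
    finally show ?thesis .
  qed
  have gauss: "(\<integral>\<^sup>+u. ennreal (exp (8 * ?d - q * (\<Sum>c\<in>I. (t c - u c)\<^sup>2))) \<partial>prior) \<le> 1" for t
  proof -
    have "(\<integral>\<^sup>+u. ennreal (exp (8 * ?d - q * (\<Sum>c\<in>I. (t c - u c)\<^sup>2))) \<partial>prior)
      = (\<integral>\<^sup>+u. (\<Prod>c\<in>I. ennreal (exp 8) * ennreal (exp (- q * (t c - u c)\<^sup>2))) \<partial>prior)"
    proof (intro nn_integral_cong)
      fix u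
      have "8 * ?d - q * (\<Sum>c\<in>I. (t c - u c)\<^sup>2) = (\<Sum>c\<in>I. 8 + - q * (t c - u c)\<^sup>2)"
        by (simp add: sum_subtractf sum_distrib_left)
      then have "exp (8 * ?d - q * (\<Sum>c\<in>I. (t c - u c)\<^sup>2)) = (\<Prod>c\<in>I. exp 8 * exp (- q * (t c - u c)\<^sup>2))"
        by (simp only: exp_sum[OF I] exp_add)
      then show "ennreal (exp (8 * ?d - q * (\<Sum>c\<in>I. (t c - u c)\<^sup>2))) =
          (\<Prod>c\<in>I. ennreal (exp 8) * ennreal (exp (- q * (t c - u c)\<^sup>2)))"
        by (simp add: prod_ennreal flip: ennreal_mult)
    qed
    also have "\<dots> = (\<Prod>c\<in>I. \<integral>\<^sup>+s. ennreal (exp 8) * ennreal (exp (- q * (t c - s)\<^sup>2)) \<partial>bump_prior \<delta>)"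
      unfolding prior_def by (rule PS.product_nn_integral_prod[OF I]) measurable
    also have "\<dots> \<le> (\<Prod>c\<in>I. 1)"
    proof (rule prod_mono_ennreal)
      fix c
      have "(\<integral>\<^sup>+s. ennreal (exp 8) * ennreal (exp (- q * (t c - s)\<^sup>2)) \<partial>bump_prior \<delta>)
         = ennreal (exp 8) * (\<integral>\<^sup>+s. ennreal (exp (- q * (t c - s)\<^sup>2)) \<partial>bump_prior \<delta>)"
        by (rule nn_integral_cmult) (rule expo)
      also have "\<dots> \<le> ennreal (exp 8) * ennreal (exp (- 8))"
        by (intro mult_left_mono one) simp
      also have "\<dots> = 1" by (simp flip: ennreal_mult exp_add)
      finally show "(\<integral>\<^sup>+s. ennreal (exp 8) * ennreal (exp (- q * (t c - s)\<^sup>2)) \<partial>bump_prior \<delta>) \<le> 1" .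
    qed
    finally show ?thesis by simp
  qed
  define \<Lambda> where "\<Lambda> y = (\<Sum>i\<in>A. - ln (pmf \<rho> (y i)))" for y
  have \<Lambda>0: "0 \<le> \<Lambda> y" for y
    unfolding \<Lambda>_def by (intro sum_nonneg) (use \<rho> pmf_le_1 in \<open>auto simp: ln_le_zero_iff\<close>)
  define r where "r y = ennreal (\<Prod>i\<in>A. pmf \<rho> (y i))" for y
  have r_sum: "(\<integral>\<^sup>+y. r y \<partial>count_space outcomes) = 1"
    using nn_integral_Pi_pmf_count_space[OF A, where F = "\<lambda>_. 1" and d = dflt and p = "\<lambda>_. \<rho>"]
    by (simp add: r_def outcomes_def measure_pmf.emeasure_space_1)
  have r_exp: "r y = ennreal (exp (- \<Lambda> y))" for y
    using A \<rho> by (simp add: r_def \<Lambda>_def exp_sum flip: sum_negf)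
  have "ennreal (\<kappa> * (8 * ?d)) \<le> (\<integral>\<^sup>+u. \<integral>\<^sup>+y. \<integral>\<^sup>+t. ennreal (1 * (\<Sum>c\<in>I. (t c - u c)\<^sup>2)) \<partial>D y \<partial>measure_pmf (joint u) \<partial>prior)
     + (\<integral>\<^sup>+u. \<integral>\<^sup>+y. ennreal \<kappa> * ennreal (\<Lambda> y) \<partial>measure_pmf (joint u) \<partial>prior) + (\<integral>\<^sup>+y. ennreal \<kappa> * r y \<partial>count_space outcomes)"
  proof (rule bayes_bound_from_outcomes[OF loss_measurable])
    fix y and t :: "'c \<Rightarrow> real"
    define R where "R u = (\<Sum>c\<in>I. (t c - u c)\<^sup>2)" for u
    have R0: "0 \<le> R u" for u by (simp add: R_def sum_nonneg)
    have [measurable]: "R \<in> borel_measurable prior"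
      unfolding R_def[abs_def] by (intro borel_measurable_sum borel_measurable_power borel_measurable_diff
          borel_measurable_const prior_component)
    have "(\<integral>\<^sup>+u. ennreal (likelihood u y) * ennreal (\<kappa> * (8 * ?d)) \<partial>prior)
       \<le> (\<integral>\<^sup>+u. ennreal (likelihood u y) * ennreal (R u) + ennreal (likelihood u y) * (ennreal \<kappa> * ennreal (\<Lambda> y))
           + ennreal (exp (8 * ?d - q * R u)) * (ennreal \<kappa> * r y) \<partial>prior)"
    proof (intro nn_integral_mono)
      fix u
      have "likelihood u y * (8 * ?d - q * R u - \<Lambda> y) \<le> exp (8 * ?d - q * R u - \<Lambda> y)"
        by (intro weighted_le_exp likelihood_nonneg likelihood_le_1)
      then have "\<kappa> * (likelihood u y * (8 * ?d - q * R u - \<Lambda> y)) \<le> \<kappa> * exp (8 * ?d - q * R u - \<Lambda> y)"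
        using \<kappa> by (intro mult_left_mono) auto
      also have "\<dots> = exp (8 * ?d - q * R u) * (\<kappa> * exp (- \<Lambda> y))"
        by (simp add: exp_diff exp_minus exp_add field_simps)
      also have "\<kappa> * (likelihood u y * (8 * ?d - q * R u - \<Lambda> y)) =
          likelihood u y * (\<kappa> * (8 * ?d)) - likelihood u y * ((\<kappa> * q) * R u) - likelihood u y * (\<kappa> * \<Lambda> y)"
        by (simp only: right_diff_distrib mult_ac)
      finally have "likelihood u y * (\<kappa> * (8 * ?d)) \<le> likelihood u y * R u + likelihood u y * (\<kappa> * \<Lambda> y)
           + exp (8 * ?d - q * R u) * (\<kappa> * exp (- \<Lambda> y))"
        by (simp add: \<kappa>(2))
      then show "ennreal (likelihood u y) * ennreal (\<kappa> * (8 * ?d)) \<le> ennreal (likelihood u y) * ennreal (R u)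
           + ennreal (likelihood u y) * (ennreal \<kappa> * ennreal (\<Lambda> y)) + ennreal (exp (8 * ?d - q * R u)) * (ennreal \<kappa> * r y)"
        using likelihood_nonneg[of u y] R0[of u] \<kappa>(1) \<Lambda>0[of y]
        by (simp add: r_exp ennreal_leI flip: ennreal_mult ennreal_plus)
    qed
    also have "\<dots> = (\<integral>\<^sup>+u. ennreal (likelihood u y) * ennreal (R u) \<partial>prior) + (\<integral>\<^sup>+u. ennreal (likelihood u y) * (ennreal \<kappa> * ennreal (\<Lambda> y)) \<partial>prior)
           + (\<integral>\<^sup>+u. ennreal (exp (8 * ?d - q * R u)) \<partial>prior) * (ennreal \<kappa> * r y)"
      by (simp add: nn_integral_add nn_integral_multc)
    also have "\<dots> \<le> (\<integral>\<^sup>+u. ennreal (likelihood u y) * ennreal (R u) \<partial>prior) + (\<integral>\<^sup>+u. ennreal (likelihood u y) * (ennreal \<kappa> * ennreal (\<Lambda> y)) \<partial>prior)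
           + 1 * (ennreal \<kappa> * r y)"
      using gauss[of t] by (intro add_left_mono mult_right_mono) (simp_all add: R_def)
    finally show "(\<integral>\<^sup>+u. ennreal (likelihood u y) * ennreal (\<kappa> * (8 * ?d)) \<partial>prior)
       \<le> (\<integral>\<^sup>+u. ennreal (likelihood u y) * ennreal (1 * (\<Sum>c\<in>I. (t c - u c)\<^sup>2)) \<partial>prior)
         + (\<integral>\<^sup>+u. ennreal (likelihood u y) * (ennreal \<kappa> * ennreal (\<Lambda> y)) \<partial>prior) + ennreal \<kappa> * r y"
      by (simp add: R_def)
  qed simp
  also have "\<dots> = bayes_risk + (\<integral>\<^sup>+u. \<integral>\<^sup>+y. ennreal \<kappa> * ennreal (\<Lambda> y) \<partial>measure_pmf (joint u) \<partial>prior) + ennreal \<kappa>"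
    by (simp add: bayes_risk_def nn_integral_cmult r_sum)
  also have "\<dots> \<le> bayes_risk + ennreal (\<kappa> * b) + ennreal \<kappa>"
  proof (intro add_mono order_refl)
    have "(\<integral>\<^sup>+u. \<integral>\<^sup>+y. ennreal \<kappa> * ennreal (\<Lambda> y) \<partial>measure_pmf (joint u) \<partial>prior) \<le> (\<integral>\<^sup>+u. ennreal (\<kappa> * b) \<partial>prior)"
    proof (rule nn_integral_mono_AE)
      show "AE u in prior. (\<integral>\<^sup>+y. ennreal \<kappa> * ennreal (\<Lambda> y) \<partial>measure_pmf (joint u)) \<le> ennreal (\<kappa> * b)"
        using AE_prior_cube AE_space[of prior]
      proof eventually_elim
        case (elim u)
        then show ?case using len[of u] \<kappa>(1) b
          by (simp add: \<Lambda>_def nn_integral_cmult ennreal_mult mult_left_mono)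
      qed
    qed
    then show "(\<integral>\<^sup>+u. \<integral>\<^sup>+y. ennreal \<kappa> * ennreal (\<Lambda> y) \<partial>measure_pmf (joint u) \<partial>prior) \<le> ennreal (\<kappa> * b)"
      by (simp add: prior.emeasure_space_1)
  qed
  finally have bound: "ennreal (\<kappa> * (8 * ?d)) \<le> bayes_risk + ennreal (\<kappa> * b + \<kappa>)"
    using \<kappa>(1) b by (simp add: add.assoc)
  have "ennreal (\<kappa> * (8 * ?d - b - 1)) = ennreal (\<kappa> * (8 * ?d) - (\<kappa> * b + \<kappa>))"
    by (simp add: algebra_simps)
  also have "\<dots> = ennreal (\<kappa> * (8 * ?d)) - ennreal (\<kappa> * b + \<kappa>)"
    using \<kappa>(1) b by (intro ennreal_minus[symmetric]) auto
  also have "\<dots> \<le> bayes_risk"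
    using bound by (simp add: ennreal_minus_le_iff add.commute)
  finally show ?thesis by (simp add: \<kappa>_eq)
qed

end

section \<open>The van Trees inequality for independent messages\<close>

text \<open>Here each law \<open>p i u\<close> is differentiable in every coordinate of \<open>u\<close>, with a score \<open>a\<close> that has mean
zero and a finite second moment. The score of the joint law is the sum of the scores.\<close>

locale smooth_product_experiment = product_experiment A I p dflt \<delta> D
  for A :: "'i set" and I :: "'c set" and p :: "'i \<Rightarrow> ('c \<Rightarrow> real) \<Rightarrow> 'z :: countable pmf"
    and dflt \<delta> D +
  fixes a :: "'i \<Rightarrow> ('c \<Rightarrow> real) \<Rightarrow> 'z \<Rightarrow> 'c \<Rightarrow> real"
  assumes DERIV_p: "i \<in> A \<Longrightarrow> c \<in> I \<Longrightarrow> ((\<lambda>s. pmf (p i (u(c := s))) z) has_real_derivative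
        pmf (p i (u(c := s))) z * a i (u(c := s)) z c) (at s)"
    and continuous_p_a: "i \<in> A \<Longrightarrow> c \<in> I \<Longrightarrow>
        continuous_on UNIV (\<lambda>s. pmf (p i (u(c := s))) z * a i (u(c := s)) z c)"
    and a_measurable: "i \<in> A \<Longrightarrow> c \<in> I \<Longrightarrow> (\<lambda>u. a i u z c) \<in> borel_measurable (PiM I (\<lambda>_. borel))"
    and a_mean: "i \<in> A \<Longrightarrow> c \<in> I \<Longrightarrow> (\<integral>z. a i u z c \<partial>measure_pmf (p i u)) = 0"
    and a_square: "i \<in> A \<Longrightarrow> c \<in> I \<Longrightarrow> integrable (measure_pmf (p i u)) (\<lambda>z. (a i u z c)\<^sup>2)"
begin

definition total_score :: "('c \<Rightarrow> real) \<Rightarrow> ('i \<Rightarrow> 'z) \<Rightarrow> 'c \<Rightarrow> real" where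
  "total_score u y c = (\<Sum>i\<in>A. a i u (y i) c)"

lemma total_score_measurable [measurable]:
  "c \<in> I \<Longrightarrow> (\<lambda>u. total_score u y c) \<in> borel_measurable prior"
  unfolding total_score_def using a_measurable by (intro borel_measurable_sum) auto

lemma DERIV_likelihood:
  assumes "c \<in> I"
  shows "((\<lambda>s. likelihood (u(c := s)) y) has_real_derivative
      likelihood (u(c := s)) y * total_score (u(c := s)) y c) (at s)"
proof -
  have "((\<lambda>s. likelihood (u(c := s)) y) has_real_derivative
      (\<Sum>i\<in>A. pmf (p i (u(c := s))) (y i) * a i (u(c := s)) (y i) c *
         (\<Prod>k\<in>A - {i}. pmf (p k (u(c := s))) (y k)))) (at s)"
    unfolding likelihood_def using assms by (intro has_field_derivative_prod DERIV_p)
  also have "(\<Sum>i\<in>A. pmf (p i (u(c := s))) (y i) * a i (u(c := s)) (y i) c *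
         (\<Prod>k\<in>A - {i}. pmf (p k (u(c := s))) (y k))) = likelihood (u(c := s)) y * total_score (u(c := s)) y c"
    unfolding likelihood_def total_score_def sum_distrib_left using A
    by (intro sum.cong refl) (simp add: prod.remove mult_ac)
  finally show ?thesis .
qed

lemma continuous_likelihood_score:
  assumes c: "c \<in> I"
  shows "continuous_on UNIV (\<lambda>s. likelihood (u(c := s)) y * total_score (u(c := s)) y c)"
proof -
  have eq: "likelihood (u(c := s)) y * total_score (u(c := s)) y c =
     (\<Sum>i\<in>A. pmf (p i (u(c := s))) (y i) * a i (u(c := s)) (y i) c *
         (\<Prod>k\<in>A - {i}. pmf (p k (u(c := s))) (y k)))" for s
    unfolding likelihood_def total_score_def sum_distrib_left using A
    by (intro sum.cong refl) (simp add: prod.remove mult_ac)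
  have "continuous_on UNIV (\<lambda>s. pmf (p i (u(c := s))) z)" if "i \<in> A" for i z
    using DERIV_p[OF that c] by (meson DERIV_isCont continuous_at_imp_continuous_on)
  then show ?thesis
    unfolding eq using c by (intro continuous_on_sum continuous_on_mult continuous_p_a continuous_on_prod) auto
qed

lemma van_trees_outcome:
  assumes c: "c \<in> I" and \<gamma>: "0 \<le> \<gamma>"
  shows "(\<integral>\<^sup>+u. ennreal (2 * \<gamma> * likelihood u y) \<partial>prior)
     \<le> (\<integral>\<^sup>+u. ennreal (likelihood u y * (t - u c)\<^sup>2) \<partial>prior)
       + (\<integral>\<^sup>+u. ennreal (\<gamma>\<^sup>2 * likelihood u y * (2 * (total_score u y c)\<^sup>2 + 8 * (bump_score \<delta> (u c))\<^sup>2)) \<partial>prior)"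
proof -
  interpret PS: product_sigma_finite "\<lambda>_::'c. bump_prior \<delta>"
    by (intro product_sigma_finite.intro prob_space_imp_sigma_finite prob_space_bump_prior \<delta>)
  let ?J = "I - {c}"
  have J: "finite ?J" "c \<notin> ?J" "insert c ?J = I" using I c by auto
  have split: "(\<integral>\<^sup>+u. f u \<partial>prior) = (\<integral>\<^sup>+u. \<integral>\<^sup>+s. f (u(c := s)) \<partial>bump_prior \<delta> \<partial>PiM ?J (\<lambda>_. bump_prior \<delta>))"
    if "f \<in> borel_measurable prior" for f :: "_ \<Rightarrow> ennreal"
    using PS.product_nn_integral_insert[OF J(1,2), of f] that unfolding J(3) prior_def by simp
  have [measurable]: "(\<lambda>u. u c) \<in> borel_measurable prior" by (rule prior_component[OF c])
  have [measurable]: "(\<lambda>u. total_score u y c) \<in> borel_measurable prior" by (rule total_score_measurable[OF c])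
  let ?L = "\<lambda>u. ennreal (likelihood u y * (t - u c)\<^sup>2)"
  let ?H = "\<lambda>u. ennreal (\<gamma>\<^sup>2 * likelihood u y * (2 * (total_score u y c)\<^sup>2 + 8 * (bump_score \<delta> (u c))\<^sup>2))"
  have "(\<integral>\<^sup>+u. ennreal (2 * \<gamma> * likelihood u y) \<partial>prior) =
     (\<integral>\<^sup>+u. \<integral>\<^sup>+s. ennreal (2 * \<gamma> * likelihood (u(c := s)) y) \<partial>bump_prior \<delta> \<partial>PiM ?J (\<lambda>_. bump_prior \<delta>))"
    by (rule split) measurable
  also have "\<dots> \<le> (\<integral>\<^sup>+u. \<integral>\<^sup>+s. ?L (u(c := s)) + ?H (u(c := s)) \<partial>bump_prior \<delta> \<partial>PiM ?J (\<lambda>_. bump_prior \<delta>))"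
  proof (rule nn_integral_mono)
    fix u assume u: "u \<in> space (PiM ?J (\<lambda>_. bump_prior \<delta>))"
    have upd: "(\<lambda>s. u(c := s)) \<in> measurable borel prior"
    proof -
      have "(\<lambda>s. u(c := s)) \<in> measurable (bump_prior \<delta>) (PiM (insert c ?J) (\<lambda>_. bump_prior \<delta>))"
        using u J(2) by (rule measurable_component_update)
      then show ?thesis
        unfolding J(3) prior_def by (simp add: measurable_cong_sets[OF sets_bump_prior refl])
    qed
    have score_meas: "(\<lambda>s. total_score (u(c := s)) y c) \<in> borel_measurable borel"
      by (rule measurable_compose[OF upd total_score_measurable[OF c]])
    have lik_meas: "(\<lambda>s. likelihood (u(c := s)) y) \<in> borel_measurable borel"
      by (rule measurable_compose[OF upd likelihood_measurable])
    have "(\<integral>\<^sup>+s. ennreal (2 * \<gamma> * likelihood (u(c := s)) y) \<partial>bump_prior \<delta>)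
      \<le> (\<integral>\<^sup>+s. ennreal (likelihood (u(c := s)) y * (t - s)\<^sup>2) \<partial>bump_prior \<delta>) +
       (\<integral>\<^sup>+s. ennreal (\<gamma>\<^sup>2 * likelihood (u(c := s)) y * (2 * (total_score (u(c := s)) y c)\<^sup>2 + 8 * (bump_score \<delta> s)\<^sup>2)) \<partial>bump_prior \<delta>)"
      using c \<gamma> \<delta> score_meas
      by (intro van_trees_coordinate DERIV_likelihood likelihood_nonneg continuous_likelihood_score) auto
    also have "\<dots> = (\<integral>\<^sup>+s. ?L (u(c := s)) + ?H (u(c := s)) \<partial>bump_prior \<delta>)"
      using score_meas lik_meas
      by (subst nn_integral_add[symmetric]) (auto simp: measurable_cong_sets[OF sets_bump_prior refl])
    finally show "(\<integral>\<^sup>+s. ennreal (2 * \<gamma> * likelihood (u(c := s)) y) \<partial>bump_prior \<delta>)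
      \<le> (\<integral>\<^sup>+s. ?L (u(c := s)) + ?H (u(c := s)) \<partial>bump_prior \<delta>)" .
  qed
  also have "\<dots> = (\<integral>\<^sup>+u. ?L u + ?H u \<partial>prior)"
    by (rule split[symmetric]) measurable
  also have "\<dots> = (\<integral>\<^sup>+u. ?L u \<partial>prior) + (\<integral>\<^sup>+u. ?H u \<partial>prior)"
    by (rule nn_integral_add) measurable
  finally show ?thesis .
qed

lemma nn_integral_total_score_square:
  assumes c: "c \<in> I"
  shows "(\<integral>\<^sup>+y. ennreal ((total_score u y c)\<^sup>2) \<partial>measure_pmf (joint u)) =
    (\<Sum>i\<in>A. \<integral>\<^sup>+z. ennreal ((a i u z c)\<^sup>2) \<partial>measure_pmf (p i u))"
proof -
  note S = second_moment_sum_Pi_pmf[OF A, where f = "\<lambda>i z. a i u z c" and p = "\<lambda>i. p i u" and d = dflt,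
      OF a_square[OF _ c] a_mean[OF _ c]]
  have "(\<integral>\<^sup>+y. ennreal ((total_score u y c)\<^sup>2) \<partial>measure_pmf (joint u)) =
     ennreal (\<Sum>i\<in>A. \<integral>z. (a i u z c)\<^sup>2 \<partial>measure_pmf (p i u))"
    unfolding joint_def total_score_def using S by (subst nn_integral_eq_integral) auto
  also have "\<dots> = (\<Sum>i\<in>A. \<integral>\<^sup>+z. ennreal ((a i u z c)\<^sup>2) \<partial>measure_pmf (p i u))"
    using a_square[OF _ c] by (simp add: nn_integral_eq_integral flip: sum_ennreal)
  finally show ?thesis .
qed

text \<open>The multivariate van Trees inequality with the trace of the Fisher information: \<open>F\<close> bounds that of
the experiment, and \<open>20 / \<delta>\<^sup>2\<close> per coordinate comes from the prior. The coordinates are summed before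
the optimization over \<open>\<gamma>\<close>, so that only the trace enters.\<close>

lemma van_trees_bound:
  assumes info: "\<And>u. u \<in> space prior \<Longrightarrow> (\<forall>c\<in>I. \<bar>u c\<bar> \<le> \<delta>) \<Longrightarrow>
       (\<Sum>i\<in>A. \<Sum>c\<in>I. \<integral>\<^sup>+z. ennreal ((a i u z c)\<^sup>2) \<partial>measure_pmf (p i u)) \<le> ennreal F"
    and F: "0 \<le> F" and I_ne: "I \<noteq> {}"
  shows "ennreal ((real (card I))\<^sup>2 / (2 * F + 20 * real (card I) / \<delta>\<^sup>2)) \<le> bayes_risk"
proof -
  interpret prior: prob_space prior by (rule prob_space_prior)
  let ?d = "real (card I)"
  have d: "0 < ?d" using I I_ne by (simp add: card_gt_0_iff)
  define V where "V = 2 * F + 20 * ?d / \<delta>\<^sup>2"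
  have V: "0 < V" using F d \<delta> by (auto simp: V_def intro!: add_nonneg_pos)
  (* This choice maximizes 2 * \<gamma> * d - \<gamma>\<^sup>2 * V. *)
  define \<gamma> where "\<gamma> = ?d / V"
  have \<gamma>: "0 < \<gamma>" using d V by (simp add: \<gamma>_def)
  define H where "H u y = (\<Sum>c\<in>I. 2 * (total_score u y c)\<^sup>2 + 8 * (bump_score \<delta> (u c))\<^sup>2)" for u y
  have H0: "0 \<le> H u y" for u y by (auto simp: H_def intro!: sum_nonneg)
  have [measurable]: "(\<lambda>u. bump_score \<delta> (u c)) \<in> borel_measurable prior" if "c \<in> I" for c
    by (rule measurable_compose[OF prior_component[OF that] bump_measurable(2)])
  have "ennreal (2 * \<gamma> * ?d) \<le> (\<integral>\<^sup>+u. \<integral>\<^sup>+y. \<integral>\<^sup>+t. ennreal (1 * (\<Sum>c\<in>I. (t c - u c)\<^sup>2)) \<partial>D y \<partial>measure_pmf (joint u) \<partial>prior)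
     + (\<integral>\<^sup>+u. \<integral>\<^sup>+y. ennreal (\<gamma>\<^sup>2) * ennreal (H u y) \<partial>measure_pmf (joint u) \<partial>prior) + (\<integral>\<^sup>+y. 0 \<partial>count_space outcomes)"
  proof (rule bayes_bound_from_outcomes[OF loss_measurable])
    fix y
    have [measurable]: "(\<lambda>u. H u y) \<in> borel_measurable prior"
      unfolding H_def by (intro borel_measurable_sum borel_measurable_add borel_measurable_times borel_measurable_power borel_measurable_const) auto
    then show "(\<lambda>u. ennreal (\<gamma>\<^sup>2) * ennreal (H u y)) \<in> borel_measurable prior" by measurable
    fix t :: "'c \<Rightarrow> real"
    have "(\<integral>\<^sup>+u. ennreal (likelihood u y) * ennreal (2 * \<gamma> * ?d) \<partial>prior) = (\<Sum>c\<in>I. \<integral>\<^sup>+u. ennreal (2 * \<gamma> * likelihood u y) \<partial>prior)"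
    proof -
      have "ennreal (likelihood u y) * ennreal (2 * \<gamma> * ?d) = (\<Sum>c\<in>I. ennreal (2 * \<gamma> * likelihood u y))" for u
      proof -
        have "ennreal (likelihood u y) * ennreal (2 * \<gamma> * ?d) = ennreal (\<Sum>c\<in>I. 2 * \<gamma> * likelihood u y)"
          using \<gamma> likelihood_nonneg[of u y] by (simp add: mult_ac flip: ennreal_mult)
        then show ?thesis using \<gamma> likelihood_nonneg[of u y] by (subst sum_ennreal) auto
      qed
      then show ?thesis by (simp only:) (rule nn_integral_sum, measurable)
    qed
    also have "\<dots> \<le> (\<Sum>c\<in>I. (\<integral>\<^sup>+u. ennreal (likelihood u y * (t c - u c)\<^sup>2) \<partial>prior)
       + (\<integral>\<^sup>+u. ennreal (\<gamma>\<^sup>2 * likelihood u y * (2 * (total_score u y c)\<^sup>2 + 8 * (bump_score \<delta> (u c))\<^sup>2)) \<partial>prior))"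
      using \<gamma> by (intro sum_mono van_trees_outcome) auto
    also have "\<dots> = (\<Sum>c\<in>I. (\<integral>\<^sup>+u. ennreal (likelihood u y * (t c - u c)\<^sup>2) \<partial>prior))
       + (\<Sum>c\<in>I. (\<integral>\<^sup>+u. ennreal (\<gamma>\<^sup>2 * likelihood u y * (2 * (total_score u y c)\<^sup>2 + 8 * (bump_score \<delta> (u c))\<^sup>2)) \<partial>prior))"
      by (rule sum.distrib)
    also have "(\<Sum>c\<in>I. (\<integral>\<^sup>+u. ennreal (likelihood u y * (t c - u c)\<^sup>2) \<partial>prior))
        = (\<integral>\<^sup>+u. ennreal (likelihood u y) * ennreal (1 * (\<Sum>c\<in>I. (t c - u c)\<^sup>2)) \<partial>prior)"
    proof (subst nn_integral_sum[symmetric])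
      show "(\<integral>\<^sup>+u. (\<Sum>c\<in>I. ennreal (likelihood u y * (t c - u c)\<^sup>2)) \<partial>prior) =
         (\<integral>\<^sup>+u. ennreal (likelihood u y) * ennreal (1 * (\<Sum>c\<in>I. (t c - u c)\<^sup>2)) \<partial>prior)"
        using likelihood_nonneg by (intro nn_integral_cong) (simp add: sum_nonneg sum_distrib_left flip: ennreal_mult)
    qed auto
    also have "(\<Sum>c\<in>I. (\<integral>\<^sup>+u. ennreal (\<gamma>\<^sup>2 * likelihood u y * (2 * (total_score u y c)\<^sup>2 + 8 * (bump_score \<delta> (u c))\<^sup>2)) \<partial>prior))
        = (\<integral>\<^sup>+u. ennreal (likelihood u y) * (ennreal (\<gamma>\<^sup>2) * ennreal (H u y)) \<partial>prior)"
    proof (subst nn_integral_sum[symmetric])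
      show "(\<integral>\<^sup>+u. (\<Sum>c\<in>I. ennreal (\<gamma>\<^sup>2 * likelihood u y * (2 * (total_score u y c)\<^sup>2 + 8 * (bump_score \<delta> (u c))\<^sup>2))) \<partial>prior)
         = (\<integral>\<^sup>+u. ennreal (likelihood u y) * (ennreal (\<gamma>\<^sup>2) * ennreal (H u y)) \<partial>prior)"
      proof (intro nn_integral_cong)
        fix u
        have "(\<Sum>c\<in>I. ennreal (\<gamma>\<^sup>2 * likelihood u y * (2 * (total_score u y c)\<^sup>2 + 8 * (bump_score \<delta> (u c))\<^sup>2)))
          = ennreal (\<gamma>\<^sup>2 * likelihood u y * H u y)"
          unfolding H_def sum_distrib_left
          using likelihood_nonneg[of u y] by (intro sum_ennreal) auto
        also have "\<dots> = ennreal (likelihood u y) * (ennreal (\<gamma>\<^sup>2) * ennreal (H u y))"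
          using likelihood_nonneg[of u y] H0[of u y] by (simp add: mult_ac flip: ennreal_mult)
        finally show "(\<Sum>c\<in>I. ennreal (\<gamma>\<^sup>2 * likelihood u y * (2 * (total_score u y c)\<^sup>2 + 8 * (bump_score \<delta> (u c))\<^sup>2)))
           = ennreal (likelihood u y) * (ennreal (\<gamma>\<^sup>2) * ennreal (H u y))" .
      qed
    qed auto
    finally show "(\<integral>\<^sup>+u. ennreal (likelihood u y) * ennreal (2 * \<gamma> * ?d) \<partial>prior)
       \<le> (\<integral>\<^sup>+u. ennreal (likelihood u y) * ennreal (1 * (\<Sum>c\<in>I. (t c - u c)\<^sup>2)) \<partial>prior)
       + (\<integral>\<^sup>+u. ennreal (likelihood u y) * (ennreal (\<gamma>\<^sup>2) * ennreal (H u y)) \<partial>prior) + 0" by simp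
  qed
  also have "\<dots> = bayes_risk + (\<integral>\<^sup>+u. \<integral>\<^sup>+y. ennreal (\<gamma>\<^sup>2) * ennreal (H u y) \<partial>measure_pmf (joint u) \<partial>prior)"
    by (simp add: bayes_risk_def)
  also have "\<dots> \<le> bayes_risk + ennreal (\<gamma>\<^sup>2 * V)"
  proof (rule add_left_mono)
    let ?B = "\<lambda>u. \<Sum>c\<in>I. ennreal 8 * ennreal ((bump_score \<delta> (u c))\<^sup>2)"
    have "(\<integral>\<^sup>+u. \<integral>\<^sup>+y. ennreal (\<gamma>\<^sup>2) * ennreal (H u y) \<partial>measure_pmf (joint u) \<partial>prior)
       \<le> (\<integral>\<^sup>+u. ennreal (\<gamma>\<^sup>2) * (ennreal 2 * ennreal F + ?B u) \<partial>prior)"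
    proof (rule nn_integral_mono_AE)
      show "AE u in prior. (\<integral>\<^sup>+y. ennreal (\<gamma>\<^sup>2) * ennreal (H u y) \<partial>measure_pmf (joint u))
         \<le> ennreal (\<gamma>\<^sup>2) * (ennreal 2 * ennreal F + ?B u)"
        using AE_prior_cube AE_space[of prior]
      proof eventually_elim
        case (elim u)
        have "ennreal (H u y) = (\<Sum>c\<in>I. ennreal 2 * ennreal ((total_score u y c)\<^sup>2)) + ?B u" for y
        proof -
          have "(\<Sum>c\<in>I. ennreal k * ennreal ((f c)\<^sup>2)) = ennreal (\<Sum>c\<in>I. k * (f c)\<^sup>2)" if "0 \<le> k" for k and f :: "'c \<Rightarrow> real"
            using that by (simp flip: ennreal_mult)
          note e = this[OF zero_le_numeral]
          show ?thesis unfolding e H_def sum.distrib by (rule ennreal_plus) (auto intro!: sum_nonneg)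
        qed
        then have "(\<integral>\<^sup>+y. ennreal (H u y) \<partial>measure_pmf (joint u))
           = (\<Sum>c\<in>I. ennreal 2 * (\<integral>\<^sup>+y. ennreal ((total_score u y c)\<^sup>2) \<partial>measure_pmf (joint u))) + ?B u"
          by (simp add: nn_integral_add nn_integral_sum nn_integral_cmult measure_pmf.emeasure_space_1)
        also have "(\<Sum>c\<in>I. ennreal 2 * (\<integral>\<^sup>+y. ennreal ((total_score u y c)\<^sup>2) \<partial>measure_pmf (joint u)))
           = ennreal 2 * (\<Sum>c\<in>I. \<Sum>i\<in>A. \<integral>\<^sup>+z. ennreal ((a i u z c)\<^sup>2) \<partial>measure_pmf (p i u))"
          unfolding sum_distrib_left by (intro sum.cong refl) (simp add: nn_integral_total_score_square sum_distrib_left)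
        also have "\<dots> \<le> ennreal 2 * ennreal F"
          using info[OF elim(2,1)] by (intro mult_left_mono) (subst sum.swap, auto)
        finally have "(\<integral>\<^sup>+y. ennreal (H u y) \<partial>measure_pmf (joint u)) \<le> ennreal 2 * ennreal F + ?B u"
          by (simp add: add_right_mono)
        then show ?case by (simp add: nn_integral_cmult mult_left_mono)
      qed
    qed
    also have "\<dots> = ennreal (\<gamma>\<^sup>2) * (ennreal 2 * ennreal F + (\<Sum>c\<in>I. ennreal 8 * (\<integral>\<^sup>+u. ennreal ((bump_score \<delta> (u c))\<^sup>2) \<partial>prior)))"
      by (simp add: nn_integral_cmult nn_integral_add nn_integral_sum prior.emeasure_space_1)
    also have "(\<Sum>c\<in>I. ennreal 8 * (\<integral>\<^sup>+u. ennreal ((bump_score \<delta> (u c))\<^sup>2) \<partial>prior)) = (\<Sum>c\<in>I. ennreal (20 / \<delta>\<^sup>2))"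
    proof (intro sum.cong refl)
      fix c assume c: "c \<in> I"
      have "(\<integral>\<^sup>+u. ennreal ((bump_score \<delta> (u c))\<^sup>2) \<partial>prior) = ennreal (5 / (2 * \<delta>\<^sup>2))"
        by (subst nn_integral_prior_component[OF c]) (simp_all add: nn_integral_bump_score[OF \<delta>])
      then have "ennreal 8 * (\<integral>\<^sup>+u. ennreal ((bump_score \<delta> (u c))\<^sup>2) \<partial>prior) = ennreal (8 * (5 / (2 * \<delta>\<^sup>2)))"
        by (simp only:) (rule ennreal_mult[symmetric], auto)
      then show "ennreal 8 * (\<integral>\<^sup>+u. ennreal ((bump_score \<delta> (u c))\<^sup>2) \<partial>prior) = ennreal (20 / \<delta>\<^sup>2)"
        by simp
    qed
    also have "ennreal (\<gamma>\<^sup>2) * (ennreal 2 * ennreal F + (\<Sum>c\<in>I. ennreal (20 / \<delta>\<^sup>2))) = ennreal (\<gamma>\<^sup>2 * V)"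
    proof -
      have "(\<Sum>c\<in>I. ennreal (20 / \<delta>\<^sup>2)) = ennreal (20 * ?d / \<delta>\<^sup>2)"
        by (subst sum_ennreal) (auto simp: mult.commute)
      moreover have "ennreal 2 * ennreal F = ennreal (2 * F)"
        using F by (intro ennreal_mult[symmetric]) auto
      ultimately show ?thesis
        using F by (simp only: V_def) (simp flip: ennreal_mult ennreal_plus)
    qed
    finally show "(\<integral>\<^sup>+u. \<integral>\<^sup>+y. ennreal (\<gamma>\<^sup>2) * ennreal (H u y) \<partial>measure_pmf (joint u) \<partial>prior) \<le> ennreal (\<gamma>\<^sup>2 * V)" .
  qed
  finally have bound: "ennreal (2 * \<gamma> * ?d) \<le> bayes_risk + ennreal (\<gamma>\<^sup>2 * V)" .
  have "?d\<^sup>2 / V = 2 * \<gamma> * ?d - \<gamma>\<^sup>2 * V"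
    using V by (simp add: \<gamma>_def power2_eq_square field_simps)
  then have "ennreal (?d\<^sup>2 / V) = ennreal (2 * \<gamma> * ?d) - ennreal (\<gamma>\<^sup>2 * V)"
    using V by (simp add: ennreal_minus)
  also have "\<dots> \<le> bayes_risk"
    using bound by (simp add: ennreal_minus_le_iff add.commute)
  finally show ?thesis by (simp add: V_def)
qed

end

section \<open>Priors on one level of a Besov ball\<close>

lemma level_norm_zero: "(\<And>k. k \<in> {1..2 ^ j} \<Longrightarrow> \<theta> (j, k) = 0) \<Longrightarrow> level_norm p \<theta> j = 0"
proof -
  assume z: "\<And>k. k \<in> {1..2 ^ j} \<Longrightarrow> \<theta> (j, k) = 0"
  have "(MAX k\<in>{1..2 ^ j}. \<bar>\<theta> (j, k)\<bar>) = (MAX k\<in>{1..2 ^ j :: nat}. (0 :: real))"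
    using z by (intro arg_cong[of _ _ Max] image_cong) auto
  also have "\<dots> = 0" by simp
  finally show ?thesis using z by (simp add: level_norm_def)
qed

lemma level_norm_nonneg: "0 \<le> level_norm p \<theta> j"
proof (cases "p = \<infinity>")
  case True
  have "\<bar>\<theta> (j, 1)\<bar> \<le> (MAX k\<in>{1..2 ^ j}. \<bar>\<theta> (j, k)\<bar>)"
    by (intro Max_ge) auto
  then have "0 \<le> (MAX k\<in>{1..2 ^ j}. \<bar>\<theta> (j, k)\<bar>)" by (rule order_trans[OF abs_ge_zero])
  then show ?thesis using True by (simp add: level_norm_def)
qed (simp add: level_norm_def)

lemma enn2real_inverse: "0 < p \<Longrightarrow> p \<noteq> \<infinity> \<Longrightarrow> enn2real (1 / p) = 1 / enn2real p"
  by (cases p) (auto simp: divide_ennreal simp flip: ennreal_1)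

lemma level_norm_le:
  assumes p: "0 < p" and e: "0 \<le> e" and le: "\<And>k. k \<in> {1..2 ^ j} \<Longrightarrow> \<bar>\<theta> (j, k)\<bar> \<le> e"
  shows "level_norm p \<theta> j \<le> e * 2 powr (real j * enn2real (1 / p))"
proof (cases "p = \<infinity>")
  case True
  have "(MAX k\<in>{1..2 ^ j}. \<bar>\<theta> (j, k)\<bar>) \<le> e" using le by (intro Max.boundedI) auto
  then show ?thesis using True by (simp add: level_norm_def ennreal_divide_top)
next
  case False
  define r where "r = enn2real p"
  have r: "0 < r" using p False by (simp add: r_def enn2real_positive_iff less_top)
  have "(\<Sum>k = 1..2 ^ j. \<bar>\<theta> (j, k)\<bar> powr r) \<le> (\<Sum>k = 1..2 ^ j :: nat. e powr r)"
    using le r by (intro sum_mono powr_mono2) auto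
  also have "\<dots> = 2 powr real j * e powr r" by (simp add: powr_realpow)
  finally have "(\<Sum>k = 1..2 ^ j. \<bar>\<theta> (j, k)\<bar> powr r) powr (1 / r) \<le> (2 powr real j * e powr r) powr (1 / r)"
    using r by (intro powr_mono2 sum_nonneg) auto
  also have "\<dots> = e * 2 powr (real j * (1 / r))"
    using r e by (simp add: powr_mult powr_powr mult.commute)
  finally show ?thesis using False p by (simp add: level_norm_def enn2real_inverse flip: r_def)
qed

text \<open>A sequence on one level enters the norm through the number of its coefficients only: the factor
\<open>2 powr (j / p)\<close> from the level norm cancels the term \<open>- 1 / p\<close> of the smoothness index. Hence the side of
the cube is the same for all \<open>p\<close> and \<open>q\<close>, and so is the lower bound.\<close>

lemma single_level_in_besov_ball:
  assumes p: "0 < p" and q: "0 < q" and M: "0 < M"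
    and small: "\<And>k. k \<in> {1..2 ^ j} \<Longrightarrow> \<bar>\<theta> (j, k)\<bar> \<le> M * 2 powr (- real j * (\<alpha> + 1 / 2))"
    and zero: "\<And>i k. i \<noteq> j \<Longrightarrow> \<theta> (i, k) = 0"
  shows "\<theta> \<in> besov_ball \<alpha> p q M"
proof -
  define w where "w i = 2 powr (real i * besov_s \<alpha> p) * level_norm p \<theta> i" for i
  have w0: "w i = 0" if "i \<noteq> j" for i
    using zero[OF that] by (simp add: w_def level_norm_zero)
  have wj0: "0 \<le> w i" for i by (simp add: w_def level_norm_nonneg)
  have "w j \<le> 2 powr (real j * besov_s \<alpha> p) * (M * 2 powr (- real j * (\<alpha> + 1 / 2)) * 2 powr (real j * enn2real (1 / p)))"
    unfolding w_def using p M small by (intro mult_left_mono level_norm_le) auto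
  also have "\<dots> = M * 2 powr (real j * besov_s \<alpha> p + (- real j * (\<alpha> + 1 / 2)) + real j * enn2real (1 / p))"
    by (simp only: powr_add) simp
  also have "real j * besov_s \<alpha> p + (- real j * (\<alpha> + 1 / 2)) + real j * enn2real (1 / p) = 0"
    by (simp add: besov_s_def algebra_simps)
  finally have wj: "w j \<le> M" by simp
  have "besov_norm \<alpha> p q \<theta> \<le> ennreal M"
  proof (cases "q = \<infinity>")
    case True
    have "w i \<le> M" for i using w0[of i] wj M by (cases "i = j") auto
    then show ?thesis using True by (auto simp: besov_norm_def Let_def w_def[symmetric] intro!: SUP_least ennreal_leI)
  next
    case False
    define r where "r = enn2real q"
    have r: "0 < r" using q False by (simp add: r_def enn2real_positive_iff less_top)
    have "(\<Sum>i. ennreal (w i powr r)) = (\<Sum>i\<in>{j}. ennreal (w i powr r))"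
      using w0 by (intro suminf_finite) auto
    then have "besov_norm \<alpha> p q \<theta> = ennreal ((w j powr r) powr (1 / r))"
      using False by (simp add: besov_norm_def Let_def ennpowr_def flip: w_def r_def)
    also have "(w j powr r) powr (1 / r) = w j" using r wj0[of j] by (simp add: powr_powr)
    finally show ?thesis using wj by (simp add: ennreal_leI)
  qed
  then show ?thesis by (simp add: besov_ball_def)
qed

lemma dyadic_bracket:
  assumes "1 \<le> (x :: real)"
  obtains j :: nat where "2 ^ j \<le> x" "x < 2 * 2 ^ j"
proof -
  obtain j where j: "2 ^ j \<le> nat \<lfloor>x\<rfloor>" "nat \<lfloor>x\<rfloor> < 2 ^ (j + 1)"
    using ex_power_ivl1[of 2 "nat \<lfloor>x\<rfloor>"] assms by (auto simp: le_nat_iff le_floor_iff)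
  have "real (2 ^ j) \<le> real (nat \<lfloor>x\<rfloor>)" using j(1) by (simp only: of_nat_le_iff)
  also have "\<dots> \<le> x" using assms by linarith
  finally have 1: "2 ^ j \<le> x" by simp
  have "x < real (nat \<lfloor>x\<rfloor> + 1)" using assms by linarith
  also have "\<dots> \<le> real (2 ^ (j + 1))" using j(2) by (simp only: of_nat_le_iff)
  finally have "x < 2 * 2 ^ j" by (simp add: power_add)
  with 1 show thesis by (rule that)
qed

definition level :: "nat \<Rightarrow> (nat \<times> nat) set" where
  "level j = {j} \<times> {1..2 ^ j}"

lemma level_facts: "finite (level j)" "level j \<subseteq> coeffs" "card (level j) = 2 ^ j" "level j \<noteq> {}"
  by (auto simp: level_def coeffs_def)

lemma sq_loss_ge_level: "ennreal (\<Sum>c\<in>level j. (t c - \<theta> c)\<^sup>2) \<le> sq_loss t \<theta>"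
proof -
  have "ennreal (\<Sum>c\<in>level j. (t c - \<theta> c)\<^sup>2) = (\<Sum>c\<in>level j. ennreal ((t c - \<theta> c)\<^sup>2))"
    by simp
  also have "\<dots> = (\<Sum>k = 1..2 ^ j. ennreal ((t (j, k) - \<theta> (j, k))\<^sup>2))"
  proof -
    have "level j = Pair j ` {1..2 ^ j}" by (auto simp: level_def)
    then show ?thesis by (simp add: sum.reindex inj_on_def)
  qed
  also have "\<dots> = (\<Sum>i\<in>{j}. \<Sum>k = 1..2 ^ i. ennreal ((t (i, k) - \<theta> (i, k))\<^sup>2))" by simp
  also have "\<dots> \<le> sq_loss t \<theta>"
    unfolding sq_loss_def by (intro sum_le_suminf) auto
  finally show ?thesis .
qed

(* Machines and coefficients are numbered from 1. Rewriting 1 to Suc 0 would turn the index set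
   into a different term and stop the facts about the experiment from matching. *)
declare One_nat_def [simp del]

text \<open>A distributed estimator within the budget, seen through a prior on the cube of side \<open>2 * \<delta>\<close> at level
\<open>j\<close>. The bound on \<open>\<delta>\<close> places the cube in the Besov ball, so that the Bayes risk is at most the maximal
risk and the budget holds for every parameter in the cube.\<close>

locale besov_level =
  fixes p q :: ennreal and \<alpha> \<sigma> M B \<delta> :: real and m j :: nat and Z :: transcripts and D :: central
  assumes p: "0 < p" and q: "0 < q" and \<sigma>: "0 < \<sigma>" and M: "0 < M" and B: "0 < B"
    and ZD: "(Z, D) \<in> dist_estimators m \<sigma> B (besov_ball \<alpha> p q M)"
    and \<delta>: "0 < \<delta>" "\<delta> \<le> M * 2 powr (- real j * (\<alpha> + 1 / 2))"
begin

abbreviation \<theta> :: "(nat \<times> nat \<Rightarrow> real) \<Rightarrow> nat \<times> nat \<Rightarrow> real" where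
  "\<theta> u \<equiv> extend_zero (level j) u"

abbreviation string_law :: "nat \<Rightarrow> (nat \<times> nat \<Rightarrow> real) \<Rightarrow> bool list pmf" where
  "string_law i u \<equiv> gaussian_channel.law \<sigma> (Z i) (\<theta> u)"

abbreviation max_risk :: ennreal where
  "max_risk \<equiv> (SUP \<theta>\<in>besov_ball \<alpha> p q M. risk m \<sigma> (Z, D) \<theta>)"

lemma machine: "i \<in> {1..m} \<Longrightarrow> gaussian_channel \<sigma> (Z i)"
  using ZD \<sigma> by unfold_locales (auto simp: dist_estimators_def valid_transcripts_def)

lemma cube_in_ball:
  assumes "\<forall>c\<in>level j. \<bar>u c\<bar> \<le> \<delta>" shows "\<theta> u \<in> besov_ball \<alpha> p q M"
  using assms \<delta>(2)
  by (intro single_level_in_besov_ball[OF p q M, where j = j]) (force simp: extend_zero_def level_def)+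

lemma nonempty_string:
  assumes i: "i \<in> {1..m}" and z: "z \<in> set_pmf (string_law i u)" shows "z \<noteq> []"
proof -
  have "valid_transcripts m Z" using ZD by (simp add: dist_estimators_def)
  then obtain C where C: "[] \<notin> C" "\<And>x. x \<in> space seq_space \<Longrightarrow> set_pmf (Z i x) \<subseteq> C"
    unfolding valid_transcripts_def using i by blast
  have "set_pmf (string_law i u) \<subseteq> C"
    unfolding gaussian_channel.law_def[OF machine[OF i]]
    using C(2) by (intro channel.set_mixture_pmf[OF gaussian_channel.channel[OF machine[OF i]]]) simp
  then show ?thesis using C(1) z by auto
qed

lemma level_coeffs: "c \<in> level j \<Longrightarrow> c \<in> coeffs"
  using level_facts(2) by auto

lemma central_component_measurable:
  assumes c: "c \<in> level j" shows "(\<lambda>t. t c) \<in> borel_measurable (D y)"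
proof -
  have DS: "sets (D y) = sets seq_space" using ZD by (simp add: dist_estimators_def valid_central_def)
  show ?thesis
    using measurable_component_singleton[OF level_coeffs[OF c], of "\<lambda>_. borel :: real measure"]
    by (simp add: measurable_cong_sets[OF DS refl])
qed

sublocale smooth_product_experiment "{1..m}" "level j" string_law "[]" \<delta> D
  "\<lambda>i u. gaussian_channel.score \<sigma> (Z i) (\<theta> u)"
proof (intro smooth_product_experiment.intro product_experiment.intro smooth_product_experiment_axioms.intro, goal_cases)
  case (4 i z)
  then show ?case
    using level_facts by (intro gaussian_channel.pmf_law_measurable[OF machine, where c = "(j, 1)"])
      (auto simp: coeffs_def)
next
  case (5 y)
  then show ?case using ZD by (simp add: dist_estimators_def valid_central_def)
next
  case (6 c y)
  then show ?case by (rule central_component_measurable)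
next
  case (7 i c u z s)
  then show ?case
    unfolding extend_zero_update[OF 7(2)] by (intro gaussian_channel.DERIV_pmf_law machine level_coeffs)
next
  case (8 i c u z)
  then show ?case
    unfolding extend_zero_update[OF 8(2)] by (intro gaussian_channel.continuous_pmf_law_score machine level_coeffs)
next
  case (9 i c z)
  then show ?case
    by (intro gaussian_channel.score_measurable machine level_coeffs level_facts)
next
  case (10 i c u)
  then show ?case by (intro gaussian_channel.integral_score machine level_coeffs)
next
  case (11 i c u)
  then show ?case by (intro gaussian_channel.integrable_score_square machine level_coeffs)
qed (use \<delta> in \<open>auto simp: level_facts\<close>)

lemma transcript_law:
  "(\<integral>\<^sup>+X. \<integral>\<^sup>+y. F y \<partial>measure_pmf (transcripts_given m Z X) \<partial>data_law m \<sigma> (\<theta> u))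
    = (\<integral>\<^sup>+y. F y \<partial>measure_pmf (joint u))"
proof -
  have "(\<integral>\<^sup>+X. \<integral>\<^sup>+y. F y \<partial>measure_pmf (transcripts_given m Z X) \<partial>data_law m \<sigma> (\<theta> u))
    = (\<integral>\<^sup>+y. F y \<partial>measure_pmf (Pi_pmf {1..m} [] (\<lambda>i. mixture_pmf (machine_law \<sigma> (\<theta> u)) (Z i))))"
    unfolding transcripts_given_def data_law_def
  proof (rule nn_integral_product_channel)
    show "channel (machine_law \<sigma> (\<theta> u)) (Z i)" if "i \<in> {1..m}" for i
      by (rule gaussian_channel.channel[OF machine[OF that]])
  qed (auto intro: prob_space_machine_law[OF \<sigma>])
  also have "Pi_pmf {1..m} [] (\<lambda>i. mixture_pmf (machine_law \<sigma> (\<theta> u)) (Z i)) = joint u"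
    unfolding joint_def by (intro Pi_pmf_cong refl) (simp add: gaussian_channel.law_def[OF machine])
  finally show ?thesis .
qed

lemma bayes_risk_le_max_risk: "bayes_risk \<le> max_risk"
proof -
  interpret prior: prob_space prior by (rule prob_space_prior)
  have "bayes_risk \<le> (\<integral>\<^sup>+u. max_risk \<partial>prior)"
    unfolding bayes_risk_def
  proof (rule nn_integral_mono_AE)
    show "AE u in prior. (\<integral>\<^sup>+y. \<integral>\<^sup>+t. ennreal (\<Sum>c\<in>level j. (t c - u c)\<^sup>2) \<partial>D y \<partial>measure_pmf (joint u)) \<le> max_risk"
      using AE_prior_cube
    proof eventually_elim
      case (elim u)
      have "(\<Sum>c\<in>level j. (t c - u c)\<^sup>2) = (\<Sum>c\<in>level j. (t c - \<theta> u c)\<^sup>2)" for t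
        by (intro sum.cong) (auto simp: extend_zero_def)
      then have "(\<integral>\<^sup>+y. \<integral>\<^sup>+t. ennreal (\<Sum>c\<in>level j. (t c - u c)\<^sup>2) \<partial>D y \<partial>measure_pmf (joint u))
          \<le> (\<integral>\<^sup>+y. \<integral>\<^sup>+t. sq_loss t (\<theta> u) \<partial>D y \<partial>measure_pmf (joint u))"
        by (intro nn_integral_mono) (simp add: sq_loss_ge_level)
      also have "\<dots> = risk m \<sigma> (Z, D) (\<theta> u)"
        by (simp add: risk_def transcript_law)
      also have "\<dots> \<le> max_risk"
        using cube_in_ball[OF elim] by (rule SUP_upper)
      finally show ?case .
    qed
  qed
  then show ?thesis by (simp add: prior.emeasure_space_1)
qed

lemma expected_length:
  assumes "\<forall>c\<in>level j. \<bar>u c\<bar> \<le> \<delta>"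
  shows "(\<integral>\<^sup>+y. (\<Sum>i\<in>{1..m}. of_nat (length (y i))) \<partial>measure_pmf (joint u)) \<le> ennreal B"
proof -
  have "(\<integral>\<^sup>+y. (\<Sum>i\<in>{1..m}. of_nat (length (y i))) \<partial>measure_pmf (joint u)) = expected_cost m \<sigma> Z (\<theta> u)"
    by (simp add: expected_cost_def transcript_law)
  also have "\<dots> \<le> (SUP \<theta>\<in>besov_ball \<alpha> p q M. expected_cost m \<sigma> Z \<theta>)"
    using cube_in_ball[OF assms] by (rule SUP_upper)
  also have "\<dots> \<le> ennreal B" using ZD by (simp add: dist_estimators_def)
  finally show ?thesis .
qed

lemma nn_integral_joint_component:
  assumes i: "i \<in> {1..m}"
  shows "(\<integral>\<^sup>+y. f (y i) \<partial>measure_pmf (joint u)) = (\<integral>\<^sup>+z. f z \<partial>measure_pmf (string_law i u))"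
proof -
  have e: "map_pmf (\<lambda>y. y i) (joint u) = string_law i u"
    using Pi_pmf_component[of "{1..m}" i "[]" "\<lambda>i. string_law i u"] i by (simp add: joint_def)
  show ?thesis by (subst e[symmetric]) simp
qed

lemma expected_length_sum:
  assumes "\<forall>c\<in>level j. \<bar>u c\<bar> \<le> \<delta>"
  shows "(\<Sum>i\<in>{1..m}. \<integral>\<^sup>+z. of_nat (length z) \<partial>measure_pmf (string_law i u)) \<le> ennreal B"
  using expected_length[OF assms] by (simp add: nn_integral_sum nn_integral_joint_component[where f = "\<lambda>z. of_nat (length z)"])

text \<open>Every machine sends at least one bit, because the empty string is no codeword. This bounds the
additive constants of the information inequalities, one per machine, by the budget.\<close>

lemma machines_le_budget: "real m \<le> B"
proof -
  have 0: "\<forall>c\<in>level j. \<bar>(\<lambda>_. 0 :: real) c\<bar> \<le> \<delta>" using \<delta> by simp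
  have "of_nat m = (\<Sum>i\<in>{1..m}. \<integral>\<^sup>+z. 1 \<partial>measure_pmf (string_law i (\<lambda>_. 0)))"
    by (simp add: measure_pmf.emeasure_space_1)
  also have "\<dots> \<le> (\<Sum>i\<in>{1..m}. \<integral>\<^sup>+z. of_nat (length z) \<partial>measure_pmf (string_law i (\<lambda>_. 0)))"
  proof (intro sum_mono nn_integral_mono_AE)
    fix i assume i: "i \<in> {1..m}"
    show "AE z in measure_pmf (string_law i (\<lambda>_. 0)). (1 :: ennreal) \<le> of_nat (length z)"
      unfolding AE_measure_pmf_iff
    proof
      fix z assume "z \<in> set_pmf (string_law i (\<lambda>_. 0))"
      then have "1 \<le> length z" using nonempty_string[OF i] by (cases z) auto
      then show "(1 :: ennreal) \<le> of_nat (length z)"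
        using of_nat_mono[of 1 "length z"] by simp
    qed
  qed
  also have "\<dots> \<le> ennreal B" by (rule expected_length_sum[OF 0])
  finally show ?thesis using B by (simp add: ennreal_of_nat_eq_real_of_nat)
qed

lemma neg_ln_code_le:
  "i \<in> {1..m} \<Longrightarrow> z \<in> set_pmf (string_law i u) \<Longrightarrow> - ln (pmf code_pmf z) \<le> 3 * real (length z)"
  using nonempty_string neg_ln_code_pmf by force

lemma quantization_risk:
  "ennreal (\<delta>\<^sup>2 / (pi * exp 16) * (8 * 2 ^ j - 3 * B - 1)) \<le> max_risk"
proof -
  have "ennreal (\<delta>\<^sup>2 / (pi * exp 16) * (8 * real (card (level j)) - 3 * B - 1)) \<le> bayes_risk"
  proof (rule quantization_bound[OF pmf_code_pmf_pos])
    fix u assume u: "\<forall>c\<in>level j. \<bar>u c\<bar> \<le> \<delta>"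
    have "(\<integral>\<^sup>+y. ennreal (\<Sum>i\<in>{1..m}. - ln (pmf code_pmf (y i))) \<partial>measure_pmf (joint u))
       \<le> (\<integral>\<^sup>+y. ennreal 3 * (\<Sum>i\<in>{1..m}. of_nat (length (y i))) \<partial>measure_pmf (joint u))"
    proof (intro nn_integral_mono_AE, unfold AE_measure_pmf_iff, intro ballI)
      fix y assume y: "y \<in> set_pmf (joint u)"
      then have yi: "y i \<in> set_pmf (string_law i u)" if "i \<in> {1..m}" for i
        using that by (auto simp: joint_def set_Pi_pmf PiE_dflt_def)
      have "(\<Sum>i\<in>{1..m}. - ln (pmf code_pmf (y i))) \<le> 3 * (\<Sum>i\<in>{1..m}. real (length (y i)))"
        unfolding sum_distrib_left
      proof (rule sum_mono)
        fix i assume i: "i \<in> {1..m}"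
        show "- ln (pmf code_pmf (y i)) \<le> 3 * real (length (y i))"
          by (rule neg_ln_code_le[OF i yi[OF i]])
      qed
      then have "ennreal (\<Sum>i\<in>{1..m}. - ln (pmf code_pmf (y i))) \<le> ennreal (3 * (\<Sum>i\<in>{1..m}. real (length (y i))))"
        by (rule ennreal_leI)
      also have "\<dots> = ennreal 3 * ennreal (\<Sum>i\<in>{1..m}. real (length (y i)))"
        by (intro ennreal_mult) (auto intro: sum_nonneg)
      also have "ennreal (\<Sum>i\<in>{1..m}. real (length (y i))) = (\<Sum>i\<in>{1..m}. of_nat (length (y i)))"
        by (simp add: ennreal_of_nat_eq_real_of_nat flip: sum_ennreal)
      finally show "ennreal (\<Sum>i\<in>{1..m}. - ln (pmf code_pmf (y i))) \<le> ennreal 3 * (\<Sum>i\<in>{1..m}. of_nat (length (y i)))" .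
    qed
    also have "\<dots> = ennreal 3 * (\<integral>\<^sup>+y. (\<Sum>i\<in>{1..m}. of_nat (length (y i))) \<partial>measure_pmf (joint u))"
      by (rule nn_integral_cmult) simp
    also have "\<dots> \<le> ennreal 3 * ennreal B" by (intro mult_left_mono expected_length u) simp
    also have "\<dots> = ennreal (3 * B)" using B by (intro ennreal_mult[symmetric]) auto
    finally show "(\<integral>\<^sup>+y. ennreal (\<Sum>i\<in>{1..m}. - ln (pmf code_pmf (y i))) \<partial>measure_pmf (joint u)) \<le> ennreal (3 * B)" .
  qed (use B in auto)
  then show ?thesis using bayes_risk_le_max_risk by (simp add: level_facts)
qed

text \<open>The information bound that ignores communication: \<open>m\<close> machines carry at most \<open>m / \<sigma>\<^sup>2\<close> per coordinate.\<close>

lemma centralized_risk: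
  "ennreal ((2 ^ j)\<^sup>2 / (2 * (real m * 2 ^ j / \<sigma>\<^sup>2) + 20 * 2 ^ j / \<delta>\<^sup>2)) \<le> max_risk"
proof -
  have "ennreal ((real (card (level j)))\<^sup>2 / (2 * (real m * 2 ^ j / \<sigma>\<^sup>2) + 20 * real (card (level j)) / \<delta>\<^sup>2)) \<le> bayes_risk"
  proof (rule van_trees_bound)
    fix u
    have "(\<Sum>i\<in>{1..m}. \<Sum>c\<in>level j. \<integral>\<^sup>+z. ennreal ((gaussian_channel.score \<sigma> (Z i) (\<theta> u) z c)\<^sup>2) \<partial>measure_pmf (string_law i u))
       \<le> (\<Sum>i\<in>{1..m}. \<Sum>c\<in>level j. ennreal (1 / \<sigma>\<^sup>2))"
      using level_facts(2) by (intro sum_mono gaussian_channel.nn_integral_score_square machine) auto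
    also have "\<dots> = ennreal (\<Sum>i\<in>{1..m}. \<Sum>c\<in>level j. 1 / \<sigma>\<^sup>2)"
      by (simp add: sum_nonneg del: sum_constant)
    also have "(\<Sum>i\<in>{1..m}. \<Sum>c\<in>level j. 1 / \<sigma>\<^sup>2) = real m * 2 ^ j / \<sigma>\<^sup>2" by (simp add: level_facts)
    finally show "(\<Sum>i\<in>{1..m}. \<Sum>c\<in>level j. \<integral>\<^sup>+z. ennreal ((gaussian_channel.score \<sigma> (Z i) (\<theta> u) z c)\<^sup>2) \<partial>measure_pmf (string_law i u))
       \<le> ennreal (real m * 2 ^ j / \<sigma>\<^sup>2)" .
  qed (auto simp: level_facts)
  then show ?thesis using bayes_risk_le_max_risk by (simp add: level_facts)
qed

text \<open>The information bound that ignores the number of machines: the transcripts carry information of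
order \<open>B / \<sigma>\<^sup>2\<close> in total, to be shared by all coordinates.\<close>

lemma communication_risk:
  "ennreal ((2 ^ j)\<^sup>2 / (2 * (8 * B / \<sigma>\<^sup>2) + 20 * 2 ^ j / \<delta>\<^sup>2)) \<le> max_risk"
proof -
  have "ennreal ((real (card (level j)))\<^sup>2 / (2 * (8 * B / \<sigma>\<^sup>2) + 20 * real (card (level j)) / \<delta>\<^sup>2)) \<le> bayes_risk"
  proof (rule van_trees_bound)
    fix u assume u: "\<forall>c\<in>level j. \<bar>u c\<bar> \<le> \<delta>"
    let ?a = "\<lambda>i z c. gaussian_channel.score \<sigma> (Z i) (\<theta> u) z c"
    have one: "(\<integral>\<^sup>+z. ennreal (\<sigma>\<^sup>2 / 2 * (\<Sum>c\<in>level j. (?a i z c)\<^sup>2)) \<partial>measure_pmf (string_law i u))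
        \<le> ennreal 3 * (\<integral>\<^sup>+z. of_nat (length z) \<partial>measure_pmf (string_law i u)) + 1" if i: "i \<in> {1..m}" for i
    proof -
      have "(\<integral>\<^sup>+z. ennreal (\<sigma>\<^sup>2 / 2 * (\<Sum>c\<in>level j. (?a i z c)\<^sup>2)) \<partial>measure_pmf (string_law i u))
        \<le> (\<integral>\<^sup>+z. ennreal (- ln (pmf code_pmf z)) \<partial>measure_pmf (string_law i u)) + 1"
        by (intro gaussian_channel.score_information[OF machine[OF i]] level_facts pmf_code_pmf_pos)
      also have "(\<integral>\<^sup>+z. ennreal (- ln (pmf code_pmf z)) \<partial>measure_pmf (string_law i u))
         \<le> (\<integral>\<^sup>+z. ennreal 3 * of_nat (length z) \<partial>measure_pmf (string_law i u))"
      proof (intro nn_integral_mono_AE, unfold AE_measure_pmf_iff, intro ballI)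
        fix z assume "z \<in> set_pmf (string_law i u)"
        then have "ennreal (- ln (pmf code_pmf z)) \<le> ennreal (3 * real (length z))"
          by (intro ennreal_leI neg_ln_code_le[OF i])
        also have "\<dots> = ennreal 3 * of_nat (length z)"
          by (simp add: ennreal_of_nat_eq_real_of_nat ennreal_mult)
        finally show "ennreal (- ln (pmf code_pmf z)) \<le> ennreal 3 * of_nat (length z)" .
      qed
      also have "\<dots> = ennreal 3 * (\<integral>\<^sup>+z. of_nat (length z) \<partial>measure_pmf (string_law i u))"
        by (rule nn_integral_cmult) simp
      finally show ?thesis by (simp add: add_right_mono)
    qed
    let ?S = "\<Sum>i\<in>{1..m}. \<Sum>c\<in>level j. \<integral>\<^sup>+z. ennreal ((?a i z c)\<^sup>2) \<partial>measure_pmf (string_law i u)"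
    have "(\<Sum>c\<in>level j. \<integral>\<^sup>+z. ennreal ((?a i z c)\<^sup>2) \<partial>measure_pmf (string_law i u))
       = ennreal (2 / \<sigma>\<^sup>2) * (\<integral>\<^sup>+z. ennreal (\<sigma>\<^sup>2 / 2 * (\<Sum>c\<in>level j. (?a i z c)\<^sup>2)) \<partial>measure_pmf (string_law i u))" for i
    proof -
      have "(\<Sum>c\<in>level j. \<integral>\<^sup>+z. ennreal ((?a i z c)\<^sup>2) \<partial>measure_pmf (string_law i u))
        = (\<integral>\<^sup>+z. ennreal (\<Sum>c\<in>level j. (?a i z c)\<^sup>2) \<partial>measure_pmf (string_law i u))"
        by (subst nn_integral_sum[symmetric]) auto
      also have "\<dots> = (\<integral>\<^sup>+z. ennreal (2 / \<sigma>\<^sup>2) * ennreal (\<sigma>\<^sup>2 / 2 * (\<Sum>c\<in>level j. (?a i z c)\<^sup>2)) \<partial>measure_pmf (string_law i u))"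
        using \<sigma> by (intro nn_integral_cong) (subst ennreal_mult[symmetric]; auto intro!: sum_nonneg mult_nonneg_nonneg)
      finally show ?thesis by (simp add: nn_integral_cmult)
    qed
    then have "?S = ennreal (2 / \<sigma>\<^sup>2) * (\<Sum>i\<in>{1..m}. \<integral>\<^sup>+z. ennreal (\<sigma>\<^sup>2 / 2 * (\<Sum>c\<in>level j. (?a i z c)\<^sup>2)) \<partial>measure_pmf (string_law i u))"
      by (simp only: sum_distrib_left)
    also have "\<dots> \<le> ennreal (2 / \<sigma>\<^sup>2) * (\<Sum>i\<in>{1..m}. ennreal 3 * (\<integral>\<^sup>+z. of_nat (length z) \<partial>measure_pmf (string_law i u)) + 1)"
      by (intro mult_left_mono sum_mono one) auto
    also have "\<dots> = ennreal (2 / \<sigma>\<^sup>2) * (ennreal 3 * (\<Sum>i\<in>{1..m}. \<integral>\<^sup>+z. of_nat (length z) \<partial>measure_pmf (string_law i u)) + of_nat m)"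
      by (simp add: sum.distrib sum_distrib_left)
    also have "\<dots> \<le> ennreal (2 / \<sigma>\<^sup>2) * (ennreal 3 * ennreal B + ennreal B)"
      using machines_le_budget
      by (intro mult_left_mono add_mono expected_length_sum u) (auto simp: ennreal_of_nat_eq_real_of_nat ennreal_leI)
    also have "ennreal 3 * ennreal B = ennreal (3 * B)" using B by (intro ennreal_mult[symmetric]) auto
    also have "ennreal (2 / \<sigma>\<^sup>2) * (ennreal (3 * B) + ennreal B) = ennreal (8 * B / \<sigma>\<^sup>2)"
      using B by (simp flip: ennreal_plus ennreal_mult)
    finally show "?S \<le> ennreal (8 * B / \<sigma>\<^sup>2)" .
  qed (use B in \<open>auto simp: level_facts\<close>)
  then show ?thesis using bayes_risk_le_max_risk by (simp add: level_facts)
qed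

end

section \<open>The three rates\<close>

lemma dyadic_powr: "(2 ^ j :: real) powr b = 2 powr (real j * b)"
  by (simp add: powr_powr flip: powr_realpow)

lemma square_two_powr: "(2 powr e)\<^sup>2 = (2 :: real) powr (2 * e)"
proof -
  have "(2 powr e)\<^sup>2 = (2 :: real) powr (e + e)" by (simp only: power2_eq_square powr_add)
  then show ?thesis by simp
qed

lemma cube_radius_le:
  fixes r M \<alpha> :: real and j :: nat
  assumes M: "0 < M" and r: "r * (2 ^ j) powr (2 * \<alpha> + 1) \<le> M\<^sup>2"
  shows "sqrt r \<le> M * 2 powr (- real j * (\<alpha> + 1 / 2))"
proof (rule real_le_lsqrt)
  have "(2 ^ j :: real) powr (2 * \<alpha> + 1) * (2 powr (- real j * (\<alpha> + 1 / 2)))\<^sup>2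
      = 2 powr (real j * (2 * \<alpha> + 1) + 2 * (- real j * (\<alpha> + 1 / 2)))"
    by (simp only: dyadic_powr square_two_powr powr_add[symmetric])
  also have "\<dots> = 1" by (simp add: algebra_simps)
  finally have one: "(2 ^ j :: real) powr (2 * \<alpha> + 1) * (2 powr (- real j * (\<alpha> + 1 / 2)))\<^sup>2 = 1" .
  have "r = r * ((2 ^ j) powr (2 * \<alpha> + 1) * (2 powr (- real j * (\<alpha> + 1 / 2)))\<^sup>2)" by (simp only: one mult_1_right)
  also have "\<dots> = (r * (2 ^ j) powr (2 * \<alpha> + 1)) * (2 powr (- real j * (\<alpha> + 1 / 2)))\<^sup>2"
    by (simp only: mult.assoc)
  also have "\<dots> \<le> M\<^sup>2 * (2 powr (- real j * (\<alpha> + 1 / 2)))\<^sup>2"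
    using r by (intro mult_right_mono) auto
  finally show "r \<le> (M * 2 powr (- real j * (\<alpha> + 1 / 2)))\<^sup>2" by (simp add: power_mult_distrib)
qed (use M in auto)

lemma rate_power_identity:
  fixes M K a :: real
  assumes "0 < M" "0 < K"
  shows "(M\<^sup>2 / K) powr a * K = M powr (2 * a) * K powr (1 - a)"
proof -
  have "(M\<^sup>2 / K) powr a * K = (M powr 2) powr a / K powr a * K powr 1"
    using assms by (simp add: powr_divide)
  also have "\<dots> = M powr (2 * a) * K powr (1 - a)"
    by (simp add: powr_powr powr_diff)
  finally show ?thesis .
qed

text \<open>With about one bit per coefficient, \<open>2 ^ j \<le> B < 2 ^ (j + 1)\<close>, a fixed fraction of the squared size of the
full cube is lost. Choosing \<open>2 ^ j\<close> below \<open>B\<close>, and not above, keeps the constant free of \<open>\<alpha>\<close>.\<close>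

lemma rate_small_budget:
  assumes \<alpha>: "0 < \<alpha>" and B: "1 \<le> B" and M: "0 < M"
    and risk: "\<And>j \<delta>. 0 < \<delta> \<Longrightarrow> \<delta> \<le> M * 2 powr (- real j * (\<alpha> + 1 / 2)) \<Longrightarrow>
        ennreal (\<delta>\<^sup>2 / (pi * exp 16) * (8 * 2 ^ j - 3 * B - 1)) \<le> R"
  shows "ennreal (1 / (pi * exp 16) * (M\<^sup>2 * B powr (- 2 * \<alpha>))) \<le> R"
proof -
  obtain j where j: "2 ^ j \<le> B" "B < 2 * 2 ^ j" using dyadic_bracket[OF B] .
  define \<delta> where "\<delta> = M * 2 powr (- real j * (\<alpha> + 1 / 2))"
  have \<delta>: "0 < \<delta>" using M by (simp add: \<delta>_def)
  have "\<delta>\<^sup>2 * 2 ^ j = M\<^sup>2 * (2 powr (2 * (- real j * (\<alpha> + 1 / 2)) + real j))"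
    by (simp only: \<delta>_def power_mult_distrib square_two_powr powr_add) (simp add: powr_realpow)
  also have "2 * (- real j * (\<alpha> + 1 / 2)) + real j = real j * (- 2 * \<alpha>)" by (simp add: algebra_simps)
  also have "2 powr (real j * (- 2 * \<alpha>)) = (2 ^ j) powr (- 2 * \<alpha>)" by (simp only: dyadic_powr)
  finally have eq: "\<delta>\<^sup>2 * 2 ^ j = M\<^sup>2 * (2 ^ j) powr (- 2 * \<alpha>)" .
  have "B powr (- 2 * \<alpha>) \<le> (2 ^ j) powr (- 2 * \<alpha>)"
    using \<alpha> j(1) by (intro powr_mono2') auto
  then have "M\<^sup>2 * B powr (- 2 * \<alpha>) \<le> \<delta>\<^sup>2 * 2 ^ j" unfolding eq by (intro mult_left_mono) auto
  also have "\<dots> \<le> \<delta>\<^sup>2 * (8 * 2 ^ j - 3 * B - 1)"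
  proof (rule mult_left_mono)
    have "(1 :: real) \<le> 2 ^ j" by simp
    then show "2 ^ j \<le> 8 * 2 ^ j - 3 * B - 1" using j(2) by linarith
  qed simp
  finally have "1 / (pi * exp 16) * (M\<^sup>2 * B powr (- 2 * \<alpha>)) \<le> 1 / (pi * exp 16) * (\<delta>\<^sup>2 * (8 * 2 ^ j - 3 * B - 1))"
    by (intro mult_left_mono) auto
  then have "ennreal (1 / (pi * exp 16) * (M\<^sup>2 * B powr (- 2 * \<alpha>))) \<le> ennreal (\<delta>\<^sup>2 / (pi * exp 16) * (8 * 2 ^ j - 3 * B - 1))"
    by (intro ennreal_leI) simp
  also have "\<dots> \<le> R" using \<delta> by (intro risk) (simp_all add: \<delta>_def)
  finally show ?thesis .
qed

text \<open>The level balances the largest admissible \<open>\<delta>\<^sup>2\<close>, which is \<open>M\<^sup>2 * d powr (- 2 * \<alpha> - 1)\<close> for \<open>d = 2 ^ j\<close>, and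
the accuracy \<open>d * \<sigma>\<^sup>2 / B\<close> per coefficient that the budget permits. The dyadic rounding of \<open>d\<close> costs a
factor of two.\<close>

lemma rate_medium_budget:
  assumes \<alpha>: "0 < \<alpha>" and B: "1 \<le> B" and \<sigma>: "0 < \<sigma>" "\<sigma> \<le> M"
    and risk: "\<And>j \<delta>. 0 < \<delta> \<Longrightarrow> \<delta> \<le> M * 2 powr (- real j * (\<alpha> + 1 / 2)) \<Longrightarrow>
        ennreal ((2 ^ j)\<^sup>2 / (2 * (8 * B / \<sigma>\<^sup>2) + 20 * 2 ^ j / \<delta>\<^sup>2)) \<le> R"
  shows "ennreal (1 / 144 * (M powr (2 / (\<alpha> + 1)) * (\<sigma>\<^sup>2 / B) powr (\<alpha> / (\<alpha> + 1)))) \<le> R"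
proof -
  have M: "0 < M" using \<sigma> by linarith
  define K where "K = \<sigma>\<^sup>2 / B"
  have K: "0 < K" using \<sigma> B by (simp add: K_def)
  define X where "X = M\<^sup>2 / K"
  have X: "1 \<le> X"
  proof -
    have "K \<le> \<sigma>\<^sup>2" using B by (simp add: K_def divide_le_eq mult_left_mono[of 1 B "\<sigma>\<^sup>2", simplified])
    also have "\<dots> \<le> M\<^sup>2" using \<sigma> by (intro power_mono) auto
    finally show ?thesis using K by (simp add: X_def)
  qed
  define x where "x = X powr (1 / (2 * \<alpha> + 2))"
  have x1: "1 \<le> x" unfolding x_def using X \<alpha> by (intro ge_one_powr_ge_zero) auto
  obtain j where j: "2 ^ j \<le> x" "x < 2 * 2 ^ j" using dyadic_bracket[OF x1] .
  let ?d = "2 ^ j :: real"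
  have "?d powr (2 * \<alpha> + 2) \<le> x powr (2 * \<alpha> + 2)" using j \<alpha> by (intro powr_mono2) auto
  also have "\<dots> = X" using X \<alpha> by (simp add: x_def powr_powr)
  finally have dX: "?d powr (2 * \<alpha> + 2) \<le> X" .
  define \<delta> where "\<delta> = sqrt (?d * K)"
  have \<delta>: "0 < \<delta>" "\<delta>\<^sup>2 = ?d * K" using K by (simp_all add: \<delta>_def)
  have "?d * ?d powr (2 * \<alpha> + 1) = ?d powr (2 * \<alpha> + 2)"
  proof -
    have "?d powr (2 * \<alpha> + 2) = ?d powr (1 + (2 * \<alpha> + 1))" by (simp add: algebra_simps)
    then show ?thesis by (simp only: powr_add) simp
  qed
  then have "?d * K * ?d powr (2 * \<alpha> + 1) \<le> X * K"
    using dX K by (simp add: mult.commute mult.left_commute mult_right_mono)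
  then have ball: "\<delta> \<le> M * 2 powr (- real j * (\<alpha> + 1 / 2))"
    unfolding \<delta>_def using K by (intro cube_radius_le M) (simp add: X_def)
  have rate_eq: "M powr (2 / (\<alpha> + 1)) * K powr (\<alpha> / (\<alpha> + 1)) = x\<^sup>2 * K"
  proof -
    have "x\<^sup>2 = X powr (1 / (\<alpha> + 1))"
    proof -
      have "1 / (2 * \<alpha> + 2) + 1 / (2 * \<alpha> + 2) = 1 / (\<alpha> + 1)" using \<alpha> by (simp add: field_simps)
      then show ?thesis by (simp add: x_def power2_eq_square flip: powr_add)
    qed
    moreover have "1 - 1 / (\<alpha> + 1) = \<alpha> / (\<alpha> + 1)" using \<alpha> by (simp add: field_simps)
    ultimately show ?thesis using rate_power_identity[OF M K, of "1 / (\<alpha> + 1)"] by (simp add: X_def)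
  qed
  have "x\<^sup>2 \<le> (2 * ?d)\<^sup>2" using j x1 by (intro power_mono) auto
  then have "x\<^sup>2 * K / 144 \<le> (2 * ?d)\<^sup>2 * K / 144" using K by (intro divide_right_mono mult_right_mono) auto
  also have "\<dots> = ?d\<^sup>2 / (2 * (8 * B / \<sigma>\<^sup>2) + 20 * ?d / \<delta>\<^sup>2)"
  proof -
    have "2 * (8 * B / \<sigma>\<^sup>2) + 20 * ?d / \<delta>\<^sup>2 = 36 / K"
      unfolding \<delta>(2) using K \<sigma> B by (simp add: K_def field_simps)
    then show ?thesis by (simp add: power_mult_distrib)
  qed
  finally have "ennreal (x\<^sup>2 * K / 144) \<le> ennreal (?d\<^sup>2 / (2 * (8 * B / \<sigma>\<^sup>2) + 20 * ?d / \<delta>\<^sup>2))"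
    by (rule ennreal_leI)
  also have "\<dots> \<le> R" by (rule risk[OF \<delta>(1) ball])
  finally show ?thesis by (simp add: rate_eq flip: K_def)
qed

text \<open>The level balances the largest admissible \<open>\<delta>\<^sup>2\<close> and the noise level \<open>\<sigma>\<^sup>2 / m\<close> of the average of all
observations.\<close>

lemma rate_large_budget:
  assumes \<alpha>: "0 < \<alpha>" and m: "1 \<le> (m :: nat)" and \<sigma>: "0 < \<sigma>" "\<sigma> \<le> M"
    and risk: "\<And>j \<delta>. 0 < \<delta> \<Longrightarrow> \<delta> \<le> M * 2 powr (- real j * (\<alpha> + 1 / 2)) \<Longrightarrow>
        ennreal ((2 ^ j)\<^sup>2 / (2 * (real m * 2 ^ j / \<sigma>\<^sup>2) + 20 * 2 ^ j / \<delta>\<^sup>2)) \<le> R"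
  shows "ennreal (1 / 44 * (M powr (2 / (2 * \<alpha> + 1)) * (\<sigma>\<^sup>2 / real m) powr (2 * \<alpha> / (2 * \<alpha> + 1)))) \<le> R"
proof -
  have M: "0 < M" using \<sigma> by linarith
  define K where "K = \<sigma>\<^sup>2 / real m"
  have K: "0 < K" using \<sigma> m by (simp add: K_def)
  define X where "X = M\<^sup>2 / K"
  have X: "1 \<le> X"
  proof -
    have "K \<le> \<sigma>\<^sup>2" using m by (simp add: K_def divide_le_eq mult_left_mono[of 1 "real m" "\<sigma>\<^sup>2", simplified])
    also have "\<dots> \<le> M\<^sup>2" using \<sigma> by (intro power_mono) auto
    finally show ?thesis using K by (simp add: X_def)
  qed
  define x where "x = X powr (1 / (2 * \<alpha> + 1))"
  have x1: "1 \<le> x" unfolding x_def using X \<alpha> by (intro ge_one_powr_ge_zero) auto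
  obtain j where j: "2 ^ j \<le> x" "x < 2 * 2 ^ j" using dyadic_bracket[OF x1] .
  let ?d = "2 ^ j :: real"
  have "?d powr (2 * \<alpha> + 1) \<le> x powr (2 * \<alpha> + 1)" using j \<alpha> by (intro powr_mono2) auto
  also have "\<dots> = X" using X \<alpha> by (simp add: x_def powr_powr)
  finally have dX: "?d powr (2 * \<alpha> + 1) \<le> X" .
  define \<delta> where "\<delta> = sqrt K"
  have \<delta>: "0 < \<delta>" "\<delta>\<^sup>2 = K" using K by (simp_all add: \<delta>_def)
  have "K * ?d powr (2 * \<alpha> + 1) \<le> K * X"
    using dX K by (intro mult_left_mono) auto
  then have ball: "\<delta> \<le> M * 2 powr (- real j * (\<alpha> + 1 / 2))"
    unfolding \<delta>_def using K by (intro cube_radius_le M) (simp add: X_def)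
  have rate_eq: "M powr (2 / (2 * \<alpha> + 1)) * K powr (2 * \<alpha> / (2 * \<alpha> + 1)) = x * K"
  proof -
    have "1 - 1 / (2 * \<alpha> + 1) = 2 * \<alpha> / (2 * \<alpha> + 1)" using \<alpha> by (simp add: field_simps)
    then show ?thesis using rate_power_identity[OF M K, of "1 / (2 * \<alpha> + 1)"] by (simp add: X_def x_def)
  qed
  have "x * K / 44 \<le> 2 * ?d * K / 44" using K j by (intro divide_right_mono mult_right_mono) auto
  also have "\<dots> = ?d\<^sup>2 / (2 * (real m * ?d / \<sigma>\<^sup>2) + 20 * ?d / \<delta>\<^sup>2)"
  proof -
    have "2 * (real m * ?d / \<sigma>\<^sup>2) + 20 * ?d / \<delta>\<^sup>2 = 22 * ?d / K"
      unfolding \<delta>(2) using K \<sigma> m by (simp add: K_def field_simps)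
    then show ?thesis by (simp add: power2_eq_square)
  qed
  finally have "ennreal (x * K / 44) \<le> ennreal (?d\<^sup>2 / (2 * (real m * ?d / \<sigma>\<^sup>2) + 20 * ?d / \<delta>\<^sup>2))"
    by (rule ennreal_leI)
  also have "\<dots> \<le> R" by (rule risk[OF \<delta>(1) ball])
  finally show ?thesis by (simp add: rate_eq flip: K_def)
qed

theorem theorem2:
  shows "\<exists>c::real. c > 0 \<and>
    (\<forall>(p::ennreal) (q::ennreal) (\<alpha>::real) (\<sigma>::real) (M::real) (m::nat) (B::real).
       0 < p \<longrightarrow> 0 < q \<longrightarrow> 0 < \<alpha> \<longrightarrow> 0 < \<alpha> + 1 / 2 - enn2real (1 / p) \<longrightarrow>
       0 < \<sigma> \<longrightarrow> \<sigma> \<le> M \<longrightarrow> 1 \<le> m \<longrightarrow> 0 < B \<longrightarrow>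
       (INF E\<in>dist_estimators m \<sigma> B (besov_ball \<alpha> p q M).
          SUP \<theta>\<in>besov_ball \<alpha> p q M. risk m \<sigma> E \<theta>)
       \<ge> ennreal (c * rate \<alpha> \<sigma> M m B))"
proof -
  define c where "c = min (1 / (pi * exp 16)) (1 / 144 :: real)"
  have c: "0 < c" "c \<le> 1 / (pi * exp 16)" "c \<le> 1 / 144" "c \<le> 1 / 44"
    by (auto simp: c_def)
  have "ennreal (c * rate \<alpha> \<sigma> M m B) \<le>
      (INF E\<in>dist_estimators m \<sigma> B (besov_ball \<alpha> p q M). SUP \<theta>\<in>besov_ball \<alpha> p q M. risk m \<sigma> E \<theta>)"
    if p: "0 < p" and q: "0 < q" and \<alpha>: "0 < \<alpha>" and \<sigma>: "0 < \<sigma>" "\<sigma> \<le> M" and m: "1 \<le> m" and B: "0 < B"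
    for p q :: ennreal and \<alpha> \<sigma> M B :: real and m :: nat
  proof (rule INF_greatest)
    fix E assume "E \<in> dist_estimators m \<sigma> B (besov_ball \<alpha> p q M)"
    then obtain Z D where E: "E = (Z, D)" and ZD: "(Z, D) \<in> dist_estimators m \<sigma> B (besov_ball \<alpha> p q M)"
      by (cases E) auto
    have M: "0 < M" using \<sigma> by linarith
    have level: "besov_level p q \<alpha> \<sigma> M B \<delta> m j Z D"
      if "0 < \<delta>" "\<delta> \<le> M * 2 powr (- real j * (\<alpha> + 1 / 2))" for j \<delta>
      by unfold_locales (use p q \<sigma> M B ZD that in auto)
    have "real m \<le> B"
      by (rule besov_level.machines_le_budget[OF level[of M 0]]) (use M in auto)
    then have B1: "1 \<le> B" using m by linarith
    let ?R = "SUP \<theta>\<in>besov_ball \<alpha> p q M. risk m \<sigma> (Z, D) \<theta>"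
    have scale: "ennreal (c * r) \<le> ?R" if "ennreal (c' * r) \<le> ?R" "c \<le> c'" "0 \<le> r" for c' r
      using that by (meson ennreal_leI mult_right_mono order_trans)
    have small: "ennreal (c * (M\<^sup>2 * B powr (- 2 * \<alpha>))) \<le> ?R"
      by (rule scale[OF rate_small_budget[OF \<alpha> B1 M] c(2)]) (rule besov_level.quantization_risk[OF level], auto)
    have medium: "ennreal (c * (M powr (2 / (\<alpha> + 1)) * (\<sigma>\<^sup>2 / B) powr (\<alpha> / (\<alpha> + 1)))) \<le> ?R"
      by (rule scale[OF rate_medium_budget[OF \<alpha> B1 \<sigma>] c(3)]) (rule besov_level.communication_risk[OF level], auto)
    have large: "ennreal (c * (M powr (2 / (2 * \<alpha> + 1)) * (\<sigma>\<^sup>2 / real m) powr (2 * \<alpha> / (2 * \<alpha> + 1)))) \<le> ?R"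
      by (rule scale[OF rate_large_budget[OF \<alpha> m \<sigma>] c(4)]) (rule besov_level.centralized_risk[OF level], auto)
    have "ennreal (c * rate \<alpha> \<sigma> M m B) \<le> ?R"
      unfolding rate_def using small medium large by presburger
    then show "ennreal (c * rate \<alpha> \<sigma> M m B) \<le> (SUP \<theta>\<in>besov_ball \<alpha> p q M. risk m \<sigma> E \<theta>)"
      by (simp add: E)
  qed
  then show ?thesis using c(1) by blast
qed

end
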